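(* Let $G\subseteq \mathrm{SL}_2(\mathbb{R})$ be a group and $H$ a subgroup of finite index $d=[G:H]$ such that $-I\in H$ and the images $\bar H,\bar G$ in $\mathrm{PSL}_2(\mathbb{R})$ are Fuchsian groups of the first kind. Let $\rho:H\to\mathrm{GL}_m(\mathbb{C})$ be a finite dimensional representation, $\mathbb{X}(\tau)$ a weakly holomorphic vector-valued automorphic form (vvaf) of weight $0$ associated to $(H,\rho)$, and $\widetilde{\mathbb{X}}(\tau)$ the lifted form associated to $(G,\widetilde\rho)$, $\widetilde\rho=\mathrm{Ind}_H^G(\rho)$. Then there exists a family of weakly holomorphic vvafs $\{\mathbb{X}^{(i)}(\tau)\mid 1\le i\le d\}$ associated to some $\mathrm{SL}_2(\mathbb{R})$-conjugates of $(H,\rho)$ with the following property. Let $\mathbb{X}^{(i)}[n]$ be the $n$-th Fourier coefficient of $\mathbb{X}^{(i)}(\tau)$ and $\widetilde{\mathbb{X}}[n]$ the $n$-th Fourier coefficient of $\widetilde{\mathbb{X}}(\tau)$. Then there exists a set of rationals $\{m_i,n_i,r_i\mid 1\le i\le d\}$ such that $$\widetilde{\mathbb{X}}[n]=\left(r_i\,\mathbb{X}^{(i)}[m_in+n_i]\right)^t_{1\le i\le d}.$$ Furthermore, the quantities $\{m_i,n_i,r_i\mid 1\le i\le d\}$ depend only on $H$, $G$ and $\rho$, but not on the vvaf $\mathbb{X}(\tau)$.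
   Context: **Groups and cusps.** $\mathbb{H}$ is the upper half plane; matrices act by Möbius transformations. A Fuchsian group of the first kind is a discrete subgroup of $\mathrm{PSL}_2(\mathbb{R})$ whose quotient of $\mathbb{H}$ is a Riemann surface with finitely many punctures and which has a fundamental domain of finite area. Parabolic means trace $\pm2$. Cusps of $G$ are points of $\mathbb{R}\cup\{\infty\}$ fixed by a nontrivial parabolic element of $\bar G$. Put $A_{\mathfrak{c}}=\begin{pmatrix}\mathfrak{c}&-1\\1&0\end{pmatrix}$ for $\mathfrak{c}\ne\infty$, $A_\infty=I$; the cusp width $h_{\mathfrak{c}}>0$ is such that $\bar G_{\mathfrak{c}}$ is generated by the image of $t_{\mathfrak{c}}=A_{\mathfrak{c}}\begin{pmatrix}1&h_{\mathfrak{c}}\\0&1\end{pmatrix}A_{\mathfrak{c}}^{-1}$. For a group with cusp $\infty$, $\widetilde q=e^{2\pi i\tau/h_\infty}$ and $\log\widetilde q=2\pi i\tau/h_\infty$. **Vvafs (weight 0).** Let $\rho$ be a representation such that all eigenvalues of $\rho(\gamma)$, $\gamma$ parabolic, have absolute value 1. It is admissible if all these $\rho(\gamma)$ are diagonalizable, otherwise logarithmic. For $\lambda=e^{2\pi i\mu(\lambda)}$ unitary take $0\le\mu(\lambda)<1$. A weakly holomorphic vvaf of weight 0 associated to $\rho$ is a holomorphic $\mathbb{X}:\mathbb{H}\to\mathbb{C}^m$ with $\mathbb{X}(\gamma\tau)=\rho(\gamma)\mathbb{X}(\tau)$ for all group elements $\gamma$ having, at every cusp (after replacing $\mathbb{X}(\tau)$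 by $\mathbb{X}(A_{\mathfrak{c}}\tau)$), an expansion of the following kind with finitely many negative powers. (Admissible) Writing $\rho(t_\infty)=P\,\mathrm{diag}(\lambda_1,\dots,\lambda_m)P^{-1}$ and $\widetilde q^{\Lambda}=\mathrm{diag}(\widetilde q^{\mu(\lambda_1)},\dots,\widetilde q^{\mu(\lambda_m)})$: $\ \mathbb{X}(\tau)=P\,\widetilde q^{\Lambda}P^{-1}\sum_{n\ge -M}\mathbb{X}[n]\,\widetilde q^{\,n}$; the vectors $\mathbb{X}[n]$ are the Fourier coefficients (at $\infty$). (Logarithmic) $\ \mathbb{X}(\tau)=\sum_\lambda\sum_{j=0}^{m(\lambda)-1}(\log\widetilde q)^j\,\widetilde q^{\,\mu(\lambda)}\sum_{n\ge -M}\mathbb{X}[\lambda,j,n]\,\widetilde q^{\,n}$, where $\lambda$ runs over the eigenvalues of $\rho(t_\infty)$ and $m(\lambda)$ is the size of the corresponding Jordan block; the Fourier coefficients are the $\mathbb{X}[\lambda,j,n]$. In the logarithmic case the identity of the theorem is understood for these labelled coefficients: for each eigenvalue $\lambda'$ of $\widetilde\rho(t_\infty)$ and each $j'$, the $i$-th block (of length $m$) of $\widetilde{\mathbb{X}}[\lambda',j',n]$ equals $r_i\mathbb{X}^{(i)}[\lambda,j',m_in+n_i]$ for a corresponding eigenvalue $\lambda$, the rationals being allowed to depend on the labels $(\lambda',j')$. **Conjugates.** For $g\in\mathrm{SL}_2(\mathbb{R})$ the conjugate of $(H,\rho)$ by $g$ is $(gHg^{-1},\ g\gamma g^{-1}\mapsto\rho(\gamma))$.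 **Induction and lift.** Let $\infty$ be a cusp of $G$, let $\mathfrak{c}_1,\dots,\mathfrak{c}_{n_\infty}$ be inequivalent cusps of $H$ with $G\cdot\infty=\bigcup_iH\cdot\mathfrak{c}_i$, $A_i\in G$ with $A_i(\infty)=\mathfrak{c}_i$, $h_i=[\bar G_{\mathfrak{c}_i}:\bar H_{\mathfrak{c}_i}]$, and $g_{i,j}=t_\infty^jA_i^{-1}$ ($0\le j<h_i$), which are $d$ representatives of the left cosets $G/H$. The lift of a weight 0 form is $\widetilde{\mathbb{X}}(\tau)=\left(\mathbb{X}(g_{i,j}^{-1}\tau)\right)^t_{1\le i\le n_\infty,0\le j<h_i}\in\mathbb{C}^{dm}$. With representatives $\gamma_1,\dots,\gamma_d$ listing the $g_{i,j}$, $\widetilde\rho(\gamma)$ is the block matrix with $(a,b)$ block $\rho(\gamma_a^{-1}\gamma\gamma_b)$ if this element lies in $H$, and $0$ otherwise. If $\infty$ is not a cusp of $G$, one picks a cusp $\mathfrak{c}$ of $G$, performs the construction with $\mathfrak{c}$ in place of $\infty$ (using $t_{\mathfrak{c}}$) and sets $\widetilde{\mathbb{X}}(\tau)$ to be the result evaluated at $A_{\mathfrak{c}}\tau$, a form for $A_{\mathfrak{c}}^{-1}GA_{\mathfrak{c}}$ with representation $A_{\mathfrak{c}}^{-1}\gamma A_{\mathfrak{c}}\mapsto\widetilde\rho(\gamma)$. Fourier coefficients are taken at $\infty$.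
   Formalization: In the admissible case the displayed identity is stated with coefficient vectors in bases, fixed before X, that diagonalize the cusp generators; in standard coordinates it fails (e.g. Γ0(2) in SL2(Z)). The eigenvalue-labelled identity is also asserted, in both cases. *)

theory Defs
  imports
    "HOL-Analysis.Analysis"
    "HOL-Algebra.Coset"
    "HOL-Algebra.Generated_Groups"
    "Jordan_Normal_Form.Jordan_Normal_Form"
begin

text \<open>
  Elements of $SL_2(R)$ have type \<^typ>\<open>real^2^2\<close>. Matrices and vectors whose size is a natural
  number varying with the data (the values of representations and of vector-valued forms) are
  those of \<^theory>\<open>Jordan_Normal_Form.Matrix\<close>; the symbol \<open>$\<close> is reserved for the latter.
\<close>

unbundle no vec_syntax
notation vec_nth (infixl "$h" 90)


section \<open>Groups\<close>

abbreviation id2 :: "real^2^2" where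
  "id2 \<equiv> Finite_Cartesian_Product.mat 1"

definition mat2 :: "real \<Rightarrow> real \<Rightarrow> real \<Rightarrow> real \<Rightarrow> real^2^2" where
  "mat2 a b c d = vector [vector [a, b], vector [c, d]]"

definition SL2R :: "(real^2^2) monoid" where
  "SL2R = \<lparr>carrier = {A. Determinants.det A = 1}, mult = (**), one = id2\<rparr>"

definition PSL2R :: "(real^2^2) set monoid" where
  "PSL2R = SL2R Mod {id2, - id2}"

definition psl :: "real^2^2 \<Rightarrow> (real^2^2) set" where
  "psl A = {id2, - id2} #>\<^bsub>SL2R\<^esub> A"

definition group_index :: "('a, 'b) monoid_scheme \<Rightarrow> 'a set \<Rightarrow> nat" where
  "group_index K L = card (rcosets\<^bsub>K\<^esub> L)"

definition GL :: "nat \<Rightarrow> complex Matrix.mat monoid" where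
  "GL m = \<lparr>carrier = {A \<in> carrier_mat m m. invertible_mat A}, mult = (*), one = 1\<^sub>m m\<rparr>"

definition upper_half_plane :: "complex set" where
  "upper_half_plane = {\<tau>. Im \<tau> > 0}"

definition moebius :: "real^2^2 \<Rightarrow> complex \<Rightarrow> complex" where
  "moebius A \<tau> = (of_real (A $h 1 $h 1) * \<tau> + of_real (A $h 1 $h 2)) /
                 (of_real (A $h 2 $h 1) * \<tau> + of_real (A $h 2 $h 2))"


section \<open>Cusps\<close>

text \<open>The boundary of the upper half plane, i.e. the real line together with infinity.\<close>

datatype boundary_point = Infty | Fin real

fun moebius_bd :: "real^2^2 \<Rightarrow> boundary_point \<Rightarrow> boundary_point" where
  "moebius_bd A Infty =
     (if A $h 2 $h 1 = 0 then Infty else Fin (A $h 1 $h 1 / A $h 2 $h 1))"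
| "moebius_bd A (Fin x) =
     (if A $h 2 $h 1 * x + A $h 2 $h 2 = 0 then Infty
      else Fin ((A $h 1 $h 1 * x + A $h 1 $h 2) / (A $h 2 $h 1 * x + A $h 2 $h 2)))"

definition parabolic :: "real^2^2 \<Rightarrow> bool" where
  "parabolic A \<longleftrightarrow> trace A = 2 \<or> trace A = - 2"

definition is_cusp :: "(real^2^2) set \<Rightarrow> boundary_point \<Rightarrow> bool" where
  "is_cusp \<Gamma> c \<longleftrightarrow> (\<exists>\<gamma>\<in>\<Gamma>. parabolic \<gamma> \<and> \<gamma> \<noteq> id2 \<and> \<gamma> \<noteq> - id2 \<and> moebius_bd \<gamma> c = c)"

definition bd_stabilizer :: "(real^2^2) set \<Rightarrow> boundary_point \<Rightarrow> (real^2^2) set" where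
  "bd_stabilizer \<Gamma> c = {\<gamma> \<in> \<Gamma>. moebius_bd \<gamma> c = c}"

fun cusp_mat :: "boundary_point \<Rightarrow> real^2^2" where
  "cusp_mat Infty = id2"
| "cusp_mat (Fin x) = mat2 x (-1) 1 0"

definition cusp_translation :: "boundary_point \<Rightarrow> real \<Rightarrow> real^2^2" where
  "cusp_translation c h = cusp_mat c ** mat2 1 h 0 1 ** matrix_inv (cusp_mat c)"

definition cusp_width :: "(real^2^2) set \<Rightarrow> boundary_point \<Rightarrow> real" where
  "cusp_width \<Gamma> c = (THE h. h > 0 \<and>
     generate PSL2R {psl (cusp_translation c h)} = psl ` bd_stabilizer \<Gamma> c)"

definition cusp_generator :: "(real^2^2) set \<Rightarrow> boundary_point \<Rightarrow> real^2^2" where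
  "cusp_generator \<Gamma> c = cusp_translation c (cusp_width \<Gamma> c)"


section \<open>Fuchsian groups of the first kind\<close>

text \<open>
  The predicate expresses that the image of \<^term>\<open>\<Gamma>\<close> in $PSL_2(R)$ is such a group.
  The image is discrete iff its full preimage \<open>\<Gamma> \<union> -\<Gamma>\<close> is discrete in $SL_2(R)$.
  That the quotient surface has only finitely many punctures is expressed by: removing the images
  of the horoballs at finitely many cusps leaves something covered by the image of a compact set.
\<close>

definition finitely_punctured :: "(real^2^2) set \<Rightarrow> bool" where
  "finitely_punctured \<Gamma> \<longleftrightarrow>
     (\<exists>C K. finite C \<and> (\<forall>c\<in>C. is_cusp \<Gamma> c) \<and> compact K \<and> K \<subseteq> upper_half_plane \<and>
        (\<forall>\<tau>\<in>upper_half_plane. \<exists>\<gamma>\<in>\<Gamma>. moebius \<gamma> \<tau> \<in> K \<or>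
           (\<exists>c\<in>C. Im (moebius (matrix_inv (cusp_mat c)) (moebius \<gamma> \<tau>)) > 1)))"

definition fundamental_domain :: "(real^2^2) set \<Rightarrow> complex set \<Rightarrow> bool" where
  "fundamental_domain \<Gamma> D \<longleftrightarrow>
     D \<in> sets borel \<and> D \<subseteq> upper_half_plane \<and>
     (\<Union>\<gamma>\<in>\<Gamma>. moebius \<gamma> ` D) = upper_half_plane \<and>
     (\<forall>\<gamma>\<in>\<Gamma>. \<gamma> \<noteq> id2 \<and> \<gamma> \<noteq> - id2 \<longrightarrow> D \<inter> moebius \<gamma> ` D \<in> null_sets lborel)"

definition hyperbolic_area :: "complex set \<Rightarrow> ennreal" where
  "hyperbolic_area D = (\<integral>\<^sup>+ \<tau> \<in> D. ennreal (1 / (Im \<tau>)\<^sup>2) \<partial>lborel)"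

definition fuchsian_first_kind :: "(real^2^2) set \<Rightarrow> bool" where
  "fuchsian_first_kind \<Gamma> \<longleftrightarrow>
     discrete (\<Gamma> \<union> uminus ` \<Gamma>) \<and> finitely_punctured \<Gamma> \<and>
     (\<exists>D. fundamental_domain \<Gamma> D \<and> hyperbolic_area D < \<infinity>)"


section \<open>Representations\<close>

definition diagonalizable :: "complex Matrix.mat \<Rightarrow> bool" where
  "diagonalizable A \<longleftrightarrow> (\<exists>D. diagonal_mat D \<and> similar_mat A D)"

definition unitary_at_parabolics :: "(real^2^2) set \<Rightarrow> (real^2^2 \<Rightarrow> complex Matrix.mat) \<Rightarrow> bool" where
  "unitary_at_parabolics \<Gamma> \<rho> \<longleftrightarrow>
     (\<forall>\<gamma>\<in>\<Gamma>. parabolic \<gamma> \<longrightarrow> (\<forall>z. eigenvalue (\<rho> \<gamma>) z \<longrightarrow> cmod z = 1))"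

definition admissible :: "(real^2^2) set \<Rightarrow> (real^2^2 \<Rightarrow> complex Matrix.mat) \<Rightarrow> bool" where
  "admissible \<Gamma> \<rho> \<longleftrightarrow> (\<forall>\<gamma>\<in>\<Gamma>. parabolic \<gamma> \<longrightarrow> diagonalizable (\<rho> \<gamma>))"

definition conj_group :: "real^2^2 \<Rightarrow> (real^2^2) set \<Rightarrow> (real^2^2) set" where
  "conj_group g \<Gamma> = (\<lambda>\<gamma>. g ** \<gamma> ** matrix_inv g) ` \<Gamma>"

definition conj_rep ::
  "real^2^2 \<Rightarrow> (real^2^2 \<Rightarrow> complex Matrix.mat) \<Rightarrow> real^2^2 \<Rightarrow> complex Matrix.mat" where
  "conj_rep g \<rho> = (\<lambda>\<gamma>. \<rho> (matrix_inv g ** \<gamma> ** g))"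


section \<open>Fourier expansions at infinity\<close>

definition mu :: "complex \<Rightarrow> real" where
  "mu z = Arg2pi z / (2 * pi)"

text \<open>\<open>q_pow h x \<tau>\<close> is $\widetilde q^{x}$ for $\widetilde q = e^{2 \pi i \tau / h}$ and a real exponent.\<close>

definition q_pow :: "real \<Rightarrow> real \<Rightarrow> complex \<Rightarrow> complex" where
  "q_pow h x \<tau> = exp (2 * pi * \<i> * x * \<tau> / h)"

definition log_q :: "real \<Rightarrow> complex \<Rightarrow> complex" where
  "log_q h \<tau> = 2 * pi * \<i> * \<tau> / h"

definition q_series :: "nat \<Rightarrow> real \<Rightarrow> (int \<Rightarrow> complex Matrix.vec) \<Rightarrow> bool" where
  "q_series m h a \<longleftrightarrow>
     (\<forall>n. a n \<in> carrier_vec m) \<and>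
     (\<exists>M. \<forall>n < - M. a n = 0\<^sub>v m) \<and>
     (\<forall>\<tau>\<in>upper_half_plane. \<forall>l<m. (\<lambda>n. a n $ l * q_pow h (of_int n) \<tau>) summable_on UNIV)"

definition q_sum :: "nat \<Rightarrow> real \<Rightarrow> (int \<Rightarrow> complex Matrix.vec) \<Rightarrow> complex \<Rightarrow> complex Matrix.vec" where
  "q_sum m h a \<tau> = Matrix.vec m (\<lambda>l. \<Sum>\<^sub>\<infinity>n. a n $ l * q_pow h (of_int n) \<tau>)"

text \<open>
  The expansion does not depend on the choice of the diagonalization: \<open>P q\<^sup>\<Lambda> P\<^sup>-\<^sup>1\<close> acts on the
  eigenspace of \<open>z\<close> as multiplication by \<^term>\<open>q_pow h (mu z) \<tau>\<close>.
\<close>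

definition admissible_expansion ::
  "nat \<Rightarrow> (real^2^2) set \<Rightarrow> (real^2^2 \<Rightarrow> complex Matrix.mat) \<Rightarrow> (complex \<Rightarrow> complex Matrix.vec) \<Rightarrow>
   (int \<Rightarrow> complex Matrix.vec) \<Rightarrow> bool" where
  "admissible_expansion m \<Gamma> \<rho> X a \<longleftrightarrow>
     (let h = cusp_width \<Gamma> Infty; T = \<rho> (cusp_generator \<Gamma> Infty) in
      q_series m h a \<and>
      (\<exists>P P' ev. similar_mat_wit T (mat_diag m ev) P P' \<and>
         (\<forall>\<tau>\<in>upper_half_plane.
            X \<tau> = P *\<^sub>v (mat_diag m (\<lambda>l. q_pow h (mu (ev l)) \<tau>) *\<^sub>v (P' *\<^sub>v q_sum m h a \<tau>)))))"

definition jordan_size :: "complex Matrix.mat \<Rightarrow> complex \<Rightarrow> nat" where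
  "jordan_size T z = Max {k. \<exists>blocks. jordan_nf T blocks \<and> (k, z) \<in> set blocks}"

text \<open>
  If there are several Jordan blocks for an eigenvalue, the powers of the logarithm run up to the
  size of the largest one. Coefficients with labels outside the range of the summation are zero.
\<close>

definition log_expansion ::
  "nat \<Rightarrow> (real^2^2) set \<Rightarrow> (real^2^2 \<Rightarrow> complex Matrix.mat) \<Rightarrow> (complex \<Rightarrow> complex Matrix.vec) \<Rightarrow>
   (complex \<Rightarrow> nat \<Rightarrow> int \<Rightarrow> complex Matrix.vec) \<Rightarrow> bool" where
  "log_expansion m \<Gamma> \<rho> X a \<longleftrightarrow>
     (let h = cusp_width \<Gamma> Infty; T = \<rho> (cusp_generator \<Gamma> Infty) in
      (\<forall>z j. q_series m h (a z j)) \<and>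
      (\<forall>z j n. \<not> (eigenvalue T z \<and> j < jordan_size T z) \<longrightarrow> a z j n = 0\<^sub>v m) \<and>
      (\<forall>\<tau>\<in>upper_half_plane. X \<tau> \<in> carrier_vec m \<and>
         (\<forall>l<m. X \<tau> $ l =
            (\<Sum>z\<in>{z. eigenvalue T z}. \<Sum>j<jordan_size T z.
               log_q h \<tau> ^ j * q_pow h (mu z) \<tau> * q_sum m h (a z j) \<tau> $ l))))"


section \<open>Vector-valued automorphic forms of weight zero\<close>

text \<open>\<open>X\<close> is a weakly holomorphic vvaf of weight 0 and rank \<open>m\<close> associated to \<open>(\<Gamma>, \<rho>)\<close>.\<close>

definition weakly_holomorphic_vvaf ::
  "nat \<Rightarrow> (real^2^2) set \<Rightarrow> (real^2^2 \<Rightarrow> complex Matrix.mat) \<Rightarrow> (complex \<Rightarrow> complex Matrix.vec) \<Rightarrow> bool" where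
  "weakly_holomorphic_vvaf m \<Gamma> \<rho> X \<longleftrightarrow>
     (\<forall>\<tau>\<in>upper_half_plane. X \<tau> \<in> carrier_vec m) \<and>
     (\<forall>l<m. (\<lambda>\<tau>. X \<tau> $ l) holomorphic_on upper_half_plane) \<and>
     (\<forall>\<gamma>\<in>\<Gamma>. \<forall>\<tau>\<in>upper_half_plane. X (moebius \<gamma> \<tau>) = \<rho> \<gamma> *\<^sub>v X \<tau>) \<and>
     (\<forall>c. is_cusp \<Gamma> c \<longrightarrow>
        (let A = cusp_mat c; \<Gamma>' = conj_group (matrix_inv A) \<Gamma>; \<rho>' = conj_rep (matrix_inv A) \<rho>;
             X' = (\<lambda>\<tau>. X (moebius A \<tau>))
         in if admissible \<Gamma> \<rho> then \<exists>a. admissible_expansion m \<Gamma>' \<rho>' X' a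
            else \<exists>a. log_expansion m \<Gamma>' \<rho>' X' a))"


section \<open>Induction and lift\<close>

text \<open>
  The data of the construction at a cusp \<open>c\<close> of \<open>G\<close>: inequivalent cusps \<open>cs\<close> of \<open>H\<close> with
  $G \cdot c = \bigcup_i H \cdot c_i$, and \<open>As ! i \<in> G\<close> with \<open>As ! i\<close> mapping \<open>c\<close> to \<open>cs ! i\<close>.
\<close>

definition lift_data ::
  "(real^2^2) set \<Rightarrow> (real^2^2) set \<Rightarrow> boundary_point \<Rightarrow> boundary_point list \<Rightarrow> (real^2^2) list \<Rightarrow> bool" where
  "lift_data G H c cs As \<longleftrightarrow>
     length As = length cs \<and>
     (\<forall>i<length cs. is_cusp H (cs ! i) \<and> As ! i \<in> G \<and> moebius_bd (As ! i) c = cs ! i) \<and>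
     (\<forall>i<length cs. \<forall>j<length cs. i \<noteq> j \<longrightarrow> (\<forall>\<gamma>\<in>H. moebius_bd \<gamma> (cs ! i) \<noteq> cs ! j)) \<and>
     (\<lambda>\<gamma>. moebius_bd \<gamma> c) ` G = (\<Union>i<length cs. (\<lambda>\<gamma>. moebius_bd \<gamma> (cs ! i)) ` H)"

definition cusp_index :: "(real^2^2) set \<Rightarrow> (real^2^2) set \<Rightarrow> boundary_point \<Rightarrow> nat" where
  "cusp_index G H c =
     group_index (PSL2R\<lparr>carrier := psl ` bd_stabilizer G c\<rparr>) (psl ` bd_stabilizer H c)"

definition coset_reps ::
  "(real^2^2) set \<Rightarrow> (real^2^2) set \<Rightarrow> boundary_point \<Rightarrow> boundary_point list \<Rightarrow> (real^2^2) list \<Rightarrow>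
   (real^2^2) list" where
  "coset_reps G H c cs As =
     concat (map (\<lambda>i. map (\<lambda>j. (cusp_generator G c [^]\<^bsub>SL2R\<^esub> j) ** matrix_inv (As ! i))
                        [0..<cusp_index G H (cs ! i)])
                 [0..<length cs])"

text \<open>The vector of length \<open>d * m\<close> whose consecutive blocks are \<open>v 0, \<dots>, v (d - 1)\<close>.\<close>

definition block_vec :: "nat \<Rightarrow> nat \<Rightarrow> (nat \<Rightarrow> complex Matrix.vec) \<Rightarrow> complex Matrix.vec" where
  "block_vec d m v = Matrix.vec (d * m) (\<lambda>k. v (k div m) $ (k mod m))"

definition induced_rep ::
  "nat \<Rightarrow> (real^2^2) set \<Rightarrow> (real^2^2 \<Rightarrow> complex Matrix.mat) \<Rightarrow> (real^2^2) list \<Rightarrow>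
   real^2^2 \<Rightarrow> complex Matrix.mat" where
  "induced_rep m H \<rho> gs \<gamma> =
     Matrix.mat (length gs * m) (length gs * m)
       (\<lambda>(k, l). let x = matrix_inv (gs ! (k div m)) ** \<gamma> ** gs ! (l div m)
                 in if x \<in> H then \<rho> x $$ (k mod m, l mod m) else 0)"

definition induced_form ::
  "nat \<Rightarrow> (real^2^2) list \<Rightarrow> (complex \<Rightarrow> complex Matrix.vec) \<Rightarrow> complex \<Rightarrow> complex Matrix.vec" where
  "induced_form m gs X \<tau> =
     block_vec (length gs) m (\<lambda>i. X (moebius (matrix_inv (gs ! i)) \<tau>))"

text \<open>
  The lift performed at \<open>c\<close> and transported to infinity by \<^term>\<open>cusp_mat c\<close>, which is the identity
  if \<open>c\<close> is infinity.
\<close>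

definition lift_group :: "(real^2^2) set \<Rightarrow> boundary_point \<Rightarrow> (real^2^2) set" where
  "lift_group G c = conj_group (matrix_inv (cusp_mat c)) G"

definition lift_rep ::
  "nat \<Rightarrow> (real^2^2) set \<Rightarrow> (real^2^2) set \<Rightarrow> boundary_point \<Rightarrow> boundary_point list \<Rightarrow>
   (real^2^2) list \<Rightarrow> (real^2^2 \<Rightarrow> complex Matrix.mat) \<Rightarrow> real^2^2 \<Rightarrow> complex Matrix.mat" where
  "lift_rep m G H c cs As \<rho> =
     conj_rep (matrix_inv (cusp_mat c)) (induced_rep m H \<rho> (coset_reps G H c cs As))"

definition lift_form ::
  "nat \<Rightarrow> (real^2^2) set \<Rightarrow> (real^2^2) set \<Rightarrow> boundary_point \<Rightarrow> boundary_point list \<Rightarrow>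
   (real^2^2) list \<Rightarrow> (complex \<Rightarrow> complex Matrix.vec) \<Rightarrow> complex \<Rightarrow> complex Matrix.vec" where
  "lift_form m G H c cs As X \<tau> =
     induced_form m (coset_reps G H c cs As) X (moebius (cusp_mat c) \<tau>)"


section \<open>Identities between Fourier coefficients\<close>

definition eigenbasis :: "complex Matrix.mat \<Rightarrow> complex Matrix.mat \<Rightarrow> complex Matrix.mat \<Rightarrow> bool" where
  "eigenbasis T P P' \<longleftrightarrow> (\<exists>D. diagonal_mat D \<and> similar_mat_wit T D P P')"

text \<open>
  \<open>(X, \<Gamma>, \<rho>)\<close> is a form of rank \<open>d * m\<close> and \<open>(F i, \<Gamma>s i, \<rho>s i)\<close>, \<open>i < d\<close>, are forms of rank \<open>m\<close>.
  Admissible case: the vectors of coefficients are compared in coordinates \<open>P\<close>, \<open>Q i\<close> in which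
  the representing matrices of the generators at infinity are diagonal.
  In the standard coordinates the identity fails in general: for \<open>H = \<Gamma>\<^sub>0(2)\<close> in \<open>G = SL\<^sub>2(\<int>)\<close>,
  trivial \<open>\<rho>\<close>, and \<open>X(-1/\<tau>) = \<Sum>\<^sub>n a\<^sub>n q\<^bsup>n/2\<^esup>\<close>, two of the entries of the \<open>n\<close>-th
  coefficient of the lift are \<open>a\<^bsub>2n\<^esub> \<plusminus> a\<^bsub>2n+1\<^esub>\<close>, whereas
  in eigencoordinates they are \<open>a\<^bsub>2n\<^esub>\<close> and \<open>a\<^bsub>2n+1\<^esub>\<close>.
\<close>

definition coefficient_identity ::
  "nat \<Rightarrow> nat \<Rightarrow> (real^2^2) set \<Rightarrow> (real^2^2 \<Rightarrow> complex Matrix.mat) \<Rightarrow> (complex \<Rightarrow> complex Matrix.vec) \<Rightarrow>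
   (nat \<Rightarrow> (real^2^2) set) \<Rightarrow> (nat \<Rightarrow> real^2^2 \<Rightarrow> complex Matrix.mat) \<Rightarrow>
   (nat \<Rightarrow> complex \<Rightarrow> complex Matrix.vec) \<Rightarrow>
   complex Matrix.mat \<times> complex Matrix.mat \<Rightarrow> (nat \<Rightarrow> complex Matrix.mat \<times> complex Matrix.mat) \<Rightarrow>
   (nat \<Rightarrow> rat) \<Rightarrow> (nat \<Rightarrow> rat) \<Rightarrow> (nat \<Rightarrow> rat) \<Rightarrow> bool" where
  "coefficient_identity d m \<Gamma> \<rho> X \<Gamma>s \<rho>s F P Q ms ns rs \<longleftrightarrow>
     eigenbasis (\<rho> (cusp_generator \<Gamma> Infty)) (fst P) (snd P) \<and>
     (\<forall>i<d. eigenbasis (\<rho>s i (cusp_generator (\<Gamma>s i) Infty)) (fst (Q i)) (snd (Q i))) \<and>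
     (\<exists>a b.
        admissible_expansion (d * m) \<Gamma> \<rho> X a \<and>
        (\<forall>i<d. admissible_expansion m (\<Gamma>s i) (\<rho>s i) (F i) (b i)) \<and>
        (\<forall>n. \<exists>k :: nat \<Rightarrow> int.
           (\<forall>i<d. of_int (k i) = ms i * of_int n + ns i) \<and>
           snd P *\<^sub>v a n =
             block_vec d m (\<lambda>i. of_rat (rs i) \<cdot>\<^sub>v (snd (Q i) *\<^sub>v b i (k i)))))"

text \<open>
  The identity for coefficients labelled by an eigenvalue and a power of the logarithm;
  \<open>ev i z j\<close> is the eigenvalue for the \<open>i\<close>-th form that corresponds to the label \<open>(z, j)\<close>.
  For diagonalizable generators all powers of the logarithm are 0, and the coefficient labelled
  \<open>(z, 0, n)\<close> is the component of the \<open>n\<close>-th coefficient in the eigenspace of \<open>z\<close>.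
\<close>

definition labelled_coefficient_identity ::
  "nat \<Rightarrow> nat \<Rightarrow> (real^2^2) set \<Rightarrow> (real^2^2 \<Rightarrow> complex Matrix.mat) \<Rightarrow> (complex \<Rightarrow> complex Matrix.vec) \<Rightarrow>
   (nat \<Rightarrow> (real^2^2) set) \<Rightarrow> (nat \<Rightarrow> real^2^2 \<Rightarrow> complex Matrix.mat) \<Rightarrow>
   (nat \<Rightarrow> complex \<Rightarrow> complex Matrix.vec) \<Rightarrow>
   (nat \<Rightarrow> complex \<Rightarrow> nat \<Rightarrow> complex) \<Rightarrow> (nat \<Rightarrow> complex \<Rightarrow> nat \<Rightarrow> rat) \<Rightarrow>
   (nat \<Rightarrow> complex \<Rightarrow> nat \<Rightarrow> rat) \<Rightarrow> (nat \<Rightarrow> complex \<Rightarrow> nat \<Rightarrow> rat) \<Rightarrow> bool" where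
  "labelled_coefficient_identity d m \<Gamma> \<rho> X \<Gamma>s \<rho>s F ev ms ns rs \<longleftrightarrow>
     (\<exists>a b.
        log_expansion (d * m) \<Gamma> \<rho> X a \<and>
        (\<forall>i<d. log_expansion m (\<Gamma>s i) (\<rho>s i) (F i) (b i)) \<and>
        (let T = \<rho> (cusp_generator \<Gamma> Infty) in
         \<forall>z j. eigenvalue T z \<and> j < jordan_size T z \<longrightarrow>
           (\<forall>i<d. eigenvalue (\<rho>s i (cusp_generator (\<Gamma>s i) Infty)) (ev i z j)) \<and>
           (\<forall>n. \<exists>k :: nat \<Rightarrow> int.
              (\<forall>i<d. of_int (k i) = ms i z j * of_int n + ns i z j) \<and>
              a z j n = block_vec d m (\<lambda>i. of_rat (rs i z j) \<cdot>\<^sub>v b i (ev i z j) j (k i)))))"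

end

theory Submission
  imports Defs "Jordan_Normal_Form.Jordan_Normal_Form_Uniqueness" "Jordan_Normal_Form.Jordan_Normal_Form_Existence"
begin

text \<open>
  Let \<open>t\<close> generate the stabilizer of the cusp \<open>c\<close> in \<open>G\<close>, let \<open>h\<close> be its width, and list the coset
  representatives as \<open>g\<^sub>a = t\<^sup>l A\<^sub>i\<^sup>-\<^sup>1\<close>, \<open>a = (i, l)\<close>, \<open>l < k = h\<^sub>i\<close>. The block of the lift with index \<open>a\<close> is
  \<open>F\<^sub>a(\<tau>) = X(g\<^sub>a\<^sup>-\<^sup>1 A\<^sub>c \<tau>)\<close>, which is a form for a conjugate of \<open>H\<close> whose width at infinity is \<open>k h\<close> and whose
  generator there acts by \<open>S = \<rho>(A\<^sub>i t\<^sup>k A\<^sub>i\<^sup>-\<^sup>1)\<close>. The induced representation maps \<open>t\<close> to a matrix that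
  permutes the \<open>k\<close> blocks of each \<open>i\<close> cyclically and has \<open>k\<close>-th power \<open>S\<close> on each of them. So its
  eigenvalues are the \<open>k\<close>-th roots \<open>z\<close> of the eigenvalues of \<open>S\<close>, and \<open>\<mu>(z) = (\<mu>(z\<^sup>k) + r) / k\<close> with \<open>0 \<le> r < k\<close>.
  Splitting the expansion of \<open>F\<^sub>a\<close>, which is in powers of the \<open>k\<close>-th root of \<open>q\<close>, according to the
  residue \<open>r\<close> of the exponent modulo \<open>k\<close> gives the components of the lift for the roots \<open>z\<close>; the
  coefficient of index \<open>n\<close> of the lift is the one of index \<open>k n + r\<close> of \<open>F\<^sub>a\<close>. The powers of the
  logarithm contribute the factors \<open>k\<^sup>-\<^sup>j\<close>.
\<close>

section \<open>Matrices of determinant one\<close>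

text \<open>Two obstacles shape the argument. First, an expansion of the lift may only use powers of
  the logarithm below the largest Jordan block of its generator \<open>T\<close>, whereas the blocks
  bring the powers permitted by the matrices \<open>S\<close>. So a Jordan chain of \<open>S\<close>
  for \<open>z ^ k\<close> has to force a chain of \<open>T\<close> for \<open>z\<close> that is at
  least as long; this is the reason for the detour through Jordan normal forms.

  Second, in the admissible case one coefficient of the lift is read off from all blocks at once,
  and the index shift of a block may not depend on an eigenvalue label. In an eigenbasis of
  \<open>T\<close> whose column for block a and eigenvector s belongs to the root with number
  \<open>ps a\<close>, the coordinate of block a picks exactly the residue \<open>ps a\<close>. This
  eigenbasis is a discrete Fourier transform along each cycle, and its columns are scaled so that
  the phases by which the expansions of the blocks of one cycle differ disappear; hence the factor
  1.

  All numbers and bases are computed from the coset representatives and from \<open>\<rho>\<close>;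
  the form enters only through its coefficients.\<close>

lemma mat2_nth [simp]:
  "mat2 a b c d $h 1 $h 1 = a" "mat2 a b c d $h 1 $h 2 = b"
  "mat2 a b c d $h 2 $h 1 = c" "mat2 a b c d $h 2 $h 2 = d"
  by (simp_all add: mat2_def)

lemma mat2_eqI:
  assumes "A $h 1 $h 1 = B $h 1 $h 1" "A $h 1 $h 2 = B $h 1 $h 2"
    "A $h 2 $h 1 = B $h 2 $h 1" "A $h 2 $h 2 = B $h 2 $h 2"
  shows "(A :: real^2^2) = B"
  using assms by (simp add: Finite_Cartesian_Product.vec_eq_iff forall_2)

lemma mat2_cases:
  obtains a b c d where "A = mat2 a b c d"
proof
  show "A = mat2 (A $h 1 $h 1) (A $h 1 $h 2) (A $h 2 $h 1) (A $h 2 $h 2)"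
    by (rule mat2_eqI) simp_all
qed

lemma mat2_eq_iff [simp]:
  "mat2 a b c d = mat2 a' b' c' d' \<longleftrightarrow> a = a' \<and> b = b' \<and> c = c' \<and> d = d'"
  by (metis mat2_nth)

lemma mat2_mult [simp]:
  "mat2 a b c d ** mat2 a' b' c' d' = mat2 (a*a' + b*c') (a*b' + b*d') (c*a' + d*c') (c*b' + d*d')"
  by (rule mat2_eqI) (simp_all add: matrix_matrix_mult_def sum_2)

lemma id2_mat2: "id2 = mat2 1 0 0 1"
  by (rule mat2_eqI) (simp_all add: Finite_Cartesian_Product.mat_def)

lemma uminus_mat2 [simp]: "- mat2 a b c d = mat2 (-a) (-b) (-c) (-d)"
  by (rule mat2_eqI) simp_all

lemma det_mat2 [simp]: "Determinants.det (mat2 a b c d) = a * d - b * c"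
  by (simp add: det_2)

lemma trace_mat2 [simp]: "trace (mat2 a b c d) = a + d"
  by (simp add: trace_def sum_2)

abbreviation sl2 :: "real^2^2 \<Rightarrow> bool" where
  "sl2 A \<equiv> Determinants.det A = 1"

lemma matrix_inv_unique:
  assumes "A ** B = id2" "B ** A = id2"
  shows "matrix_inv A = (B :: real^2^2)"
proof -
  have "A ** matrix_inv A = id2 \<and> matrix_inv A ** A = id2"
    unfolding matrix_inv_def by (rule someI[of _ B]) (use assms in simp)
  then have "B = B ** (A ** matrix_inv A)" by simp
  also have "\<dots> = matrix_inv A" by (simp add: matrix_mul_assoc assms)
  finally show ?thesis by simp
qed

lemma matrix_inv_mat2: "a * d - b * c = 1 \<Longrightarrow> matrix_inv (mat2 a b c d) = mat2 d (-b) (-c) a"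
  by (rule matrix_inv_unique) (simp_all add: id2_mat2 algebra_simps)

lemma sl2_inv:
  assumes "sl2 A"
  shows "A ** matrix_inv A = id2" "matrix_inv A ** A = id2" "sl2 (matrix_inv A)"
    "matrix_inv (matrix_inv A) = A"
proof -
  obtain a b c d where A: "A = mat2 a b c d" by (rule mat2_cases)
  then have "a * d - b * c = 1" using assms by simp
  then show "A ** matrix_inv A = id2" "matrix_inv A ** A = id2" "sl2 (matrix_inv A)"
    "matrix_inv (matrix_inv A) = A"
    unfolding A by (simp_all add: matrix_inv_mat2 id2_mat2 algebra_simps)
qed

lemma sl2_mult: "sl2 A \<Longrightarrow> sl2 B \<Longrightarrow> sl2 (A ** B)"
  by (simp add: det_mul)

lemma sl2_inv_cancel:
  assumes "sl2 A"
  shows "A ** (matrix_inv A ** B) = B" "matrix_inv A ** (A ** B) = B"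
    "B ** A ** matrix_inv A = B" "B ** matrix_inv A ** A = B"
  using sl2_inv(1,2)[OF assms] by (metis matrix_mul_assoc matrix_mul_lid matrix_mul_rid)+

lemma sl2_inv_mult:
  assumes "sl2 A" "sl2 B"
  shows "matrix_inv (A ** B) = matrix_inv B ** matrix_inv A"
  by (rule matrix_inv_unique) (simp_all add: matrix_mul_assoc sl2_inv_cancel sl2_inv assms)

lemma matrix_inv_id2 [simp]: "matrix_inv id2 = id2"
  by (rule matrix_inv_unique) simp_all

lemma uminus_mult:
  fixes A B :: "real^2^2"
  shows "(- A) ** B = - (A ** B)" "A ** (- B) = - (A ** B)"
proof -
  obtain a b c d where A: "A = mat2 a b c d" by (rule mat2_cases)
  obtain a' b' c' d' where B: "B = mat2 a' b' c' d'" by (rule mat2_cases)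
  show "(- A) ** B = - (A ** B)" "A ** (- B) = - (A ** B)"
    by (simp_all add: A B)
qed

lemma sl2_uminus [simp]: "sl2 (- A) \<longleftrightarrow> sl2 A"
proof -
  obtain a b c d where A: "A = mat2 a b c d" by (rule mat2_cases)
  show ?thesis by (simp add: A)
qed

lemma matrix_inv_uminus: "sl2 A \<Longrightarrow> matrix_inv (- A) = - matrix_inv A"
  by (rule matrix_inv_unique) (simp_all add: uminus_mult sl2_inv)

lemma group_SL2R: "group SL2R"
proof (rule groupI)
  fix x assume "x \<in> carrier SL2R"
  then show "\<exists>y\<in>carrier SL2R. y \<otimes>\<^bsub>SL2R\<^esub> x = \<one>\<^bsub>SL2R\<^esub>"
    by (intro bexI[of _ "matrix_inv x"]) (auto simp: SL2R_def sl2_inv)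
qed (auto simp: SL2R_def det_mul matrix_mul_assoc)

lemma SL2R_simps [simp]:
  "x \<in> carrier SL2R \<longleftrightarrow> sl2 x" "x \<otimes>\<^bsub>SL2R\<^esub> y = x ** y" "\<one>\<^bsub>SL2R\<^esub> = id2"
  by (simp_all add: SL2R_def)

lemma inv_SL2R: "sl2 x \<Longrightarrow> inv\<^bsub>SL2R\<^esub> x = matrix_inv x"
  using group.inv_equality[OF group_SL2R, of "matrix_inv x" x] by (simp add: sl2_inv)

lemma subgroup_SL2R_D:
  assumes "subgroup K SL2R"
  shows "x \<in> K \<Longrightarrow> sl2 x" "x \<in> K \<Longrightarrow> y \<in> K \<Longrightarrow> x ** y \<in> K" "x \<in> K \<Longrightarrow> matrix_inv x \<in> K"
    "id2 \<in> K"
proof -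
  show s: "sl2 x" if "x \<in> K" for x using subgroup.subset[OF assms] that by (auto simp: SL2R_def)
  show "x \<in> K \<Longrightarrow> y \<in> K \<Longrightarrow> x ** y \<in> K" using subgroup.m_closed[OF assms, of x y] by simp
  show "x \<in> K \<Longrightarrow> matrix_inv x \<in> K" using subgroup.m_inv_closed[OF assms, of x]
    by (simp add: inv_SL2R s)
  show "id2 \<in> K" using subgroup.one_closed[OF assms] by simp
qed

section \<open>Moebius transformations\<close>

lemma moebius_denom:
  assumes "sl2 A" "\<tau> \<in> upper_half_plane"
  shows "of_real (A $h 2 $h 1) * \<tau> + of_real (A $h 2 $h 2) \<noteq> (0::complex)"
proof
  obtain a b c d where A: "A = mat2 a b c d" by (rule mat2_cases)
  assume "of_real (A $h 2 $h 1) * \<tau> + of_real (A $h 2 $h 2) = (0::complex)"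
  then have "Im (of_real c * \<tau> + of_real d) = 0" "Re (of_real c * \<tau> + of_real d) = 0"
    by (simp_all add: A)
  then have "c * Im \<tau> = 0" "c * Re \<tau> + d = 0" by simp_all
  then have "c = 0" "d = 0" using assms(2) by (auto simp: upper_half_plane_def)
  then show False using assms(1) by (simp add: A)
qed

lemma moebius_upper:
  assumes "sl2 A" "\<tau> \<in> upper_half_plane"
  shows "moebius A \<tau> \<in> upper_half_plane"
proof -
  obtain a b c d where A: "A = mat2 a b c d" by (rule mat2_cases)
  have nz: "of_real c * \<tau> + of_real d \<noteq> (0::complex)"
    using moebius_denom[OF assms] by (simp add: A)
  have "a * d - b * c = 1" using assms(1) by (simp add: A)
  then have "Im ((of_real a * \<tau> + of_real b) * cnj (of_real c * \<tau> + of_real d)) = Im \<tau>"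
    by (simp add: algebra_simps)
  then have "Im (moebius A \<tau>) = Im \<tau> / (cmod (of_real c * \<tau> + of_real d))\<^sup>2"
    unfolding moebius_def A by (subst complex_div_cnj) (simp add: Im_divide_of_real flip: of_real_power)
  then show ?thesis using assms(2) nz by (simp add: upper_half_plane_def)
qed

lemma moebius_mult:
  assumes "sl2 A" "sl2 B" "\<tau> \<in> upper_half_plane"
  shows "moebius (A ** B) \<tau> = moebius A (moebius B \<tau>)"
proof -
  obtain a b c d where A: "A = mat2 a b c d" by (rule mat2_cases)
  obtain a' b' c' d' where B: "B = mat2 a' b' c' d'" by (rule mat2_cases)
  have nz: "of_real c' * \<tau> + of_real d' \<noteq> (0::complex)"
    using moebius_denom[OF assms(2,3)] by (simp add: B)
  let ?n = "of_real a' * \<tau> + of_real b'" and ?d = "of_real c' * \<tau> + of_real d'"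
  have frac: "(x * (n / e) + y) / (z * (n / e) + w) = (x * n + y * e) / (z * n + w * e)"
    if "e \<noteq> 0" for x y z w n e :: complex
  proof -
    have "x * (n / e) + y = (x * n + y * e) / e" "z * (n / e) + w = (z * n + w * e) / e"
      using that by (simp_all add: add_divide_distrib)
    then show ?thesis using that by simp
  qed
  have "moebius A (moebius B \<tau>) = (of_real a * (?n / ?d) + of_real b) / (of_real c * (?n / ?d) + of_real d)"
    by (simp add: moebius_def A B)
  also have "\<dots> = (of_real a * ?n + of_real b * ?d) / (of_real c * ?n + of_real d * ?d)"
    by (rule frac[OF nz])
  also have "\<dots> = moebius (A ** B) \<tau>"
    by (simp add: moebius_def A B algebra_simps)
  finally show ?thesis by simp
qed

lemma moebius_id2 [simp]: "moebius id2 \<tau> = \<tau>"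
  by (simp add: moebius_def id2_mat2)

lemma moebius_holomorphic:
  assumes "sl2 A"
  shows "moebius A holomorphic_on upper_half_plane"
  unfolding moebius_def by (intro holomorphic_intros) (use moebius_denom[OF assms] in auto)

lemma moebius_bd_mult:
  assumes "sl2 A" "sl2 B"
  shows "moebius_bd (A ** B) x = moebius_bd A (moebius_bd B x)"
proof -
  obtain a b c d where A: "A = mat2 a b c d" by (rule mat2_cases)
  obtain a' b' c' d' where B: "B = mat2 a' b' c' d'" by (rule mat2_cases)
  have dB: "a' * d' - b' * c' = 1" using assms(2) by (simp add: B)
  \<comment> \<open>Homogeneous coordinates: the pair \<open>p\<close>, \<open>q\<close> stands for
    the boundary point p/q, with infinity for q = 0, so one computation covers all cases of
    \<open>moebius_bd\<close>.\<close>
  have key: "moebius_bd A (if q = 0 then Infty else Fin (p / q)) =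
      (if c * p + d * q = 0 then Infty else Fin ((a * p + b * q) / (c * p + d * q)))"
    if "p \<noteq> 0 \<or> q \<noteq> 0" for p q
  proof (cases "q = 0")
    case True
    then show ?thesis using that by (simp add: A)
  next
    case False
    have "c * (p / q) + d = (c * p + d * q) / q" "a * (p / q) + b = (a * p + b * q) / q"
      using False by (simp_all add: add_divide_distrib)
    then show ?thesis using False by (simp add: A)
  qed
  show ?thesis
  proof (cases x)
    case Infty
    have nz: "a' \<noteq> 0 \<or> c' \<noteq> 0" using dB by auto
    have e: "moebius_bd B x = (if c' = 0 then Infty else Fin (a' / c'))" by (simp add: Infty B)
    show ?thesis unfolding e key[OF nz] by (simp add: Infty A B)
  next
    case (Fin y)
    have nz: "a' * y + b' \<noteq> 0 \<or> c' * y + d' \<noteq> 0"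
    proof (rule ccontr)
      assume "\<not> ?thesis"
      then have "a' * y + b' = 0" "c' * y + d' = 0" by auto
      then have "b' = - (a' * y)" "d' = - (c' * y)" by linarith+
      then show False using dB by (simp add: algebra_simps)
    qed
    have e: "moebius_bd B x = (if c' * y + d' = 0 then Infty else Fin ((a' * y + b') / (c' * y + d')))"
      by (simp add: Fin B)
    show ?thesis unfolding e key[OF nz] by (simp add: Fin A B algebra_simps)
  qed
qed

lemma moebius_bd_id2 [simp]: "moebius_bd id2 x = x"
  by (cases x) (simp_all add: id2_mat2)

lemma moebius_bd_uminus [simp]: "moebius_bd (- A) x = moebius_bd A x"
proof -
  obtain a b c d where A: "A = mat2 a b c d" by (rule mat2_cases)
  show ?thesis
  proof (cases x)
    case (Fin y)
    have "- (c * y) - d = 0 \<longleftrightarrow> c * y + d = 0" by linarith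
    moreover have "(- (a * y) - b) / (- (c * y) - d) = (a * y + b) / (c * y + d)"
    proof -
      have "- (a * y) - b = - (a * y + b)" "- (c * y) - d = - (c * y + d)" by simp_all
      then show ?thesis by (simp only: minus_divide_divide)
    qed
    ultimately show ?thesis by (simp add: A Fin)
  qed (simp add: A)
qed

lemma moebius_bd_inv:
  assumes "sl2 A"
  shows "moebius_bd (matrix_inv A) (moebius_bd A x) = x" "moebius_bd A (moebius_bd (matrix_inv A) x) = x"
  using assms by (metis moebius_bd_mult moebius_bd_id2 sl2_inv)+

lemma sl2_cusp_mat [simp]: "sl2 (cusp_mat c)"
  by (cases c) (simp_all add: id2_mat2)

lemma moebius_bd_cusp_mat [simp]: "moebius_bd (cusp_mat c) Infty = c"
  by (cases c) (simp_all add: id2_mat2)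

lemma moebius_bd_upper_triangular [simp]: "moebius_bd (mat2 a b 0 d) Infty = Infty"
  by simp

lemma moebius_bd_inv_cusp_mat [simp]: "moebius_bd (matrix_inv (cusp_mat c)) c = Infty"
  by (metis moebius_bd_inv(1) moebius_bd_cusp_mat sl2_cusp_mat)

lemma moebius_bd_fixes_Infty:
  assumes "sl2 A" "moebius_bd A Infty = Infty"
  obtains a b where "a \<noteq> 0" "A = mat2 a b 0 (1 / a)"
proof -
  obtain a b c d where A: "A = mat2 a b c d" by (rule mat2_cases)
  have "c = 0" using assms(2) by (simp add: A split: if_splits)
  with assms(1) have "a * d = 1" by (simp add: A)
  then have "a \<noteq> 0" by auto
  with \<open>a * d = 1\<close> have "d = 1 / a" by (simp add: field_simps)
  have "A = mat2 a b 0 (1 / a)" by (simp only: A \<open>c = 0\<close> \<open>d = 1 / a\<close>)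
  then show ?thesis by (rule that[OF \<open>a \<noteq> 0\<close>])
qed

declare moebius_bd.simps [simp del]

section \<open>Conjugate subgroups, their cusps and their discreteness\<close>

lemma mem_conj_group:
  assumes "sl2 g"
  shows "x \<in> conj_group g K \<longleftrightarrow> matrix_inv g ** x ** g \<in> K"
proof
  assume "x \<in> conj_group g K"
  then show "matrix_inv g ** x ** g \<in> K"
    using assms by (auto simp: conj_group_def matrix_mul_assoc sl2_inv sl2_inv_cancel)
next
  assume "matrix_inv g ** x ** g \<in> K"
  moreover have "x = g ** (matrix_inv g ** x ** g) ** matrix_inv g"
    using assms by (simp add: matrix_mul_assoc sl2_inv sl2_inv_cancel)
  ultimately show "x \<in> conj_group g K" unfolding conj_group_def by (rule rev_image_eqI)
qed

lemma conj_group_conj_group: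
  assumes "sl2 g" "sl2 h"
  shows "conj_group g (conj_group h K) = conj_group (g ** h) K"
  by (auto simp: mem_conj_group assms sl2_mult sl2_inv_mult matrix_mul_assoc)

lemma subgroup_conj_group:
  assumes "sl2 g" "subgroup K SL2R"
  shows "subgroup (conj_group g K) SL2R"
proof (rule group.subgroupI[OF group_SL2R])
  note K = subgroup_SL2R_D[OF assms(2)]
  show "conj_group g K \<subseteq> carrier SL2R"
    using K(1) assms(1) by (auto simp: conj_group_def det_mul sl2_inv)
  show "conj_group g K \<noteq> {}" using K(4) by (auto simp: conj_group_def)
  fix a assume "a \<in> conj_group g K"
  then obtain x where x: "x \<in> K" "a = g ** x ** matrix_inv g" by (auto simp: conj_group_def)
  have "inv\<^bsub>SL2R\<^esub> a = g ** matrix_inv x ** matrix_inv g"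
    using K(1)[OF x(1)] assms(1)
    by (simp add: x(2) inv_SL2R det_mul sl2_inv sl2_inv_mult sl2_mult matrix_mul_assoc)
  then show "inv\<^bsub>SL2R\<^esub> a \<in> conj_group g K" using K(3)[OF x(1)] by (auto simp: conj_group_def)
  fix b assume "b \<in> conj_group g K"
  then obtain y where y: "y \<in> K" "b = g ** y ** matrix_inv g" by (auto simp: conj_group_def)
  have "a ** b = g ** (x ** y) ** matrix_inv g"
    using assms(1) by (simp add: x(2) y(2) matrix_mul_assoc sl2_inv_cancel)
  then show "a \<otimes>\<^bsub>SL2R\<^esub> b \<in> conj_group g K"
    using K(2)[OF x(1) y(1)] by (auto simp: conj_group_def)
qed

lemma uminus_id2_mem_conj_group:
  assumes "sl2 g" "- id2 \<in> K"
  shows "- id2 \<in> conj_group g K"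
  using assms by (simp add: mem_conj_group uminus_mult sl2_inv)

lemma trace_conj:
  assumes "sl2 g"
  shows "trace (g ** A ** matrix_inv g) = trace (A :: real^2^2)"
proof -
  have "trace (g ** A ** matrix_inv g) = trace (matrix_inv g ** (g ** A))" by (rule trace_mul_sym)
  then show ?thesis using assms by (simp add: sl2_inv_cancel)
qed

lemma conj_eq_uminus_id2:
  assumes "sl2 g" "g ** A ** matrix_inv g = - id2"
  shows "A = - id2"
proof -
  have "A = matrix_inv g ** (g ** A ** matrix_inv g) ** g"
    using assms(1) by (simp add: matrix_mul_assoc sl2_inv_cancel sl2_inv)
  then show ?thesis using assms by (simp add: uminus_mult sl2_inv)
qed

lemma conj_eq_id2:
  assumes "sl2 g" "g ** A ** matrix_inv g = id2"
  shows "A = id2"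
proof -
  have "A = matrix_inv g ** (g ** A ** matrix_inv g) ** g"
    using assms(1) by (simp add: matrix_mul_assoc sl2_inv_cancel sl2_inv)
  then show ?thesis using assms by (simp add: uminus_mult sl2_inv)
qed

lemma is_cusp_conj_group:
  assumes "sl2 g" "subgroup K SL2R" "is_cusp K c"
  shows "is_cusp (conj_group g K) (moebius_bd g c)"
proof -
  obtain x where x: "x \<in> K" "parabolic x" "x \<noteq> id2" "x \<noteq> - id2" "moebius_bd x c = c"
    using assms(3) by (auto simp: is_cusp_def)
  have "sl2 x" using subgroup_SL2R_D(1)[OF assms(2)] x by auto
  show ?thesis unfolding is_cusp_def
  proof (intro bexI conjI)
    show "g ** x ** matrix_inv g \<in> conj_group g K" using x(1) by (auto simp: conj_group_def)
    show "parabolic (g ** x ** matrix_inv g)" using x(2) assms(1) by (simp add: parabolic_def trace_conj)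
    show "g ** x ** matrix_inv g \<noteq> id2" "g ** x ** matrix_inv g \<noteq> - id2"
      using x assms(1) conj_eq_id2 conj_eq_uminus_id2 by blast+
    show "moebius_bd (g ** x ** matrix_inv g) (moebius_bd g c) = moebius_bd g c"
      using assms(1) \<open>sl2 x\<close> x(5) by (simp add: moebius_bd_mult sl2_mult sl2_inv moebius_bd_inv)
  qed
qed

lemma continuous_on_conj: "continuous_on UNIV (\<lambda>x :: real^2^2. A ** x ** B)"
  unfolding matrix_matrix_mult_def by (intro continuous_intros)

text \<open>Conjugation is a homeomorphism: the preimage under the inverse conjugation of an open
  set isolating a point of \<open>K\<close> isolates its conjugate.\<close>

lemma discrete_conj_group:
  assumes "sl2 g" "discrete K"
  shows "discrete (conj_group g K)"
proof (rule discreteI)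
  fix y assume y: "y \<in> conj_group g K"
  let ?f = "\<lambda>x. matrix_inv g ** x ** g"
  have "?f y isolated_in K" using y assms by (auto intro: discreteD simp: mem_conj_group)
  then obtain U where U: "open U" "U \<inter> K = {?f y}" by (auto simp: isolated_in_def)
  have "open (?f -` U)" using open_vimage[OF U(1) continuous_on_conj] .
  moreover have "?f -` U \<inter> conj_group g K = {y}"
  proof
    show "?f -` U \<inter> conj_group g K \<subseteq> {y}"
    proof
      fix z assume "z \<in> ?f -` U \<inter> conj_group g K"
      then have "?f z = ?f y" using U(2) by (auto simp: mem_conj_group assms)
      then have "g ** ?f z ** matrix_inv g = g ** ?f y ** matrix_inv g" by simp
      then show "z \<in> {y}" using assms(1) by (simp add: matrix_mul_assoc sl2_inv_cancel sl2_inv)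
    qed
    show "{y} \<subseteq> ?f -` U \<inter> conj_group g K" using y U(2) by auto
  qed
  ultimately show "y isolated_in conj_group g K" using y unfolding isolated_in_def by blast
qed

lemma discrete_subset: "discrete S \<Longrightarrow> S' \<subseteq> S \<Longrightarrow> discrete S'"
proof (rule discreteI)
  fix x assume *: "discrete S" "S' \<subseteq> S" "x \<in> S'"
  then have "x isolated_in S" by (auto intro: discreteD)
  then obtain U where "open U" "U \<inter> S = {x}" by (auto simp: isolated_in_def)
  moreover from this * have "U \<inter> S' = {x}" by blast
  ultimately show "x isolated_in S'" using *(3) unfolding isolated_in_def by blast
qed

section \<open>Cusp widths\<close>

lemma cusp_translation_Infty [simp]: "cusp_translation Infty x = mat2 1 x 0 1"
  by (simp add: cusp_translation_def)

lemma sl2_cusp_translation [simp]: "sl2 (cusp_translation c x)"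
  by (simp add: cusp_translation_def det_mul sl2_inv)

lemma cusp_translation_add: "cusp_translation c x ** cusp_translation c y = cusp_translation c (x + y)"
proof -
  have "cusp_translation c x ** cusp_translation c y
      = cusp_mat c ** (mat2 1 x 0 1 ** mat2 1 y 0 1) ** matrix_inv (cusp_mat c)"
    unfolding cusp_translation_def by (simp only: matrix_mul_assoc sl2_inv_cancel sl2_cusp_mat)
  then show ?thesis by (simp add: cusp_translation_def add.commute)
qed

lemma cusp_translation_0 [simp]: "cusp_translation c 0 = id2"
  by (simp add: cusp_translation_def id2_mat2[symmetric] sl2_inv)

lemma matrix_inv_cusp_translation: "matrix_inv (cusp_translation c x) = cusp_translation c (- x)"
  by (rule matrix_inv_unique) (simp_all add: cusp_translation_add)

lemma moebius_bd_cusp_translation [simp]: "moebius_bd (cusp_translation c x) c = c"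
  by (simp add: cusp_translation_def moebius_bd_mult det_mul sl2_inv)

lemma trace_cusp_translation [simp]: "trace (cusp_translation c x) = 2"
  by (simp add: cusp_translation_def trace_conj)

lemma cusp_translation_eq_iff [simp]: "cusp_translation c x = cusp_translation c y \<longleftrightarrow> x = y"
proof
  assume "cusp_translation c x = cusp_translation c y"
  then have "matrix_inv (cusp_mat c) ** cusp_translation c x ** cusp_mat c
      = matrix_inv (cusp_mat c) ** cusp_translation c y ** cusp_mat c" by simp
  then show "x = y"
    by (simp add: cusp_translation_def matrix_mul_assoc sl2_inv_cancel sl2_inv)
qed simp

lemma cusp_translation_neq_uminus [simp]: "cusp_translation c x \<noteq> - cusp_translation c y"
proof
  assume "cusp_translation c x = - cusp_translation c y"
  then have "trace (cusp_translation c x) = trace (- cusp_translation c y)" by simp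
  moreover have "trace (- cusp_translation c y) = - trace (cusp_translation c y)"
    unfolding trace_def by (simp add: sum_negf)
  ultimately show False by simp
qed

lemma cusp_translation_eq_id2 [simp]: "cusp_translation c x = id2 \<longleftrightarrow> x = 0"
  using cusp_translation_eq_iff[of c x 0] by (simp del: cusp_translation_eq_iff)

text \<open>The full preimage in SL2(R) of a set of translations in PSL2(R). As the groups of the
  theorem contain -I, their stabilizers can be computed with matrices up to sign rather than with
  classes.\<close>

definition pm_translations :: "boundary_point \<Rightarrow> real set \<Rightarrow> (real^2^2) set" where
  "pm_translations c S = cusp_translation c ` S \<union> uminus ` cusp_translation c ` S"

lemma pm_translations_eq_iff: "pm_translations c S = pm_translations c S' \<longleftrightarrow> S = S'"
proof
  assume e: "pm_translations c S = pm_translations c S'"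
  have *: "x \<in> S \<longleftrightarrow> cusp_translation c x \<in> pm_translations c S" for x S
    by (auto simp: pm_translations_def)
  show "S = S'" using e by (auto simp: *)
qed simp

definition int_multiples :: "real \<Rightarrow> real set" where
  "int_multiples h = range (\<lambda>n :: int. of_int n * h)"

text \<open>A relational form of \<open>cusp_width\<close>, which is a definite description over
  generators in PSL2(R). A relation can be transported along conjugations before uniqueness is
  invoked.\<close>

definition has_width :: "(real^2^2) set \<Rightarrow> boundary_point \<Rightarrow> real \<Rightarrow> bool" where
  "has_width K c h \<longleftrightarrow> h > 0 \<and> bd_stabilizer K c = pm_translations c (int_multiples h)"

text \<open>Each of the two positive generators is a positive integral multiple of the
  other.\<close>

lemma int_multiples_inj:
  assumes "h > 0" "h' > 0" "int_multiples h = int_multiples h'"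
  shows "h = h'"
proof -
  have "h' \<ge> h" if "h > 0" "h' > 0" "h' \<in> int_multiples h" for h h' :: real
  proof -
    obtain n :: int where n: "h' = of_int n * h" using \<open>h' \<in> int_multiples h\<close> by (auto simp: int_multiples_def)
    then have "n > 0" using that by (simp add: zero_less_mult_iff)
    then have "of_int n \<ge> (1::real)" by linarith
    then show ?thesis using n \<open>h > 0\<close> by simp
  qed
  moreover have "h \<in> int_multiples h" for h by (auto simp: int_multiples_def intro: range_eqI[of _ _ 1])
  ultimately show ?thesis using assms by (metis order_antisym)
qed

lemma has_width_unique: "has_width K c h \<Longrightarrow> has_width K c h' \<Longrightarrow> h = h'"
  unfolding has_width_def using int_multiples_inj pm_translations_eq_iff by metis

section \<open>Classes modulo sign and the stabilizer in PSL2(R)\<close>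

lemma psl_eq: "psl x = {x, - x}"
  by (auto simp: psl_def r_coset_def uminus_mult)

lemma normal_pm: "{id2, - id2} \<lhd> SL2R"
proof -
  have s: "subgroup {id2, - id2} SL2R"
    by (rule group.subgroupI[OF group_SL2R])
      (auto simp: inv_SL2R matrix_inv_uminus uminus_mult)
  then show ?thesis
    unfolding group.normal_inv_iff[OF group_SL2R]
    by (auto simp: inv_SL2R uminus_mult sl2_inv)
qed

lemma group_PSL2R: "group PSL2R"
  unfolding PSL2R_def by (rule normal.factorgroup_is_group[OF normal_pm])

lemma psl_mult: "psl x \<otimes>\<^bsub>PSL2R\<^esub> psl y = psl (x ** y)"
  by (auto simp: PSL2R_def FactGroup_def set_mult_def psl_eq uminus_mult)

lemma psl_one: "\<one>\<^bsub>PSL2R\<^esub> = psl id2"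
  by (simp add: PSL2R_def FactGroup_def psl_eq)

lemma psl_carrier: "sl2 x \<Longrightarrow> psl x \<in> carrier PSL2R"
  by (auto simp: PSL2R_def FactGroup_def RCOSETS_def psl_def)

lemma psl_cusp_translation_pow:
  "psl (cusp_translation c h) [^]\<^bsub>PSL2R\<^esub> (k :: int) = psl (cusp_translation c (of_int k * h))"
proof -
  interpret group PSL2R by (rule group_PSL2R)
  have nat: "psl (cusp_translation c h) [^]\<^bsub>PSL2R\<^esub> (n :: nat) = psl (cusp_translation c (of_nat n * h))" for n
    by (induction n) (simp_all add: psl_one psl_mult cusp_translation_add algebra_simps)
  show ?thesis
  proof (cases k)
    case (nonneg n)
    then show ?thesis by (simp add: int_pow_int nat)
  next
    case (neg n)
    have "inv\<^bsub>PSL2R\<^esub> psl (cusp_translation c (of_nat (Suc n) * h)) = psl (cusp_translation c (- (of_nat (Suc n) * h)))"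
      by (rule inv_equality) (simp_all add: psl_mult psl_one cusp_translation_add psl_carrier)
    moreover have "psl (cusp_translation c h) [^]\<^bsub>PSL2R\<^esub> (- int (Suc n))
        = inv\<^bsub>PSL2R\<^esub> (psl (cusp_translation c h) [^]\<^bsub>PSL2R\<^esub> Suc n)"
      by (rule int_pow_neg_int) (simp add: psl_carrier)
    moreover have "of_int (- int (Suc n)) * h = - (of_nat (Suc n) * h)" by (simp add: algebra_simps)
    ultimately show ?thesis by (simp only: neg nat)
  qed
qed

lemma psl_image_pm_translations: "psl ` pm_translations c S = psl ` cusp_translation c ` S"
  by (auto simp: pm_translations_def psl_eq image_image image_Un)

lemma bd_stabilizer_uminus:
  assumes "subgroup K SL2R" "- id2 \<in> K" "x \<in> bd_stabilizer K c"
  shows "- x \<in> bd_stabilizer K c"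
proof -
  have "x \<in> K" using assms(3) by (simp add: bd_stabilizer_def)
  then have "(- id2) ** x \<in> K" using subgroup_SL2R_D(2)[OF assms(1)] assms(2) by blast
  then show ?thesis using assms(3) by (simp add: uminus_mult bd_stabilizer_def)
qed

text \<open>Uniting the classes of a set closed under negation returns the set, so equality of
  images in PSL2(R) is the same as equality in SL2(R); -I in \<open>K\<close> makes the stabilizer
  closed under negation.\<close>

lemma generate_eq_stabilizer_iff:
  assumes "subgroup K SL2R" "- id2 \<in> K"
  shows "generate PSL2R {psl (cusp_translation c h)} = psl ` bd_stabilizer K c \<longleftrightarrow>
    bd_stabilizer K c = pm_translations c (int_multiples h)"
proof -
  have "generate PSL2R {psl (cusp_translation c h)} = psl ` cusp_translation c ` int_multiples h"
    by (subst group.generate_pow[OF group_PSL2R])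
      (auto simp: psl_carrier psl_cusp_translation_pow int_multiples_def)
  then have g: "generate PSL2R {psl (cusp_translation c h)} = psl ` pm_translations c (int_multiples h)"
    by (simp add: psl_image_pm_translations)
  have u: "\<Union> (psl ` S) = S" if "\<And>x. x \<in> S \<Longrightarrow> - x \<in> S" for S
    using that by (auto simp: psl_eq)
  have "\<Union> (psl ` bd_stabilizer K c) = bd_stabilizer K c"
    by (rule u) (rule bd_stabilizer_uminus[OF assms])
  moreover have "\<Union> (psl ` pm_translations c (int_multiples h)) = pm_translations c (int_multiples h)"
    by (rule u) (auto simp: pm_translations_def)
  ultimately show ?thesis unfolding g by metis
qed

lemma cusp_width_eq:
  assumes "subgroup K SL2R" "- id2 \<in> K" "has_width K c h"
  shows "cusp_width K c = h"
  unfolding cusp_width_def generate_eq_stabilizer_iff[OF assms(1,2)] has_width_def[symmetric]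
  using assms(3) by (blast intro: has_width_unique)

text \<open>In coordinates that put both cusps at infinity, \<open>g\<close> is upper triangular
  with diagonal \<alpha>, 1/\<alpha>; conjugation by such a matrix multiplies a translation by
  \<alpha>^2, whatever \<beta> is.\<close>

lemma conj_cusp_translation:
  assumes "sl2 g" "matrix_inv (cusp_mat (moebius_bd g c)) ** g ** cusp_mat c = mat2 \<alpha> \<beta> 0 (1 / \<alpha>)"
    and "\<alpha> \<noteq> 0"
  shows "g ** cusp_translation c x ** matrix_inv g = cusp_translation (moebius_bd g c) (\<alpha>\<^sup>2 * x)"
proof -
  let ?A = "cusp_mat c" and ?B = "cusp_mat (moebius_bd g c)" and ?U = "mat2 \<alpha> \<beta> 0 (1 / \<alpha>)"
  have U: "sl2 ?U" using assms(3) by simp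
  have g: "g = ?B ** ?U ** matrix_inv ?A"
    unfolding assms(2)[symmetric] by (simp add: matrix_mul_assoc sl2_inv_cancel sl2_inv)
  have gi: "matrix_inv g = ?A ** matrix_inv ?U ** matrix_inv ?B"
    using U by (subst g) (simp add: sl2_inv_mult sl2_mult sl2_inv matrix_mul_assoc del: det_mat2)
  have "g ** cusp_translation c x ** matrix_inv g
      = ?B ** (?U ** mat2 1 x 0 1 ** matrix_inv ?U) ** matrix_inv ?B"
    unfolding gi by (subst g) (simp only: cusp_translation_def matrix_mul_assoc sl2_inv_cancel sl2_cusp_mat)
  also have "?U ** mat2 1 x 0 1 ** matrix_inv ?U = mat2 1 (\<alpha>\<^sup>2 * x) 0 1"
    using assms(3) by (simp add: matrix_inv_mat2 power2_eq_square algebra_simps)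
  finally show ?thesis by (simp add: cusp_translation_def)
qed

lemma cusp_change:
  assumes "sl2 g"
  obtains \<alpha> \<beta> where "\<alpha> \<noteq> 0" "matrix_inv (cusp_mat (moebius_bd g c)) ** g ** cusp_mat c = mat2 \<alpha> \<beta> 0 (1 / \<alpha>)"
proof -
  let ?U = "matrix_inv (cusp_mat (moebius_bd g c)) ** g ** cusp_mat c"
  have s: "sl2 ?U" using assms by (simp add: det_mul sl2_inv)
  have "moebius_bd ?U Infty = Infty"
    using assms by (simp add: moebius_bd_mult sl2_mult sl2_inv)
  from moebius_bd_fixes_Infty[OF s this] that show ?thesis by metis
qed

lemma bd_stabilizer_conj_group:
  assumes "sl2 g" "subgroup K SL2R"
  shows "bd_stabilizer (conj_group g K) (moebius_bd g c) = conj_group g (bd_stabilizer K c)"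
proof -
  have "moebius_bd x (moebius_bd g c) = moebius_bd g c \<longleftrightarrow>
      moebius_bd (matrix_inv g ** x ** g) c = c" if "sl2 x" for x
  proof -
    have e: "moebius_bd (matrix_inv g ** x ** g) c = moebius_bd (matrix_inv g) (moebius_bd x (moebius_bd g c))"
      using assms(1) that by (simp add: moebius_bd_mult sl2_mult sl2_inv)
    show ?thesis unfolding e using assms(1) by (metis moebius_bd_inv)
  qed
  moreover have "sl2 x" if "x \<in> conj_group g K" for x
    using subgroup_SL2R_D(1)[OF subgroup_conj_group[OF assms]] that .
  ultimately show ?thesis
    by (auto simp: bd_stabilizer_def mem_conj_group[OF assms(1)])
qed

lemma has_width_conj_group:
  assumes "sl2 g" "subgroup K SL2R" "has_width K c h"
    "matrix_inv (cusp_mat (moebius_bd g c)) ** g ** cusp_mat c = mat2 \<alpha> \<beta> 0 (1 / \<alpha>)" "\<alpha> \<noteq> 0"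
  shows "has_width (conj_group g K) (moebius_bd g c) (\<alpha>\<^sup>2 * h)"
proof -
  have "bd_stabilizer (conj_group g K) (moebius_bd g c) = conj_group g (pm_translations c (int_multiples h))"
    using assms(3) by (simp add: bd_stabilizer_conj_group[OF assms(1,2)] has_width_def)
  also have "\<dots> = pm_translations (moebius_bd g c) (int_multiples (\<alpha>\<^sup>2 * h))"
    unfolding pm_translations_def conj_group_def image_Un image_image uminus_mult int_multiples_def
      conj_cusp_translation[OF assms(1,4,5)]
    by (simp add: mult.left_commute)
  finally show ?thesis using assms(3,5) by (simp add: has_width_def)
qed

text \<open>The infimum of the positive elements is attained, since distinct elements are at
  distance at least \<open>e\<close>; division with remainder by this least element then gives all
  others.\<close>

lemma discrete_real_subgroup:
  fixes S :: "real set"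
  assumes zero: "0 \<in> S" and diff: "\<And>x y. x \<in> S \<Longrightarrow> y \<in> S \<Longrightarrow> x - y \<in> S"
    and e: "e > 0" "\<And>x. x \<in> S \<Longrightarrow> \<bar>x\<bar> < e \<Longrightarrow> x = 0" and nz: "x \<in> S" "x \<noteq> 0"
  shows "\<exists>h>0. S = int_multiples h"
proof -
  define P where "P = {x \<in> S. x > 0}"
  have um: "- x \<in> S" if "x \<in> S" for x using diff[OF zero that] by simp
  have ad: "x + y \<in> S" if "x \<in> S" "y \<in> S" for x y using diff[OF that(1) um[OF that(2)]] by simp
  have ne: "P \<noteq> {}"
  proof (cases "x > 0")
    case True then show ?thesis using nz by (auto simp: P_def)
  next
    case False then have "- x \<in> P" using nz um by (auto simp: P_def)
    then show ?thesis by auto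
  qed
  have bdd: "bdd_below P" by (rule bdd_belowI[of _ 0]) (auto simp: P_def)
  have "Inf P < Inf P + e" using e(1) by simp
  then obtain h where h: "h \<in> P" "h < Inf P + e"
    using cInf_less_iff[OF ne bdd] by blast
  have least: "h \<le> y" if "y \<in> P" for y
  proof (rule ccontr)
    assume "\<not> h \<le> y"
    moreover have "Inf P \<le> y" using that bdd by (rule cInf_lower)
    ultimately have "\<bar>h - y\<bar> < e" using h(2) by linarith
    moreover have "h - y \<in> S" using h(1) that diff by (auto simp: P_def)
    ultimately have "h - y = 0" using e(2) by blast
    then show False using \<open>\<not> h \<le> y\<close> by simp
  qed
  have hp: "h > 0" "h \<in> S" using h(1) by (auto simp: P_def)
  have natm: "of_nat n * h \<in> S" for n
    by (induction n) (auto simp: zero algebra_simps intro: ad hp)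
  have intm: "of_int n * h \<in> S" for n
  proof (cases n)
    case (nonneg k) then show ?thesis using natm[of k] by simp
  next
    case (neg k) 
    have "of_int n * h = - (of_nat (Suc k) * h)" unfolding neg by (simp add: algebra_simps)
    then show ?thesis using um[OF natm[of "Suc k"]] by (simp only:)
  qed
  have "y \<in> int_multiples h" if "y \<in> S" for y
  proof -
    define n where "n = \<lfloor>y / h\<rfloor>"
    have "of_int n \<le> y / h" "y / h < of_int n + 1" by (simp_all add: n_def)
    then have "of_int n * h \<le> y" "y < of_int n * h + h" using hp(1) by (simp_all add: field_simps)
    moreover have "y - of_int n * h \<in> S" using diff[OF that intm] .
    then have "h \<le> y - of_int n * h" if "y - of_int n * h > 0"
      using least[of "y - of_int n * h"] that by (simp add: P_def)
    ultimately have "y = of_int n * h" by (cases "y - of_int n * h > 0") auto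
    then show ?thesis by (auto simp: int_multiples_def)
  qed
  then have "S = int_multiples h" using intm by (auto simp: int_multiples_def)
  then show ?thesis using hp(1) by blast
qed

lemma stabilizer_pm_translations:
  assumes "subgroup K SL2R" "- id2 \<in> K"
    and "\<And>x. x \<in> bd_stabilizer K c \<Longrightarrow> \<exists>y. x = cusp_translation c y \<or> x = - cusp_translation c y"
  shows "bd_stabilizer K c = pm_translations c {y. cusp_translation c y \<in> K}" (is "?L = ?R")
proof
  note st = bd_stabilizer_uminus[OF assms(1,2)]
  show "?L \<subseteq> ?R"
  proof
    fix x assume x: "x \<in> ?L"
    then obtain y where y: "x = cusp_translation c y \<or> x = - cusp_translation c y" using assms(3) by blast
    then have "cusp_translation c y \<in> K" using x st[OF x] by (auto simp: bd_stabilizer_def)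
    then show "x \<in> ?R" using y by (auto simp: pm_translations_def)
  qed
  have "cusp_translation c y \<in> ?L" if "cusp_translation c y \<in> K" for y
    using that by (simp add: bd_stabilizer_def)
  then show "?R \<subseteq> ?L" using st by (auto simp: pm_translations_def)
qed

lemma translation_subgroup:
  assumes "subgroup K SL2R" "cusp_translation c x \<in> K" "cusp_translation c y \<in> K"
  shows "cusp_translation c (x - y) \<in> K"
proof -
  have "cusp_translation c x ** matrix_inv (cusp_translation c y) \<in> K"
    using subgroup_SL2R_D(2,3)[OF assms(1)] assms by blast
  then show ?thesis by (simp add: matrix_inv_cusp_translation cusp_translation_add)
qed

lemma dist_id2_unipotent: "dist id2 (mat2 1 x 0 1) = \<bar>x\<bar>"
  by (simp add: id2_mat2 dist_vec_def L2_set_def sum_2 dist_real_def)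

text \<open>A hyperbolic element fixing the cusp would contract a parabolic one to the identity.\<close>

lemma ex_has_width_Infty:
  assumes K: "subgroup K SL2R" "- id2 \<in> K" and disc: "discrete K" and cusp: "is_cusp K Infty"
  shows "\<exists>h. has_width K Infty h"
proof -
  note K' = subgroup_SL2R_D[OF K(1)]
  have neg: "- x \<in> K" if "x \<in> K" for x
    using K'(2)[OF K(2) that] by (simp add: uminus_mult)
  have "id2 isolated_in K" using disc K'(4) by (rule discreteD)
  then obtain e where e: "e > 0" "\<And>y. y \<in> K \<Longrightarrow> dist id2 y < e \<Longrightarrow> y = id2"
    by (auto simp: isolated_in_dist_Ex_iff)
  have small: "x = 0" if "mat2 1 x 0 1 \<in> K" "\<bar>x\<bar> < e" for x
    using e(2)[OF that(1)] that(2) by (simp add: dist_id2_unipotent) (simp add: id2_mat2)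
  obtain \<gamma> where \<gamma>: "\<gamma> \<in> K" "parabolic \<gamma>" "\<gamma> \<noteq> id2" "\<gamma> \<noteq> - id2" "moebius_bd \<gamma> Infty = Infty"
    using cusp by (auto simp: is_cusp_def)
  obtain a b where ab: "a \<noteq> 0" "\<gamma> = mat2 a b 0 (1 / a)"
    using moebius_bd_fixes_Infty[OF K'(1)[OF \<gamma>(1)] \<gamma>(5)] by metis
  \<comment> \<open>Trace 2 or -2 together with determinant 1 forces \<open>a\<close> to be 1 or -1,
    and -I in \<open>K\<close> removes the sign, so \<open>K\<close> contains a nontrivial
    translation.\<close>
  obtain x0 where x0: "mat2 1 x0 0 1 \<in> K" "x0 \<noteq> 0"
  proof -
    have "a + 1 / a = 2 \<or> a + 1 / a = - 2" using \<gamma>(2) by (simp add: ab(2) parabolic_def)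
    then have "a * a + 1 = 2 * a \<or> a * a + 1 = - 2 * a"
      using ab(1) by (auto simp: field_simps)
    then have "(a - 1)\<^sup>2 = 0 \<or> (a + 1)\<^sup>2 = 0" by (auto simp: power2_eq_square algebra_simps)
    then have "a = 1 \<or> a = -1" by auto
    then show thesis
    proof
      assume "a = 1"
      then show thesis using that[of b] \<gamma> ab(2) by (auto simp: id2_mat2)
    next
      assume "a = -1"
      then show thesis using that[of "- b"] \<gamma> neg[OF \<gamma>(1)] ab(2) by (auto simp: id2_mat2)
    qed
  qed
  have no_contract: False if nc: "mat2 a b 0 (1 / a) \<in> K" "a \<noteq> 0" "a\<^sup>2 < 1" for a b
  proof -
    have "mat2 1 ((a\<^sup>2) ^ n * x0) 0 1 \<in> K" for n
    proof (induction n)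
      case (Suc n)
      have "mat2 a b 0 (1 / a) ** mat2 1 ((a\<^sup>2) ^ n * x0) 0 1 ** matrix_inv (mat2 a b 0 (1 / a)) \<in> K"
        using Suc nc(1) K'(2,3) by blast
      also have "mat2 a b 0 (1 / a) ** mat2 1 ((a\<^sup>2) ^ n * x0) 0 1 ** matrix_inv (mat2 a b 0 (1 / a))
          = mat2 1 ((a\<^sup>2) ^ Suc n * x0) 0 1"
        using nc(2) by (simp add: matrix_inv_mat2 power2_eq_square algebra_simps)
      finally show ?case .
    qed (simp add: x0)
    moreover obtain n where n: "(a\<^sup>2) ^ n < e / \<bar>x0\<bar>"
      using real_arch_pow_inv[OF _ nc(3), of "e / \<bar>x0\<bar>"] e(1) x0(2) by auto
    then have "\<bar>(a\<^sup>2) ^ n * x0\<bar> < e" using x0(2) by (simp add: abs_mult field_simps)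
    ultimately have "(a\<^sup>2) ^ n * x0 = 0" using small by blast
    then show False using nc(2) x0(2) by simp
  qed
  have tr: "\<exists>y. x = cusp_translation Infty y \<or> x = - cusp_translation Infty y"
    if "x \<in> bd_stabilizer K Infty" for x
  proof -
    have x: "x \<in> K" "moebius_bd x Infty = Infty" using that by (auto simp: bd_stabilizer_def)
    obtain a b where ab: "a \<noteq> 0" "x = mat2 a b 0 (1 / a)"
      using moebius_bd_fixes_Infty[OF K'(1)[OF x(1)] x(2)] by metis
    have "\<not> a\<^sup>2 < 1" using no_contract ab x(1) by blast
    \<comment> \<open>The inverse has 1/a in the upper left corner, so expansion is excluded as well
      as contraction and a^2 = 1.\<close>
    moreover have "\<not> (1 / a)\<^sup>2 < 1"
    proof
      assume *: "(1 / a)\<^sup>2 < 1"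
      have "mat2 (1 / a) (- b) 0 (1 / (1 / a)) \<in> K"
        using K'(3)[OF x(1)] ab by (simp add: matrix_inv_mat2)
      then show False using no_contract[OF _ _ *] ab(1) by simp
    qed
    ultimately have "a\<^sup>2 = 1" using ab(1) by (auto simp: power_divide field_simps)
    then have "a = 1 \<or> a = -1" by (simp add: power2_eq_1_iff)
    then show ?thesis
    proof
      assume "a = 1" then show ?thesis using ab(2) by auto
    next
      assume "a = -1" then show ?thesis using ab(2) by (auto intro: exI[of _ "- b"])
    qed
  qed
  have st: "bd_stabilizer K Infty = pm_translations Infty {y. cusp_translation Infty y \<in> K}"
    by (rule stabilizer_pm_translations[OF K]) (rule tr)
  have "\<exists>h>0. {y. cusp_translation Infty y \<in> K} = int_multiples h"
    by (rule discrete_real_subgroup[of _ e x0])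
      (use K'(4) translation_subgroup[OF K(1), of Infty] e(1) small x0 in \<open>auto simp: id2_mat2\<close>)
  then obtain h where "h > 0" "{y. cusp_translation Infty y \<in> K} = int_multiples h" by blast
  then have "has_width K Infty h" by (simp only: has_width_def st simp_thms)
  then show ?thesis ..
qed

text \<open>The cusp is moved to infinity by \<open>cusp_mat\<close> and back; on the way back the
  upper triangular matrix is the identity (\<alpha> = 1, \<beta> = 0), so the width is
  unchanged.\<close>

lemma ex_has_width:
  assumes K: "subgroup K SL2R" "- id2 \<in> K" and "discrete K" and "is_cusp K c"
  shows "\<exists>h. has_width K c h"
proof -
  let ?A = "cusp_mat c" let ?K = "conj_group (matrix_inv ?A) K"
  have A: "sl2 (matrix_inv ?A)" by (simp add: sl2_inv)
  have c: "moebius_bd (matrix_inv ?A) c = Infty" by simp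
  have sub: "subgroup ?K SL2R" by (rule subgroup_conj_group[OF A K(1)])
  have "is_cusp ?K Infty" using is_cusp_conj_group[OF A K(1) assms(4)] by (simp add: c)
  then obtain h where h: "has_width ?K Infty h"
    using ex_has_width_Infty sub uminus_id2_mem_conj_group[OF A K(2)] discrete_conj_group[OF A assms(3)] by blast
  have "has_width (conj_group ?A ?K) (moebius_bd ?A Infty) (1\<^sup>2 * h)"
    by (rule has_width_conj_group[OF _ sub h, of _ _ 0]) (simp_all add: sl2_inv id2_mat2[symmetric])
  moreover have "conj_group ?A ?K = K"
    by (simp add: conj_group_conj_group A sl2_inv) (simp add: conj_group_def)
  ultimately show ?thesis by auto
qed

text \<open>Modulo sign the stabilizers consist of the translations by multiples of \<open>w\<close>
  and of some k w, so the cosets are the classes of integers modulo k, which identifies k with the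
  index.\<close>

lemma ex_cusp_index:
  assumes G: "subgroup G SL2R" and H: "subgroup H SL2R" "- id2 \<in> H" "H \<subseteq> G"
    and w: "has_width G c w" and cusp: "is_cusp H c"
  shows "cusp_index G H c > 0 \<and> has_width H c (of_nat (cusp_index G H c) * w)"
proof -
  have w0: "w > 0" and sG: "bd_stabilizer G c = pm_translations c (int_multiples w)"
    using w by (auto simp: has_width_def)
  have sub: "bd_stabilizer H c \<subseteq> bd_stabilizer G c" using H(3) by (auto simp: bd_stabilizer_def)
  have trG: "x \<in> int_multiples w" if "cusp_translation c x \<in> H" for x
  proof -
    have "cusp_translation c x \<in> pm_translations c (int_multiples w)"
      using that sub sG by (auto simp: bd_stabilizer_def)
    then show ?thesis by (auto simp: pm_translations_def)
  qed
  \<comment> \<open>The stabilizer in \<open>H\<close> consists of signed translations because it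
    lies in that of \<open>G\<close>.\<close>
  have st: "bd_stabilizer H c = pm_translations c {y. cusp_translation c y \<in> H}"
    by (rule stabilizer_pm_translations[OF H(1,2)]) (use sub sG in \<open>auto simp: pm_translations_def\<close>)
  obtain \<gamma> where \<gamma>: "\<gamma> \<in> H" "\<gamma> \<noteq> id2" "\<gamma> \<noteq> - id2" "moebius_bd \<gamma> c = c"
    using cusp by (auto simp: is_cusp_def)
  then have "\<gamma> \<in> pm_translations c {y. cusp_translation c y \<in> H}"
    unfolding st[symmetric] by (simp add: bd_stabilizer_def)
  then obtain x where x: "cusp_translation c x \<in> H" "x \<noteq> 0"
    using \<gamma>(2,3) by (auto simp: pm_translations_def)
  \<comment> \<open>All translations of \<open>H\<close> are by multiples of \<open>w\<close>, so
    \<open>w\<close> itself serves as the separation constant.\<close>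
  have "\<exists>h>0. {y. cusp_translation c y \<in> H} = int_multiples h"
  proof (rule discrete_real_subgroup[of _ w x])
    fix y assume "y \<in> {y. cusp_translation c y \<in> H}" "\<bar>y\<bar> < w"
    then obtain n :: int where n: "y = of_int n * w" using trG by (auto simp: int_multiples_def)
    with \<open>\<bar>y\<bar> < w\<close> w0 have "\<bar>of_int n\<bar> < (1::real)" by (simp add: abs_mult)
    then have "n = 0" by linarith
    then show "y = 0" using n by simp
  qed (use x w0 subgroup_SL2R_D(4)[OF H(1)] translation_subgroup[OF H(1)] in auto)
  then obtain h where h: "h > 0" "{y. cusp_translation c y \<in> H} = int_multiples h" by blast
  have "h \<in> {y. cusp_translation c y \<in> H}" unfolding h(2)
    by (auto simp: int_multiples_def intro: range_eqI[of _ _ 1])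
  then obtain k' :: int where k': "h = of_int k' * w" using trG by (auto simp: int_multiples_def)
  then have "k' > 0" using h(1) w0 by (simp add: zero_less_mult_iff)
  then obtain k :: nat where k: "k' = int k" "k > 0" using pos_int_cases by blast
  have hk: "h = of_nat k * w" using k' k(1) by simp
  have wH: "has_width H c (of_nat k * w)" unfolding has_width_def using st h hk by simp
  \<comment> \<open>\<open>C n\<close> is the coset of the translation by n w, that is, the class of
    n modulo k.\<close>
  define C where "C n = (\<lambda>j :: int. psl (cusp_translation c (of_int (n + j * int k) * w))) ` UNIV" for n
  have coset: "(psl ` bd_stabilizer H c) #>\<^bsub>PSL2R\<lparr>carrier := psl ` bd_stabilizer G c\<rparr>\<^esub>
      psl (cusp_translation c (of_int n * w)) = C n" for n
    unfolding st h(2) hk psl_image_pm_translations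
    by (auto simp: r_coset_def C_def int_multiples_def psl_mult cusp_translation_add algebra_simps)
  have psl_inj: "psl (cusp_translation c x) = psl (cusp_translation c y) \<longleftrightarrow> x = y" for x y
    by (auto simp: psl_eq doubleton_eq_iff)
  have "rcosets\<^bsub>PSL2R\<lparr>carrier := psl ` bd_stabilizer G c\<rparr>\<^esub> (psl ` bd_stabilizer H c) = range C"
    unfolding RCOSETS_def using coset
    by (auto simp: sG psl_image_pm_translations int_multiples_def)
  also have "\<dots> = C ` {0..<int k}"
  proof -
    have "C n = C (n mod int k)" for n
    proof -
      have e: "n + j * int k = n mod int k + (j + n div int k) * int k" for j
        using mod_div_mult_eq[of n "int k"] by (simp add: algebra_simps)
      have "C n = (\<lambda>j. psl (cusp_translation c (of_int (n mod int k + j * int k) * w))) ` range (\<lambda>j. j + n div int k)"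
        unfolding C_def image_image e by simp
      also have "range (\<lambda>j. j + n div int k) = UNIV"
        by (rule surjI[of _ "\<lambda>j. j - n div int k"]) simp
      finally show ?thesis by (simp add: C_def)
    qed
    moreover have "n mod int k \<in> {0..<int k}" for n using k(2) by simp
    ultimately show ?thesis by blast
  qed
  finally have "cusp_index G H c = card (C ` {0..<int k})"
    by (simp add: cusp_index_def group_index_def)
  also have "inj_on C {0..<int k}"
  proof (rule inj_onI)
    fix n n' assume n: "n \<in> {0..<int k}" "n' \<in> {0..<int k}" "C n = C n'"
    have "psl (cusp_translation c (of_int (n + 0 * int k) * w)) \<in> C n" unfolding C_def by (rule rangeI)
    then obtain j where "psl (cusp_translation c (of_int (n + 0 * int k) * w))
        = psl (cusp_translation c (of_int (n' + j * int k) * w))"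
      unfolding n(3) unfolding C_def by blast
    then have "real_of_int (n + 0 * int k) * w = of_int (n' + j * int k) * w"
      by (simp only: psl_inj)
    then have "real_of_int (n + 0 * int k) = of_int (n' + j * int k)"
      using w0 by (simp only: mult_cancel_right) auto
    then have "n + 0 * int k = n' + j * int k" by (simp only: of_int_eq_iff)
    then have "n mod int k = n' mod int k" by simp
    then show "n = n'" using n by simp
  qed
  then have "card (C ` {0..<int k}) = k" by (simp add: card_image)
  finally show ?thesis using wH k(2) by simp
qed

lemma cusp_translation_pow: "cusp_translation c h [^]\<^bsub>SL2R\<^esub> (j :: nat) = cusp_translation c (of_nat j * h)"
proof -
  interpret group SL2R by (rule group_SL2R)
  show ?thesis
    by (induction j) (simp_all add: cusp_translation_add algebra_simps)
qed

section \<open>Sizes of Jordan blocks\<close>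

text \<open>A basis of the smaller kernel is an independent subset of the larger one of the right
  cardinality, hence a basis of it.\<close>

lemma mat_kernel_subset_dim_eq:
  fixes A B :: "'a :: field Matrix.mat"
  assumes A: "A \<in> carrier_mat n n" and B: "B \<in> carrier_mat n n"
    and sub: "mat_kernel A \<subseteq> mat_kernel B" and dim: "kernel_dim A = kernel_dim B"
  shows "mat_kernel A = mat_kernel B"
proof -
  interpret A: kernel n n A by unfold_locales (rule A)
  interpret B: kernel n n B by unfold_locales (rule B)
  obtain bs where bs: "finite bs" "A.basis bs" using kernel_basis_exists[OF A] by auto
  obtain bs' where bs': "finite bs'" "B.basis bs'" using kernel_basis_exists[OF B] by auto
  have bsA: "bs \<subseteq> mat_kernel A" using bs(2) by (auto simp: A.Ker.basis_def)
  with sub have bsB: "bs \<subseteq> mat_kernel B" by blast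
  have "\<not> A.lin_dep bs" using bs(2) by (auto simp: A.Ker.basis_def)
  then have li: "\<not> B.lin_dep bs" by (simp add: A.lindep_same[OF bsA] B.lindep_same[OF bsB])
  have "card bs = B.dim" using A.Ker.dim_basis[OF bs] dim by simp
  moreover have "B.Ker.fin_dim"
    unfolding B.Ker.fin_dim_def using bs' by (auto simp: B.Ker.basis_def)
  ultimately have "B.basis bs" by (intro B.Ker.dim_li_is_basis) (use bs(1) bsB li in auto)
  then have "B.span bs = mat_kernel B" by (simp add: B.Ker.basis_def)
  moreover have "A.span bs = mat_kernel A" using bs(2) by (simp add: A.Ker.basis_def)
  ultimately show ?thesis by (simp add: A.span_same[OF bsA] B.span_same[OF bsB])
qed

lemma pow_mat_comm:
  fixes A B :: "'a :: comm_ring_1 Matrix.mat"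
  assumes A: "A \<in> carrier_mat n n" and B: "B \<in> carrier_mat n n" and AB: "A * B = B * A"
  shows "A * B ^\<^sub>m k = B ^\<^sub>m k * A"
proof (induction k)
  case 0
  then show ?case using A B by simp
next
  case (Suc k)
  have P: "B ^\<^sub>m k \<in> carrier_mat n n" using B by simp
  have "A * B ^\<^sub>m Suc k = A * B ^\<^sub>m k * B" using A B P by (simp add: assoc_mult_mat[of _ n n _ n _ n])
  also have "\<dots> = B ^\<^sub>m k * (A * B)" unfolding Suc using A B P by (simp add: assoc_mult_mat[of _ n n _ n _ n])
  also have "\<dots> = B ^\<^sub>m Suc k * A" unfolding AB using A B P by (simp add: assoc_mult_mat[of _ n n _ n _ n])
  finally show ?case .
qed

lemma pow_mat_Suc_left:
  fixes A :: "'a :: comm_ring_1 Matrix.mat"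
  assumes "A \<in> carrier_mat n n"
  shows "A ^\<^sub>m Suc k = A * A ^\<^sub>m k"
  using pow_mat_comm[OF assms assms refl, of k] by simp

lemma mat_kernel_pow_subset:
  fixes A :: "'a :: comm_ring_1 Matrix.mat"
  assumes A: "A \<in> carrier_mat n n"
  shows "mat_kernel (A ^\<^sub>m k) \<subseteq> mat_kernel (A ^\<^sub>m Suc k)"
  unfolding pow_mat_Suc_left[OF A] by (rule mat_kernel_mult_subset[of _ n n _ n]) (use A in auto)

text \<open>Jordan normal forms of one matrix agree up to the order of the blocks, so any of them
  computes the size.\<close>

lemma jordan_size_eq:
  assumes "jordan_nf T nas"
  shows "jordan_size T z = Max {k. (k, z) \<in> set nas}"
proof -
  have "{k. \<exists>blocks. jordan_nf T blocks \<and> (k, z) \<in> set blocks} = {k. (k, z) \<in> set nas}"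
    using assms jordan_nf_unique[OF assms] by blast
  then show ?thesis by (simp add: jordan_size_def)
qed

lemma complex_jordan_nf_exists:
  assumes "T \<in> carrier_mat n n"
  shows "\<exists>nas. jordan_nf (T :: complex Matrix.mat) nas"
  using char_poly_factorized[OF assms] jordan_nf_exists[OF assms] by blast

lemma finite_jordan_sizes: "finite {k. (k, z) \<in> set nas}"
  by (rule finite_subset[of _ "fst ` set nas"]) force+

text \<open>If all blocks for \<open>z\<close> had size at most k, the kernels of the powers k and k
  + 1 of \<open>char_matrix T z\<close> would have the same dimension and coincide, but
  \<open>y\<close> lies only in the second.\<close>

lemma jordan_size_ge:
  fixes T :: "complex Matrix.mat"
  assumes T: "T \<in> carrier_mat n n" and y: "y \<in> carrier_vec n"
    and k: "char_matrix T z ^\<^sub>m Suc k *\<^sub>v y = 0\<^sub>v n" "char_matrix T z ^\<^sub>m k *\<^sub>v y \<noteq> 0\<^sub>v n"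
  shows "Suc k \<le> jordan_size T z"
proof -
  let ?E = "char_matrix T z"
  have E: "?E ^\<^sub>m j \<in> carrier_mat n n" for j using T by simp
  obtain nas where nas: "jordan_nf T nas" using complex_jordan_nf_exists[OF T] by blast
  have "\<exists>k'. (k', z) \<in> set nas \<and> Suc k \<le> k'"
  proof (rule ccontr)
    assume "\<not> ?thesis"
    then have small: "k' \<le> k" if "(k', z) \<in> set nas" for k' using that by force
    have "dim_gen_eigenspace T z (Suc k) = dim_gen_eigenspace T z k"
      unfolding dim_gen_eigenspace[OF nas]
      by (intro arg_cong[where f = sum_list] map_cong) (auto dest: small)
    then have "mat_kernel (?E ^\<^sub>m k) = mat_kernel (?E ^\<^sub>m Suc k)"
      unfolding dim_gen_eigenspace_def using T
      by (intro mat_kernel_subset_dim_eq[OF E E] mat_kernel_pow_subset[of _ n]) auto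
    moreover have "y \<in> mat_kernel (?E ^\<^sub>m Suc k)" by (rule mat_kernelI[OF E y k(1)])
    ultimately show False using mat_kernelD[OF E] k(2) by metis
  qed
  then obtain k' where "(k', z) \<in> set nas" "Suc k \<le> k'" by blast
  then show ?thesis unfolding jordan_size_eq[OF nas]
    using Max_ge[OF finite_jordan_sizes, of k' z nas] by simp
qed

text \<open>The maximum in \<open>jordan_size\<close> is informative only for a nonempty set of
  blocks; the factorization of the characteristic polynomial supplies a block of positive
  size.\<close>

lemma eigenvalue_block:
  fixes T :: "complex Matrix.mat"
  assumes T: "T \<in> carrier_mat n n" and nas: "jordan_nf T nas" and ev: "eigenvalue T z"
  shows "\<exists>k. (k, z) \<in> set nas \<and> k > 0"
proof -
  have "char_poly T = (\<Prod>(k, a)\<leftarrow>nas. [:- a, 1:] ^ k)"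
    using jordan_nf_powE[OF T nas] by metis
  moreover have "poly (char_poly T) z = 0" using ev eigenvalue_root_char_poly[OF T] by simp
  ultimately have "0 \<in> set (map (\<lambda>(k, a). (z - a) ^ k) nas)"
    by (simp add: poly_prod_list o_def case_prod_beta prod_list_zero_iff)
  then obtain k a where "(k, a) \<in> set nas" "(z - a) ^ k = 0" by auto
  then have "(k, z) \<in> set nas" "k > 0" by simp_all
  then show ?thesis by blast
qed

lemma jordan_size_pos:
  fixes T :: "complex Matrix.mat"
  assumes T: "T \<in> carrier_mat n n" and ev: "eigenvalue T z"
  shows "jordan_size T z > 0"
proof -
  obtain nas where nas: "jordan_nf T nas" using complex_jordan_nf_exists[OF T] by blast
  obtain k where "(k, z) \<in> set nas" "k > 0" using eigenvalue_block[OF T nas ev] by blast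
  then show ?thesis unfolding jordan_size_eq[OF nas]
    using Max_ge[OF finite_jordan_sizes, of k z nas] by simp
qed

text \<open>A converse to \<open>jordan_size_ge\<close>: a block of size k + 1 makes the kernel of
  the power k + 1 strictly larger than that of the power k, and any vector of the difference will
  do.\<close>

lemma jordan_size_chain:
  fixes T :: "complex Matrix.mat"
  assumes T: "T \<in> carrier_mat n n" and ev: "eigenvalue T z" and k: "jordan_size T z = Suc k"
  shows "\<exists>y \<in> carrier_vec n. char_matrix T z ^\<^sub>m Suc k *\<^sub>v y = 0\<^sub>v n \<and> char_matrix T z ^\<^sub>m k *\<^sub>v y \<noteq> 0\<^sub>v n"
proof (rule ccontr)
  assume no: "\<not> ?thesis"
  let ?E = "char_matrix T z"
  have E: "?E ^\<^sub>m j \<in> carrier_mat n n" for j using T by simp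
  obtain nas where nas: "jordan_nf T nas" using complex_jordan_nf_exists[OF T] by blast
  have "{k. (k, z) \<in> set nas} \<noteq> {}" using eigenvalue_block[OF T nas ev] by blast
  then have "Suc k \<in> {k. (k, z) \<in> set nas}"
    using Max_in[OF finite_jordan_sizes] k unfolding jordan_size_eq[OF nas] by metis
  then have mem: "Suc k \<in> set (map fst [(n, e)\<leftarrow>nas . e = z])" by force
  \<comment> \<open>The kernel of the k-th power has as dimension the sum of min k n over the blocks
    of size n; a block of size k + 1 makes this sum grow strictly from k to k + 1.\<close>
  have "(\<Sum>n\<leftarrow>ns. min k n) < (\<Sum>n\<leftarrow>ns. min (Suc k) n)" if "Suc k \<in> set ns" for ns
    using that
  proof (induction ns)
    case (Cons n ns)
    have "(\<Sum>n\<leftarrow>ns. min k n) \<le> (\<Sum>n\<leftarrow>ns. min (Suc k) n)" by (rule sum_list_mono) auto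
    with Cons show ?case by (cases "Suc k \<in> set ns") auto
  qed simp
  from this[OF mem] have "dim_gen_eigenspace T z k < dim_gen_eigenspace T z (Suc k)"
    unfolding dim_gen_eigenspace[OF nas] .
  moreover have "mat_kernel (?E ^\<^sub>m Suc k) = mat_kernel (?E ^\<^sub>m k)"
  proof
    show "mat_kernel (?E ^\<^sub>m Suc k) \<subseteq> mat_kernel (?E ^\<^sub>m k)"
    proof
      fix y assume "y \<in> mat_kernel (?E ^\<^sub>m Suc k)"
      from mat_kernelD[OF E this] no show "y \<in> mat_kernel (?E ^\<^sub>m k)"
        by (intro mat_kernelI[OF E]) blast+
    qed
  qed (rule mat_kernel_pow_subset[of _ n], use T in auto)
  moreover have "dim_row ?E = n" "dim_col ?E = n" using T by (auto simp: char_matrix_def)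
  ultimately show False unfolding dim_gen_eigenspace_def kernel_dim_def
    by (cases "k = 0") (simp_all del: pow_mat.simps)
qed

text \<open>The sum of T^(h-1-i) z^i over i < h, written as a Horner scheme, so that its properties
  are inductions with a single product by \<open>T\<close>.\<close>

primrec geometric_mat :: "complex Matrix.mat \<Rightarrow> complex \<Rightarrow> nat \<Rightarrow> complex Matrix.mat" where
  "geometric_mat T z 0 = 0\<^sub>m (dim_row T) (dim_row T)"
| "geometric_mat T z (Suc h) = T * geometric_mat T z h + z ^ h \<cdot>\<^sub>m 1\<^sub>m (dim_row T)"

lemma geometric_mat_carrier:
  "T \<in> carrier_mat n n \<Longrightarrow> geometric_mat T z h \<in> carrier_mat n n"
  by (induction h) auto

lemma char_matrix_comm:
  assumes T: "T \<in> carrier_mat n n"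
  shows "char_matrix T z * T = T * (char_matrix T z :: complex Matrix.mat)"
proof -
  have "char_matrix T z * T = T * T + (- z) \<cdot>\<^sub>m T" unfolding char_matrix_def using T
    by (subst add_mult_distrib_mat[of _ n n _ _ n]) auto
  moreover have "T * char_matrix T z = T * T + (- z) \<cdot>\<^sub>m T" unfolding char_matrix_def using T
    by (subst mult_add_distrib_mat[of _ n n _ n]) (auto simp: mult_smult_distrib)
  ultimately show ?thesis by simp
qed

lemma char_matrix_geometric_Suc:
  assumes T: "T \<in> carrier_mat n n"
  shows "char_matrix T z * geometric_mat T z (Suc h)
    = T * (char_matrix T z * geometric_mat T z h) + z ^ h \<cdot>\<^sub>m char_matrix T z"
proof -
  note U = geometric_mat_carrier[OF T, of z h]
  have D: "char_matrix T z \<in> carrier_mat n n" using T by simp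
  have "char_matrix T z * geometric_mat T z (Suc h)
      = char_matrix T z * (T * geometric_mat T z h) + char_matrix T z * (z ^ h \<cdot>\<^sub>m 1\<^sub>m n)"
    using T U D by (simp add: mult_add_distrib_mat[of _ n n _ n])
  also have "char_matrix T z * (T * geometric_mat T z h) = T * (char_matrix T z * geometric_mat T z h)"
    using assoc_mult_mat[OF D T U] assoc_mult_mat[OF T D U] by (simp only: char_matrix_comm[OF T])
  also have "char_matrix T z * (z ^ h \<cdot>\<^sub>m 1\<^sub>m n) = z ^ h \<cdot>\<^sub>m char_matrix T z"
    using D by (subst mult_smult_distrib[OF D one_carrier_mat]) simp
  finally show ?thesis .
qed

lemma char_matrix_geometric_comm:
  assumes T: "T \<in> carrier_mat n n"
  shows "char_matrix T z * geometric_mat T z h = geometric_mat T z h * char_matrix T z"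
proof (induction h)
  case 0
  have D: "char_matrix T z \<in> carrier_mat n n" using T by simp
  show ?case using T by (simp add: right_mult_zero_mat[OF D] left_mult_zero_mat[OF D])
next
  case (Suc h)
  note U = geometric_mat_carrier[OF T, of z h]
  have D: "char_matrix T z \<in> carrier_mat n n" using T by simp
  have "geometric_mat T z (Suc h) * char_matrix T z
      = T * geometric_mat T z h * char_matrix T z + (z ^ h \<cdot>\<^sub>m 1\<^sub>m n) * char_matrix T z"
    using T U D by (simp add: add_mult_distrib_mat[of _ n n _ _ n])
  also have "\<dots> = T * (geometric_mat T z h * char_matrix T z) + z ^ h \<cdot>\<^sub>m char_matrix T z"
    using T U D by (simp add: assoc_mult_mat[of _ n n _ n _ n] mult_smult_assoc_mat[of _ n n _ n] left_mult_one_mat[OF D])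
  finally show ?case unfolding char_matrix_geometric_Suc[OF T] Suc by simp
qed

lemma char_matrix_geometric:
  assumes T: "T \<in> carrier_mat n n"
  shows "char_matrix T z * geometric_mat T z h = T ^\<^sub>m h + (- (z ^ h)) \<cdot>\<^sub>m 1\<^sub>m n"
proof (induction h)
  case 0
  have "char_matrix T z \<in> carrier_mat n n" using T by simp
  then have "char_matrix T z * 0\<^sub>m n n = 0\<^sub>m n n" by simp
  then show ?case using T by (intro eq_matI) auto
next
  case (Suc h)
  have P: "T ^\<^sub>m h \<in> carrier_mat n n" using T by simp
  have e: "T * (T ^\<^sub>m h + (- (z ^ h)) \<cdot>\<^sub>m 1\<^sub>m n) = T * T ^\<^sub>m h + (- (z ^ h)) \<cdot>\<^sub>m T"
    using T P by (subst mult_add_distrib_mat[of _ n n _ n]) (auto simp: mult_smult_distrib[OF T])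
  show ?case unfolding char_matrix_geometric_Suc[OF T] Suc pow_mat_Suc_left[OF T] e
    using T P by (intro eq_matI) (auto simp: char_matrix_def algebra_simps)
qed

text \<open>
  \<open>geometric_mat T z h\<close> is the cofactor of \<open>T - z\<close> in \<open>T\<^sup>h - z\<^sup>h\<close>; applying its powers turns a
  Jordan chain of \<open>S\<close> for \<open>z\<^sup>h\<close> into a Jordan chain of \<open>T\<close> for \<open>z\<close>.
\<close>

lemma jordan_size_root:
  fixes S T :: "complex Matrix.mat" and e :: "complex Matrix.vec \<Rightarrow> complex Matrix.vec"
  assumes T: "T \<in> carrier_mat n n" and S: "S \<in> carrier_mat m m"
    and e: "\<And>x. x \<in> carrier_vec m \<Longrightarrow> e x \<in> carrier_vec n" "e (0\<^sub>v m) = 0\<^sub>v n"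
      "\<And>x y a. x \<in> carrier_vec m \<Longrightarrow> y \<in> carrier_vec m \<Longrightarrow> e (x + a \<cdot>\<^sub>v y) = e x + a \<cdot>\<^sub>v e y"
    and Te: "\<And>x. x \<in> carrier_vec m \<Longrightarrow> T ^\<^sub>m h *\<^sub>v e x = e (S *\<^sub>v x)"
    and nz: "\<And>x. x \<in> carrier_vec m \<Longrightarrow> x \<noteq> 0\<^sub>v m \<Longrightarrow> geometric_mat T z h *\<^sub>v e x \<noteq> 0\<^sub>v n"
    and ev: "eigenvalue S (z ^ h)"
  shows "jordan_size S (z ^ h) \<le> jordan_size T z" "eigenvalue T z"
proof -
  define C where "C = char_matrix S (z ^ h)"
  define D where "D = char_matrix T z"
  define U where "U = geometric_mat T z h"
  have C: "C \<in> carrier_mat m m" and D: "D \<in> carrier_mat n n" and U: "U \<in> carrier_mat n n"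
    using S T geometric_mat_carrier[OF T] by (auto simp: C_def D_def U_def)
  have DU: "D * U = U * D" unfolding D_def U_def by (rule char_matrix_geometric_comm[OF T])
  \<comment> \<open>On the image of \<open>e\<close> the product (T - z) U = T^h - z^h acts as S -
    z^h, that is, as \<open>C\<close>.\<close>
  have DUe: "D * U *\<^sub>v e x = e (C *\<^sub>v x)" if x: "x \<in> carrier_vec m" for x
  proof -
    have P: "T ^\<^sub>m h \<in> carrier_mat n n" using T by simp
    have "D * U *\<^sub>v e x = T ^\<^sub>m h *\<^sub>v e x + ((- (z ^ h)) \<cdot>\<^sub>m 1\<^sub>m n) *\<^sub>v e x"
      unfolding D_def U_def char_matrix_geometric[OF T] using e(1)[OF x] P
      by (simp add: add_mult_distrib_mat_vec[of _ n n])
    also have "((- (z ^ h)) \<cdot>\<^sub>m 1\<^sub>m n) *\<^sub>v e x = (- (z ^ h)) \<cdot>\<^sub>v e x"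
      using e(1)[OF x] by (intro eq_vecI) auto
    also have "T ^\<^sub>m h *\<^sub>v e x + \<dots> = e (S *\<^sub>v x + (- (z ^ h)) \<cdot>\<^sub>v x)"
      using x S by (simp add: Te e(3))
    also have "S *\<^sub>v x + (- (z ^ h)) \<cdot>\<^sub>v x = C *\<^sub>v x"
    proof -
      have "((- (z ^ h)) \<cdot>\<^sub>m 1\<^sub>m m) *\<^sub>v x = (- (z ^ h)) \<cdot>\<^sub>v x"
        using x by (intro eq_vecI) auto
      then show ?thesis unfolding C_def char_matrix_def using S x
        by (simp add: add_mult_distrib_mat_vec[of _ m m])
    qed
    finally show ?thesis .
  qed
  obtain k where k: "jordan_size S (z ^ h) = Suc k"
    using jordan_size_pos[OF S ev] gr0_implies_Suc by blast
  obtain v where v: "v \<in> carrier_vec m" "C ^\<^sub>m Suc k *\<^sub>v v = 0\<^sub>v m" "C ^\<^sub>m k *\<^sub>v v \<noteq> 0\<^sub>v m"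
    using jordan_size_chain[OF S ev k] by (auto simp: C_def simp del: pow_mat.simps)
  \<comment> \<open>One factor \<open>U\<close> is provided for every later application of
    \<open>D\<close>: since the two commute, each \<open>D\<close> uses up one \<open>U\<close> and
    becomes a \<open>C\<close> inside \<open>e\<close>.\<close>
  define y where "y = U ^\<^sub>m Suc k *\<^sub>v e v"
  have Cv: "C ^\<^sub>m s *\<^sub>v v \<in> carrier_vec m" for s
    by (rule mult_mat_vec_carrier[OF pow_carrier_mat[OF C] v(1)])
  have chain: "D ^\<^sub>m s *\<^sub>v y = U ^\<^sub>m (Suc k - s) *\<^sub>v e (C ^\<^sub>m s *\<^sub>v v)" if "s \<le> Suc k" for s
    using that
  proof (induction s)
    case 0
    have "y \<in> carrier_vec n" unfolding y_def
      by (rule mult_mat_vec_carrier[OF pow_carrier_mat[OF U] e(1)[OF v(1)]])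
    then show ?case using C D v(1) by (simp add: y_def del: pow_mat.simps(2))
  next
    case (Suc s)
    let ?w = "e (C ^\<^sub>m s *\<^sub>v v)" and ?j = "Suc k - Suc s"
    have w: "?w \<in> carrier_vec n" using e(1)[OF Cv] .
    have y: "y \<in> carrier_vec n" unfolding y_def
      by (rule mult_mat_vec_carrier[OF pow_carrier_mat[OF U] e(1)[OF v(1)]])
    have Uj: "U ^\<^sub>m ?j \<in> carrier_mat n n" and Ds: "D ^\<^sub>m s \<in> carrier_mat n n" using U D by simp_all
    have j: "Suc k - s = Suc ?j" using Suc.prems by simp
    have "D ^\<^sub>m Suc s *\<^sub>v y = D *\<^sub>v (D ^\<^sub>m s *\<^sub>v y)"
      unfolding pow_mat_Suc_left[OF D] by (rule assoc_mult_mat_vec[OF D Ds y])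
    also have "\<dots> = D *\<^sub>v (U ^\<^sub>m Suc ?j *\<^sub>v ?w)" using Suc j by simp
    also have "\<dots> = (D * U ^\<^sub>m Suc ?j) *\<^sub>v ?w"
      by (rule assoc_mult_mat_vec[OF D pow_carrier_mat[OF U] w, symmetric])
    also have "D * U ^\<^sub>m Suc ?j = D * U ^\<^sub>m ?j * U" using D U Uj by (simp add: assoc_mult_mat[of _ n n _ n _ n])
    also have "\<dots> = U ^\<^sub>m ?j * (D * U)" unfolding pow_mat_comm[OF D U DU]
      using D U Uj by (simp add: assoc_mult_mat[of _ n n _ n _ n])
    also have "\<dots> *\<^sub>v ?w = U ^\<^sub>m ?j *\<^sub>v (D * U *\<^sub>v ?w)"
      by (rule assoc_mult_mat_vec[OF Uj mult_carrier_mat[OF D U] w])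
    also have "D * U *\<^sub>v ?w = e (C *\<^sub>v (C ^\<^sub>m s *\<^sub>v v))" by (rule DUe[OF Cv])
    also have "C *\<^sub>v (C ^\<^sub>m s *\<^sub>v v) = C ^\<^sub>m Suc s *\<^sub>v v"
      unfolding pow_mat_Suc_left[OF C] by (rule assoc_mult_mat_vec[OF C pow_carrier_mat[OF C] v(1), symmetric])
    finally show ?case .
  qed
  have y: "y \<in> carrier_vec n" unfolding y_def
      by (rule mult_mat_vec_carrier[OF pow_carrier_mat[OF U] e(1)[OF v(1)]])
  have 0: "D ^\<^sub>m Suc k *\<^sub>v y = 0\<^sub>v n"
    using chain[of "Suc k"] U by (simp add: v(2) e(2) del: pow_mat.simps(2))
  have "U ^\<^sub>m 1 = U" using U by simp
  \<comment> \<open>After k applications one factor \<open>U\<close> is left, acting on the nonzero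
    end of the chain of \<open>S\<close>; \<open>nz\<close> is exactly what keeps the result from
    vanishing.\<close>
  then have 1: "D ^\<^sub>m k *\<^sub>v y \<noteq> 0\<^sub>v n"
    using chain[of k] nz[OF Cv v(3)] by (simp add: U_def Suc_diff_le del: pow_mat.simps)
  show "jordan_size S (z ^ h) \<le> jordan_size T z"
    unfolding k by (rule jordan_size_ge[OF T y]) (use 0 1 in \<open>simp_all add: D_def del: pow_mat.simps\<close>)
  have "D *\<^sub>v (D ^\<^sub>m k *\<^sub>v y) = 0\<^sub>v n"
    using 0 unfolding pow_mat_Suc_left[OF D] assoc_mult_mat_vec[OF D pow_carrier_mat[OF D] y] .
  then show "eigenvalue T z"
    unfolding eigenvalue_char_matrix[OF T] using 1 D y
    by (intro exI[of _ "D ^\<^sub>m k *\<^sub>v y"] conjI mult_mat_vec_carrier[OF pow_carrier_mat[OF D] y]) (auto simp: D_def)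
qed

section \<open>Scalar q-series\<close>

text \<open>The scalar form of \<open>q_series\<close>. Finiteness of the principal part is
  expressed by a filter, which makes closure under sums and multiples immediate.\<close>

definition qs :: "real \<Rightarrow> (int \<Rightarrow> complex) \<Rightarrow> bool" where
  "qs h f \<longleftrightarrow> eventually (\<lambda>n. f n = 0) at_bot \<and>
     (\<forall>\<tau>\<in>upper_half_plane. (\<lambda>n. f n * q_pow h (of_int n) \<tau>) summable_on UNIV)"

definition qsum :: "real \<Rightarrow> (int \<Rightarrow> complex) \<Rightarrow> complex \<Rightarrow> complex" where
  "qsum h f \<tau> = (\<Sum>\<^sub>\<infinity>n. f n * q_pow h (of_int n) \<tau>)"

lemma q_pow_add: "q_pow h (x + y) \<tau> = q_pow h x \<tau> * q_pow h y \<tau>"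
  by (simp add: q_pow_def exp_add[symmetric] add_divide_distrib algebra_simps)

lemma q_pow_translate: "q_pow h x (\<tau> + \<sigma>) = q_pow h x \<tau> * q_pow h x \<sigma>"
  by (simp add: q_pow_def exp_add[symmetric] add_divide_distrib algebra_simps)

lemma q_pow_scale: "q_pow h x (\<tau> / of_real s) = q_pow (h * s) x \<tau>"
  by (simp add: q_pow_def mult.commute)

lemma q_pow_width_mult: "k \<noteq> 0 \<Longrightarrow> q_pow (h * k) x \<tau> = q_pow h (x / k) \<tau>"
  by (simp add: q_pow_def field_simps)

lemma upper_half_plane_affine:
  "\<tau> \<in> upper_half_plane \<Longrightarrow> s > 0 \<Longrightarrow> \<tau> / of_real s + of_real \<beta> \<in> upper_half_plane"
  by (simp add: upper_half_plane_def)

lemma qs_summable: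
  "qs h f \<Longrightarrow> \<tau> \<in> upper_half_plane \<Longrightarrow> (\<lambda>n. f n * q_pow h (of_int n) \<tau>) summable_on UNIV"
  unfolding qs_def by blast

lemma qs_zero [simp]: "qs h (\<lambda>n. 0)"
  by (simp add: qs_def)

lemma qsum_zero [simp]: "qsum h (\<lambda>n. 0) \<tau> = 0"
  by (simp add: qsum_def)

lemma qs_cmult: "qs h f \<Longrightarrow> qs h (\<lambda>n. k * f n)"
  unfolding qs_def by (auto elim: eventually_mono simp: mult.assoc intro: summable_on_cmult_right)

lemma qsum_cmult: "qsum h (\<lambda>n. k * f n) \<tau> = k * qsum h f \<tau>"
  by (simp add: qsum_def mult.assoc infsum_cmult_right')

lemma qs_add: "qs h f \<Longrightarrow> qs h g \<Longrightarrow> qs h (\<lambda>n. f n + g n)"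
  unfolding qs_def by (auto elim: eventually_elim2 simp: distrib_right intro: summable_on_add)

lemma qsum_add:
  assumes "qs h f" "qs h g" "\<tau> \<in> upper_half_plane"
  shows "qsum h (\<lambda>n. f n + g n) \<tau> = qsum h f \<tau> + qsum h g \<tau>"
  using assms by (simp add: qsum_def distrib_right qs_def infsum_add)

lemma qs_sum: "(\<And>i. i \<in> I \<Longrightarrow> qs h (f i)) \<Longrightarrow> qs h (\<lambda>n. \<Sum>i\<in>I. f i n)"
  by (induction I rule: infinite_finite_induct) (auto intro: qs_add)

lemma qsum_sum:
  assumes "\<And>i. i \<in> I \<Longrightarrow> qs h (f i)" "\<tau> \<in> upper_half_plane"
  shows "qsum h (\<lambda>n. \<Sum>i\<in>I. f i n) \<tau> = (\<Sum>i\<in>I. qsum h (f i) \<tau>)"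
  using assms
proof (induction I rule: infinite_finite_induct)
  case (insert i I)
  then show ?case using qs_sum[of I h f] by (simp add: qsum_add)
qed auto

lemma q_pow_affine:
  "q_pow h x (\<tau> / of_real s + of_real \<beta>) = q_pow (h * s) x \<tau> * q_pow h x (of_real \<beta>)"
  by (simp add: q_pow_translate q_pow_scale)

text \<open>The substitution arises from changing the matrix that moves a cusp to infinity. It
  multiplies the width by \<open>s\<close>, and the coefficients absorb the translation.\<close>

lemma qs_affine:
  assumes f: "qs h f" and s: "s > 0"
  shows "qs (h * s) (\<lambda>n. f n * q_pow h (of_int n) (of_real \<beta>))"
  unfolding qs_def
proof (intro conjI ballI)
  show "\<forall>\<^sub>F n in at_bot. f n * q_pow h (of_int n) (of_real \<beta>) = 0"
    using f unfolding qs_def by (auto elim: eventually_mono)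
  fix \<tau> assume "\<tau> \<in> upper_half_plane"
  from upper_half_plane_affine[OF this s, of \<beta>]
  have "(\<lambda>n. f n * q_pow h (of_int n) (\<tau> / of_real s + of_real \<beta>)) summable_on UNIV"
    using f unfolding qs_def by blast
  then show "(\<lambda>n. f n * q_pow h (of_int n) (of_real \<beta>) * q_pow (h * s) (of_int n) \<tau>) summable_on UNIV"
    unfolding q_pow_affine by (simp add: mult_ac)
qed

lemma qsum_affine:
  "qsum (h * s) (\<lambda>n. f n * q_pow h (of_int n) (of_real \<beta>)) \<tau> = qsum h f (\<tau> / of_real s + of_real \<beta>)"
  unfolding qsum_def q_pow_affine by (simp add: mult_ac)

lemma qs_section:
  assumes f: "qs (h * of_nat k) f" and k: "k > 0"
  shows "qs h (\<lambda>n. f (int k * n + r))"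
  unfolding qs_def
proof (intro conjI ballI)
  obtain N where N: "\<And>n. n < N \<Longrightarrow> f n = 0" using f unfolding qs_def eventually_at_bot_dense by blast
  \<comment> \<open>For negative n one has k n \<le> n, so n < N - r already puts the index below
    \<open>N\<close>; hence the minimum with 0.\<close>
  have z: "f (int k * n + r) = 0" if "n < min 0 (N - r)" for n
  proof -
    have "int k * n \<le> 1 * n" using that k by (intro mult_right_mono_neg) auto
    then show ?thesis using that by (intro N) linarith
  qed
  show "\<forall>\<^sub>F n in at_bot. f (int k * n + r) = 0" unfolding eventually_at_bot_dense
    by (intro exI[of _ "min 0 (N - r)"] allI impI) (rule z)
  fix \<tau> assume \<tau>: "\<tau> \<in> upper_half_plane"
  have "(\<lambda>n. f n * q_pow (h * of_nat k) (of_int n) \<tau>) summable_on range (\<lambda>n. int k * n + r)"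
    by (rule summable_on_subset_banach[OF qs_summable[OF f \<tau>]]) simp
  then have "(\<lambda>n. f (int k * n + r) * q_pow (h * of_nat k) (of_int (int k * n + r)) \<tau>) summable_on UNIV"
    using k by (subst (asm) summable_on_reindex) (auto simp: o_def inj_on_def)
  \<comment> \<open>A constant power of q brings the exponent n + r/k back to n.\<close>
  then have "(\<lambda>n. q_pow h (- (of_int r / of_nat k)) \<tau> *
      (f (int k * n + r) * q_pow (h * of_nat k) (of_int (int k * n + r)) \<tau>)) summable_on UNIV"
    by (rule summable_on_cmult_right)
  moreover have "q_pow h (- (of_int r / of_nat k)) \<tau> *
      (f (int k * n + r) * q_pow (h * of_nat k) (of_int (int k * n + r)) \<tau>)
      = f (int k * n + r) * q_pow h (of_int n) \<tau>" for n
  proof -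
    have "q_pow (h * of_nat k) (of_int (int k * n + r)) \<tau> = q_pow h (of_int n + of_int r / of_nat k) \<tau>"
      using k by (simp add: q_pow_width_mult add_divide_distrib)
    moreover have "q_pow h (- (of_int r / of_nat k)) \<tau> * q_pow h (of_int n + of_int r / of_nat k) \<tau>
        = q_pow h (of_int n) \<tau>"
      by (simp add: q_pow_add[symmetric])
    ultimately show ?thesis by (simp add: mult.left_commute)
  qed
  ultimately show "(\<lambda>n. f (int k * n + r) * q_pow h (of_int n) \<tau>) summable_on UNIV" by (simp only:)
qed

text \<open>The integers are split into residue classes modulo k; the index k n + r for the width h
  k contributes the exponent n + r/k for the width h.\<close>

lemma qsum_sections:
  assumes f: "qs (h * of_nat k) f" and k: "k > 0" and \<tau>: "\<tau> \<in> upper_half_plane"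
  shows "qsum (h * of_nat k) f \<tau> = (\<Sum>r<k. q_pow h (of_nat r / of_nat k) \<tau> * qsum h (\<lambda>n. f (int k * n + int r)) \<tau>)"
proof -
  let ?g = "\<lambda>n. f n * q_pow (h * of_nat k) (of_int n) \<tau>"
  define B where "B r = range (\<lambda>n. int k * n + int r)" for r
  have U: "(\<Union>r\<in>{..<k}. B r) = UNIV"
  proof -
    have "n \<in> (\<Union>r\<in>{..<k}. B r)" for n
    proof
      show "nat (n mod int k) \<in> {..<k}" using k by (simp add: nat_less_iff)
      show "n \<in> B (nat (n mod int k))" unfolding B_def using k
        by (intro range_eqI[of _ _ "n div int k"]) simp
    qed
    then show ?thesis by blast
  qed
  have disj: "B r \<inter> B r' = {}" if "r < k" "r' < k" "r \<noteq> r'" for r r'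
  proof -
    have md: "x mod int k = int r" if "x \<in> B r" "r < k" for x r
      using that by (auto simp: B_def)
    show ?thesis
    proof (rule equals0I)
      fix x assume "x \<in> B r \<inter> B r'"
      then have "int r = int r'" using md[of x r] md[of x r'] that(1,2) by simp
      then show False using that(3) by simp
    qed
  qed
  have s: "?g summable_on B r" for r
    by (rule summable_on_subset_banach[OF qs_summable[OF f \<tau>]]) simp
  have "qsum (h * of_nat k) f \<tau> = (\<Sum>r<k. infsum ?g (B r))"
    unfolding qsum_def by (subst sum_infsum) (auto simp: U s dest: disj)
  also have "\<dots> = (\<Sum>r<k. q_pow h (of_nat r / of_nat k) \<tau> * qsum h (\<lambda>n. f (int k * n + int r)) \<tau>)"
  proof (rule sum.cong)
    fix r
    have "infsum ?g (B r) = (\<Sum>\<^sub>\<infinity>n. ?g (int k * n + int r))"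
      unfolding B_def using k by (subst infsum_reindex) (auto simp: o_def inj_on_def)
    also have "\<dots> = (\<Sum>\<^sub>\<infinity>n. q_pow h (of_nat r / of_nat k) \<tau> * (f (int k * n + int r) * q_pow h (of_int n) \<tau>))"
    proof (rule infsum_cong)
      fix n
      have "q_pow (h * of_nat k) (of_int (int k * n + int r)) \<tau> = q_pow h (of_nat r / of_nat k + of_int n) \<tau>"
        using k by (simp add: q_pow_width_mult add_divide_distrib add.commute)
      then show "?g (int k * n + int r) = q_pow h (of_nat r / of_nat k) \<tau> * (f (int k * n + int r) * q_pow h (of_int n) \<tau>)"
        by (simp add: q_pow_add)
    qed
    finally show "infsum ?g (B r) = q_pow h (of_nat r / of_nat k) \<tau> * qsum h (\<lambda>n. f (int k * n + int r)) \<tau>"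
      by (simp add: infsum_cmult_right' qsum_def)
  qed simp
  finally show ?thesis .
qed

text \<open>With finitely many components, a common lower bound for the supports exists as soon as
  each component has one.\<close>

lemma q_series_iff:
  "q_series m h a \<longleftrightarrow> (\<forall>n. a n \<in> carrier_vec m) \<and> (\<forall>l<m. qs h (\<lambda>n. a n $ l))"
proof -
  have "(\<exists>M. \<forall>n < - M. a n = 0\<^sub>v m) \<longleftrightarrow> (\<forall>l<m. eventually (\<lambda>n. a n $ l = 0) at_bot)"
    if c: "\<forall>n. a n \<in> carrier_vec m"
  proof -
    have "(\<exists>M. \<forall>n < - M. a n = 0\<^sub>v m) \<longleftrightarrow> eventually (\<lambda>n. a n = 0\<^sub>v m) at_bot"
      unfolding eventually_at_bot_dense by (metis minus_minus)
    also have "\<dots> \<longleftrightarrow> eventually (\<lambda>n. \<forall>l\<in>{..<m}. a n $ l = 0) at_bot"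
      by (intro arg_cong[of _ _ "\<lambda>P. eventually P at_bot"] ext) (use c in \<open>auto intro!: eq_vecI\<close>)
    also have "\<dots> \<longleftrightarrow> (\<forall>l\<in>{..<m}. eventually (\<lambda>n. a n $ l = 0) at_bot)"
      by (simp add: eventually_ball_finite_distrib)
    finally show ?thesis by auto
  qed
  then show ?thesis unfolding q_series_def qs_def by auto
qed

lemma q_sum_index: "l < m \<Longrightarrow> q_sum m h a \<tau> $ l = qsum h (\<lambda>n. a n $ l) \<tau>"
  by (simp add: q_sum_def qsum_def)

section \<open>Expansions for a diagonalizable generator\<close>

lemma mat_diag_mult_vec:
  "v \<in> carrier_vec m \<Longrightarrow> mat_diag m f *\<^sub>v v = Matrix.vec m (\<lambda>l. f l * v $ l :: complex)"
  by (intro eq_vecI) (auto simp: mat_diag_def scalar_prod_def if_distrib[of "\<lambda>x. x * _"] cong: if_cong)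

lemma mult_mat_vec_index:
  "A \<in> carrier_mat m' m \<Longrightarrow> v \<in> carrier_vec m \<Longrightarrow> l < m' \<Longrightarrow>
    (A *\<^sub>v v) $ l = (\<Sum>k<m. A $$ (l, k) * v $ k)"
  by (auto simp: scalar_prod_def atLeast0LessThan intro!: sum.cong)

lemma mult_mat_index:
  "A \<in> carrier_mat m' m \<Longrightarrow> B \<in> carrier_mat m n \<Longrightarrow> i < m' \<Longrightarrow> j < n \<Longrightarrow>
    (A * B) $$ (i, j) = (\<Sum>k<m. A $$ (i, k) * B $$ (k, j))"
  by (auto simp: scalar_prod_def atLeast0LessThan intro!: sum.cong)

text \<open>Only the width and the matrix of the generator enter an expansion; freed from the group,
  it can be moved between cusps and conjugates.\<close>

definition adm_exp :: "nat \<Rightarrow> real \<Rightarrow> complex Matrix.mat \<Rightarrow> (complex \<Rightarrow> complex Matrix.vec) \<Rightarrow>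
    (int \<Rightarrow> complex Matrix.vec) \<Rightarrow> bool" where
  "adm_exp m h T X a \<longleftrightarrow> q_series m h a \<and>
      (\<exists>P P' ev. similar_mat_wit T (mat_diag m ev) P P' \<and>
         (\<forall>\<tau>\<in>upper_half_plane.
            X \<tau> = P *\<^sub>v (mat_diag m (\<lambda>l. q_pow h (mu (ev l)) \<tau>) *\<^sub>v (P' *\<^sub>v q_sum m h a \<tau>))))"

lemma admissible_expansion_iff:
  "admissible_expansion m \<Gamma> \<rho> X a \<longleftrightarrow> adm_exp m (cusp_width \<Gamma> Infty) (\<rho> (cusp_generator \<Gamma> Infty)) X a"
  by (simp add: admissible_expansion_def adm_exp_def Let_def)

text \<open>The expansion in the coordinates of a fixed eigenbasis \<open>P\<close>: each coordinate
  is one scalar series times a fractional power of q.\<close>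

definition coord_exp :: "nat \<Rightarrow> real \<Rightarrow> (nat \<Rightarrow> complex) \<Rightarrow> complex Matrix.mat \<Rightarrow>
    (complex \<Rightarrow> complex Matrix.vec) \<Rightarrow> (int \<Rightarrow> nat \<Rightarrow> complex) \<Rightarrow> bool" where
  "coord_exp m h ev P X c \<longleftrightarrow> (\<forall>s<m. qs h (\<lambda>n. c n s)) \<and>
     (\<forall>\<tau>\<in>upper_half_plane. X \<tau> = P *\<^sub>v Matrix.vec m (\<lambda>s. q_pow h (mu (ev s)) \<tau> * qsum h (\<lambda>n. c n s) \<tau>))"

lemma similar_diag_wit:
  fixes T :: "complex Matrix.mat"
  assumes "similar_mat_wit T (mat_diag m ev) P P'"
  shows "T \<in> carrier_mat m m" "P \<in> carrier_mat m m" "P' \<in> carrier_mat m m"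
    "P * P' = 1\<^sub>m m" "P' * P = 1\<^sub>m m" "T = P * mat_diag m ev * P'"
proof -
  have "mat_diag m ev \<in> carrier_mat (dim_row T) (dim_row T)"
    by (rule similar_mat_witD(5)[OF refl assms])
  from carrier_matD(1)[OF this] carrier_matD(1)[OF mat_diag_dim[of m ev]]
  have "m = dim_row T" by (rule trans[OF sym, rotated])
  from similar_mat_witD[OF this assms] show "T \<in> carrier_mat m m" "P \<in> carrier_mat m m" "P' \<in> carrier_mat m m"
    "P * P' = 1\<^sub>m m" "P' * P = 1\<^sub>m m" "T = P * mat_diag m ev * P'"
    by blast+
qed

text \<open>The change of basis \<open>U\<close> between the two eigenbases connects only equal
  eigenvalues, so it intertwines every function of the two diagonals. This frees the fractional
  power of q in an expansion from the eigenbasis used to write it.\<close>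

lemma diag_function_unique:
  fixes T :: "complex Matrix.mat" and f :: "complex \<Rightarrow> complex"
  assumes 1: "similar_mat_wit T (mat_diag m e1) P1 Q1" and 2: "similar_mat_wit T (mat_diag m e2) P2 Q2"
  shows "P1 * mat_diag m (\<lambda>i. f (e1 i)) * Q1 = P2 * mat_diag m (\<lambda>i. f (e2 i)) * Q2"
proof -
  note w1 = similar_diag_wit[OF 1] and w2 = similar_diag_wit[OF 2]
  note am = assoc_mult_mat[of _ m m _ m _ m]
  define U where "U = Q2 * P1"
  have U: "U \<in> carrier_mat m m" using w1 w2 by (auto simp: U_def)
  have D: "mat_diag m g \<in> carrier_mat m m" for g :: "nat \<Rightarrow> complex" by simp
  have c [simp]: "A * B \<in> carrier_mat m m" if "A \<in> carrier_mat m m" "B \<in> carrier_mat m m"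
    for A B :: "complex Matrix.mat" using that by simp
  have "U * mat_diag m e1 = Q2 * (P1 * mat_diag m e1 * (Q1 * P1))"
  proof -
    have "P1 * mat_diag m e1 * 1\<^sub>m m = P1 * mat_diag m e1"
      by (rule right_mult_one_mat[OF c[OF w1(2) D]])
    then show ?thesis unfolding w1(5) U_def using w1(2) w2(3) D by (simp only: am c)
  qed
  also have "\<dots> = Q2 * (T * P1)" using w1(2,3) w2(2,3) D w1(6) by (simp add: am)
  also have "T * P1 = P2 * mat_diag m e2 * (Q2 * P1)"
    using w1(2,3) w2(2,3) D by (subst w2(6)) (simp add: am)
  also have "Q2 * \<dots> = (Q2 * P2) * (mat_diag m e2 * U)"
    using w1(2,3) w2(2,3) D by (simp add: am U_def)
  also have "\<dots> = mat_diag m e2 * U" unfolding w2(5) by (rule left_mult_one_mat[OF c[OF D U]])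
  finally have UD: "U * mat_diag m e1 = mat_diag m e2 * U" .
  have comm: "U * mat_diag m (\<lambda>i. f (e1 i)) = mat_diag m (\<lambda>i. f (e2 i)) * U"
  proof (rule eq_matI)
    fix i j assume "i < dim_row (mat_diag m (\<lambda>i. f (e2 i)) * U)" "j < dim_col (mat_diag m (\<lambda>i. f (e2 i)) * U)"
    then have ij: "i < m" "j < m" using U by (auto simp: mat_diag_def)
    have "(U * mat_diag m e1) $$ (i, j) = (mat_diag m e2 * U) $$ (i, j)" by (simp only: UD)
    then have "U $$ (i, j) * e1 j = e2 i * U $$ (i, j)"
      using ij by (simp add: mat_diag_mult_left[OF U] mat_diag_mult_right[OF U])
    then have "U $$ (i, j) = 0 \<or> e1 j = e2 i" by simp
    then show "(U * mat_diag m (\<lambda>i. f (e1 i))) $$ (i, j) = (mat_diag m (\<lambda>i. f (e2 i)) * U) $$ (i, j)"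
      using ij by (auto simp: mat_diag_mult_left[OF U] mat_diag_mult_right[OF U])
  qed (use U in \<open>auto simp: mat_diag_def\<close>)
  have "P1 * mat_diag m (\<lambda>i. f (e1 i)) * Q1 = (P2 * Q2) * (P1 * mat_diag m (\<lambda>i. f (e1 i)) * Q1)"
    unfolding w2(4) by (rule left_mult_one_mat[OF c[OF c[OF w1(2) D] w1(3)], symmetric])
  also have "\<dots> = P2 * (U * mat_diag m (\<lambda>i. f (e1 i))) * Q1"
    using w1(2,3) w2(2,3) D by (simp add: am U_def)
  also have "\<dots> = P2 * mat_diag m (\<lambda>i. f (e2 i)) * Q2 * (P1 * Q1)"
    unfolding comm using w1(2,3) w2(2,3) D by (simp add: am U_def)
  also have "\<dots> = P2 * mat_diag m (\<lambda>i. f (e2 i)) * Q2"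
    unfolding w1(4) by (rule right_mult_one_mat[OF c[OF c[OF w2(2) D] w2(3)]])
  finally show ?thesis .
qed

lemma q_sum_mult_mat:
  assumes A: "A \<in> carrier_mat m' m" and a: "q_series m h a"
  shows "l < m' \<Longrightarrow> qs h (\<lambda>n. (A *\<^sub>v a n) $ l)"
    and "\<tau> \<in> upper_half_plane \<Longrightarrow> A *\<^sub>v q_sum m h a \<tau> = Matrix.vec m' (\<lambda>l. qsum h (\<lambda>n. (A *\<^sub>v a n) $ l) \<tau>)"
proof -
  have ac: "a n \<in> carrier_vec m" for n using a by (simp add: q_series_iff)
  have q: "qs h (\<lambda>n. A $$ (l, k) * a n $ k)" if "k < m" for l k
    using a that by (intro qs_cmult) (simp add: q_series_iff)
  show "qs h (\<lambda>n. (A *\<^sub>v a n) $ l)" if "l < m'"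
    unfolding mult_mat_vec_index[OF A ac that] by (intro qs_sum q) simp
  have cq: "q_sum m h a \<tau> \<in> carrier_vec m" by (simp add: q_sum_def)
  assume \<tau>: "\<tau> \<in> upper_half_plane"
  show "A *\<^sub>v q_sum m h a \<tau> = Matrix.vec m' (\<lambda>l. qsum h (\<lambda>n. (A *\<^sub>v a n) $ l) \<tau>)"
  proof (rule eq_vecI)
    fix l assume "l < dim_vec (Matrix.vec m' (\<lambda>l. qsum h (\<lambda>n. (A *\<^sub>v a n) $ l) \<tau>))"
    then have l: "l < m'" by simp
    have "(A *\<^sub>v q_sum m h a \<tau>) $ l = (\<Sum>k<m. A $$ (l, k) * qsum h (\<lambda>n. a n $ k) \<tau>)"
      by (simp add: mult_mat_vec_index[OF A cq l] q_sum_index del: index_mult_mat_vec)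
    also have "\<dots> = qsum h (\<lambda>n. (A *\<^sub>v a n) $ l) \<tau>"
    proof -
      have "(\<Sum>k<m. A $$ (l, k) * qsum h (\<lambda>n. a n $ k) \<tau>) = (\<Sum>k<m. qsum h (\<lambda>n. A $$ (l, k) * a n $ k) \<tau>)"
        by (simp add: qsum_cmult)
      also have "\<dots> = qsum h (\<lambda>n. \<Sum>k<m. A $$ (l, k) * a n $ k) \<tau>"
        using q \<tau> by (intro qsum_sum[symmetric]) auto
      finally show ?thesis by (simp only: mult_mat_vec_index[OF A ac l])
    qed
    finally show "(A *\<^sub>v q_sum m h a \<tau>) $ l = Matrix.vec m' (\<lambda>l. qsum h (\<lambda>n. (A *\<^sub>v a n) $ l) \<tau>) $ l"
      using l by simp
  qed (use A in auto)
qed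

text \<open>The eigenbasis hidden in \<open>adm_exp\<close> need not be the prescribed one;
  \<open>diag_function_unique\<close> exchanges the two. Bases can thus be fixed before a form is
  given.\<close>

lemma coord_exp_of_adm_exp:
  assumes w: "similar_mat_wit T (mat_diag m ev) P P'" and a: "adm_exp m h T X a"
  shows "coord_exp m h ev P X (\<lambda>n s. (P' *\<^sub>v a n) $ s)"
proof -
  obtain P1 Q1 e1 where w1: "similar_mat_wit T (mat_diag m e1) P1 Q1"
    and X: "\<And>\<tau>. \<tau> \<in> upper_half_plane \<Longrightarrow>
      X \<tau> = P1 *\<^sub>v (mat_diag m (\<lambda>l. q_pow h (mu (e1 l)) \<tau>) *\<^sub>v (Q1 *\<^sub>v q_sum m h a \<tau>))"
    using a unfolding adm_exp_def by blast
  have q: "q_series m h a" using a by (simp add: adm_exp_def)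
  note ww = similar_diag_wit[OF w] and ww1 = similar_diag_wit[OF w1]
  have cq: "q_sum m h a \<tau> \<in> carrier_vec m" for \<tau> by (simp add: q_sum_def)
  have prod3: "A *\<^sub>v (B *\<^sub>v (C *\<^sub>v v)) = (A * B * C) *\<^sub>v v"
    if "A \<in> carrier_mat m m" "B \<in> carrier_mat m m" "C \<in> carrier_mat m m" "v \<in> carrier_vec m"
    for A B C :: "complex Matrix.mat" and v
    by (simp only: assoc_mult_mat_vec[OF mult_carrier_mat[OF that(1,2)] that(3,4)]
        assoc_mult_mat_vec[OF that(1,2) mult_mat_vec_carrier[OF that(3,4)]])
  show ?thesis unfolding coord_exp_def
  proof (intro conjI allI impI ballI)
    show "qs h (\<lambda>n. (P' *\<^sub>v a n) $ s)" if "s < m" for s by (rule q_sum_mult_mat(1)[OF ww(3) q that])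
    fix \<tau> assume \<tau>: "\<tau> \<in> upper_half_plane"
    have "X \<tau> = (P1 * mat_diag m (\<lambda>l. q_pow h (mu (e1 l)) \<tau>) * Q1) *\<^sub>v q_sum m h a \<tau>"
      unfolding X[OF \<tau>] using ww1 cq by (intro prod3) auto
    also have "\<dots> = (P * mat_diag m (\<lambda>l. q_pow h (mu (ev l)) \<tau>) * P') *\<^sub>v q_sum m h a \<tau>"
      using diag_function_unique[OF w1 w, of "\<lambda>x. q_pow h (mu x) \<tau>"] by simp
    also have "\<dots> = P *\<^sub>v (mat_diag m (\<lambda>l. q_pow h (mu (ev l)) \<tau>) *\<^sub>v (P' *\<^sub>v q_sum m h a \<tau>))"
      using ww cq by (intro prod3[symmetric]) auto
    also have "mat_diag m (\<lambda>l. q_pow h (mu (ev l)) \<tau>) *\<^sub>v (P' *\<^sub>v q_sum m h a \<tau>)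
        = Matrix.vec m (\<lambda>s. q_pow h (mu (ev s)) \<tau> * qsum h (\<lambda>n. (P' *\<^sub>v a n) $ s) \<tau>)"
      unfolding q_sum_mult_mat(2)[OF ww(3) q \<tau>] by (subst mat_diag_mult_vec) auto
    finally show "X \<tau> = P *\<^sub>v Matrix.vec m (\<lambda>s. q_pow h (mu (ev s)) \<tau> * qsum h (\<lambda>n. (P' *\<^sub>v a n) $ s) \<tau>)" .
  qed
qed

lemma adm_exp_of_coord_exp:
  assumes w: "similar_mat_wit T (mat_diag m ev) P P'" and c: "coord_exp m h ev P X c"
  shows "adm_exp m h T X (\<lambda>n. P *\<^sub>v Matrix.vec m (c n))" (is "adm_exp m h T X ?a")
    and "P' *\<^sub>v (P *\<^sub>v Matrix.vec m (c n)) = Matrix.vec m (c n)"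
proof -
  note ww = similar_diag_wit[OF w]
  show inv: "P' *\<^sub>v (P *\<^sub>v Matrix.vec m (c n)) = Matrix.vec m (c n)" for n
    using assoc_mult_mat_vec[OF ww(3,2), of "Matrix.vec m (c n)"] ww(5) by simp
  have qc: "q_series m h (\<lambda>n. Matrix.vec m (c n))" using c by (simp add: q_series_iff coord_exp_def)
  have qa: "q_series m h ?a" unfolding q_series_iff
    using q_sum_mult_mat(1)[OF ww(2) qc] mult_mat_vec_carrier[OF ww(2)] by auto
  have "X \<tau> = P *\<^sub>v (mat_diag m (\<lambda>l. q_pow h (mu (ev l)) \<tau>) *\<^sub>v (P' *\<^sub>v q_sum m h ?a \<tau>))"
    if \<tau>: "\<tau> \<in> upper_half_plane" for \<tau>
  proof -
    have "P' *\<^sub>v q_sum m h ?a \<tau> = Matrix.vec m (\<lambda>s. qsum h (\<lambda>n. c n s) \<tau>)"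
      unfolding q_sum_mult_mat(2)[OF ww(3) qa \<tau>] inv by (intro eq_vecI) auto
    then show ?thesis using c \<tau> unfolding coord_exp_def
      by (auto simp: mat_diag_mult_vec intro!: arg_cong[of _ _ "\<lambda>v. P *\<^sub>v v"] eq_vecI)
  qed
  then show "adm_exp m h T X ?a" unfolding adm_exp_def using qa w by blast
qed

lemma coord_exp_affine:
  assumes c: "coord_exp m h ev P X c" and s: "s > 0"
  shows "coord_exp m (h * s) ev P (\<lambda>\<tau>. X (\<tau> / of_real s + of_real \<beta>))
    (\<lambda>n l. q_pow h (mu (ev l) + of_int n) (of_real \<beta>) * c n l)"
proof -
  have e: "q_pow h (mu (ev l) + of_int n) (of_real \<beta>) * c n l
      = q_pow h (mu (ev l)) (of_real \<beta>) * (c n l * q_pow h (of_int n) (of_real \<beta>))" for n l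
    by (simp add: q_pow_add)
  show ?thesis unfolding coord_exp_def e
  proof (intro conjI allI impI ballI)
    show "qs (h * s) (\<lambda>n. q_pow h (mu (ev l)) (of_real \<beta>) * (c n l * q_pow h (of_int n) (of_real \<beta>)))"
      if "l < m" for l using c that s by (intro qs_cmult qs_affine) (auto simp: coord_exp_def)
    fix \<tau> assume "\<tau> \<in> upper_half_plane"
    from upper_half_plane_affine[OF this s, of \<beta>] c
    have "X (\<tau> / of_real s + of_real \<beta>) = P *\<^sub>v Matrix.vec m (\<lambda>l. q_pow h (mu (ev l)) (\<tau> / of_real s + of_real \<beta>)
        * qsum h (\<lambda>n. c n l) (\<tau> / of_real s + of_real \<beta>))"
      by (simp add: coord_exp_def)
    then show "X (\<tau> / of_real s + of_real \<beta>) = P *\<^sub>v Matrix.vec m (\<lambda>l. q_pow (h * s) (mu (ev l)) \<tau> *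
        qsum (h * s) (\<lambda>n. q_pow h (mu (ev l)) (of_real \<beta>) * (c n l * q_pow h (of_int n) (of_real \<beta>))) \<tau>)"
      unfolding qsum_cmult qsum_affine q_pow_affine by (simp add: mult.assoc)
  qed
qed

lemma adm_exp_affine:
  assumes a: "adm_exp m h T X a" and s: "s > 0"
  shows "\<exists>a'. adm_exp m (h * s) T (\<lambda>\<tau>. X (\<tau> / of_real s + of_real \<beta>)) a'"
proof -
  obtain P P' ev where w: "similar_mat_wit T (mat_diag m ev) P P'" using a unfolding adm_exp_def by blast
  show ?thesis
    using adm_exp_of_coord_exp(1)[OF w coord_exp_affine[OF coord_exp_of_adm_exp[OF w a] s]] by blast
qed

lemma adm_exp_cong:
  assumes "adm_exp m h T X a" "\<And>\<tau>. \<tau> \<in> upper_half_plane \<Longrightarrow> X \<tau> = Y \<tau>"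
  shows "adm_exp m h T Y a"
  using assms unfolding adm_exp_def by metis

section \<open>Logarithmic expansions\<close>

definition log_exp :: "nat \<Rightarrow> real \<Rightarrow> complex Matrix.mat \<Rightarrow> (complex \<Rightarrow> complex Matrix.vec) \<Rightarrow>
    (complex \<Rightarrow> nat \<Rightarrow> int \<Rightarrow> complex Matrix.vec) \<Rightarrow> bool" where
  "log_exp m h T X a \<longleftrightarrow>
     (\<forall>z j n. a z j n \<in> carrier_vec m) \<and> (\<forall>z j. \<forall>l<m. qs h (\<lambda>n. a z j n $ l)) \<and>
     (\<forall>z j n. \<not> (eigenvalue T z \<and> j < jordan_size T z) \<longrightarrow> a z j n = 0\<^sub>v m) \<and>
     (\<forall>\<tau>\<in>upper_half_plane. X \<tau> \<in> carrier_vec m \<and>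
       (\<forall>l<m. X \<tau> $ l = (\<Sum>z\<in>{z. eigenvalue T z}. \<Sum>j<jordan_size T z.
               log_q h \<tau> ^ j * q_pow h (mu z) \<tau> * qsum h (\<lambda>n. a z j n $ l) \<tau>)))"

lemma log_expansion_iff:
  "log_expansion m \<Gamma> \<rho> X a \<longleftrightarrow> log_exp m (cusp_width \<Gamma> Infty) (\<rho> (cusp_generator \<Gamma> Infty)) X a"
proof -
  have "l < m \<Longrightarrow> q_sum m h f \<tau> $ l = qsum h (\<lambda>n. f n $ l) \<tau>" for l h f \<tau> by (rule q_sum_index)
  then show ?thesis
    unfolding log_expansion_def log_exp_def Let_def q_series_iff by (simp cong: conj_cong) blast
qed

lemma log_exp_cong:
  assumes "log_exp m h T X a" "\<And>\<tau>. \<tau> \<in> upper_half_plane \<Longrightarrow> X \<tau> = Y \<tau>"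
  shows "log_exp m h T Y a"
  using assms unfolding log_exp_def by simp

lemma log_q_affine: "log_q h (\<tau> / of_real s + of_real \<beta>) = log_q (h * s) \<tau> + log_q h (of_real \<beta>)"
  by (simp add: log_q_def add_divide_distrib algebra_simps)

text \<open>The logarithm is shifted by a constant, so the binomial theorem sends its j-th power to
  powers i \<le> j; the range below the Jordan size is never left.\<close>

lemma log_exp_affine:
  assumes a: "log_exp m h T X a" and s: "s > 0"
  shows "\<exists>a'. log_exp m (h * s) T (\<lambda>\<tau>. X (\<tau> / of_real s + of_real \<beta>)) a'"
proof -
  let ?J = "jordan_size T"
  define k where "k z i j = of_nat (j choose i) * log_q h (of_real \<beta>) ^ (j - i) * q_pow h (mu z) (of_real \<beta>)" for z i j
  define a' where "a' z i n = Matrix.vec m (\<lambda>l. \<Sum>j<?J z. k z i j * (a z j n $ l * q_pow h (of_int n) (of_real \<beta>)))" for z i n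
  have q: "qs h (\<lambda>n. a z j n $ l)" if "l < m" for z j l using a that by (simp add: log_exp_def)
  then have q': "qs (h * s) (\<lambda>n. k z i j * (a z j n $ l * q_pow h (of_int n) (of_real \<beta>)))" if "l < m" for z i j l
    using that s by (intro qs_cmult qs_affine)
  have binom: "log_q h (\<tau> / of_real s + of_real \<beta>) ^ j
      = (\<Sum>i<J. of_nat (j choose i) * log_q (h * s) \<tau> ^ i * log_q h (of_real \<beta>) ^ (j - i))" if "j < J" for j J \<tau>
  proof -
    have "log_q h (\<tau> / of_real s + of_real \<beta>) ^ j
      = (\<Sum>i\<le>j. of_nat (j choose i) * log_q (h * s) \<tau> ^ i * log_q h (of_real \<beta>) ^ (j - i))"
      unfolding log_q_affine by (rule binomial_ring)
    \<comment> \<open>Vanishing binomial coefficients pad the sum to a range that does not depend on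
      j, so that the two sums can be exchanged.\<close>
    also have "\<dots> = (\<Sum>i<J. of_nat (j choose i) * log_q (h * s) \<tau> ^ i * log_q h (of_real \<beta>) ^ (j - i))"
      using that by (intro sum.mono_neutral_left) (auto simp: binomial_eq_0)
    finally show ?thesis .
  qed
  have "log_exp m (h * s) T (\<lambda>\<tau>. X (\<tau> / of_real s + of_real \<beta>)) a'"
    unfolding log_exp_def
  proof (intro conjI allI impI ballI)
    show "a' z j n \<in> carrier_vec m" for z j n by (simp add: a'_def)
    show "qs (h * s) (\<lambda>n. a' z j n $ l)" if "l < m" for z j l
      using that by (simp add: a'_def) (intro qs_sum q')
    show "a' z i n = 0\<^sub>v m" if "\<not> (eigenvalue T z \<and> i < ?J z)" for z i n
    proof (rule eq_vecI)
      fix l assume l: "l < dim_vec (0\<^sub>v m :: complex Matrix.vec)"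
      have "k z i j * (a z j n $ l * q_pow h (of_int n) (of_real \<beta>)) = 0" if "j < ?J z" for j
      proof (cases "eigenvalue T z")
        case True
        with \<open>\<not> (eigenvalue T z \<and> i < ?J z)\<close> that have "j < i" by simp
        then show ?thesis by (simp add: k_def binomial_eq_0)
      next
        case False
        then show ?thesis using a l by (simp add: log_exp_def)
      qed
      then have "(\<Sum>j<?J z. k z i j * (a z j n $ l * q_pow h (of_int n) (of_real \<beta>))) = 0"
        by (intro sum.neutral ballI) (simp only: lessThan_iff)
      then show "a' z i n $ l = 0\<^sub>v m $ l" using l by (simp add: a'_def)
    qed (simp add: a'_def)
    fix \<tau> assume \<tau>: "\<tau> \<in> upper_half_plane"
    let ?\<tau> = "\<tau> / of_real s + of_real \<beta>"
    have \<tau>': "?\<tau> \<in> upper_half_plane" using upper_half_plane_affine[OF \<tau> s] .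
    show "X ?\<tau> \<in> carrier_vec m" using a \<tau>' by (simp add: log_exp_def)
    fix l assume l: "l < m"
    have "X ?\<tau> $ l = (\<Sum>z\<in>{z. eigenvalue T z}. \<Sum>j<?J z.
               log_q h ?\<tau> ^ j * q_pow h (mu z) ?\<tau> * qsum h (\<lambda>n. a z j n $ l) ?\<tau>)"
      using a \<tau>' l by (simp add: log_exp_def)
    also have "\<dots> = (\<Sum>z\<in>{z. eigenvalue T z}. \<Sum>i<?J z.
               log_q (h * s) \<tau> ^ i * q_pow (h * s) (mu z) \<tau> * qsum (h * s) (\<lambda>n. a' z i n $ l) \<tau>)"
    proof (rule sum.cong[OF refl])
      fix z
      have "qsum (h * s) (\<lambda>n. a' z i n $ l) \<tau> = (\<Sum>j<?J z. k z i j * qsum h (\<lambda>n. a z j n $ l) ?\<tau>)" for i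
        using l by (simp add: a'_def qsum_sum[OF q' \<tau>] qsum_cmult qsum_affine)
      then have "(\<Sum>i<?J z. log_q (h * s) \<tau> ^ i * q_pow (h * s) (mu z) \<tau> * qsum (h * s) (\<lambda>n. a' z i n $ l) \<tau>)
          = (\<Sum>i<?J z. \<Sum>j<?J z. log_q (h * s) \<tau> ^ i * q_pow (h * s) (mu z) \<tau> * (k z i j * qsum h (\<lambda>n. a z j n $ l) ?\<tau>))"
        by (simp add: sum_distrib_left)
      also have "\<dots> = (\<Sum>j<?J z. \<Sum>i<?J z. log_q (h * s) \<tau> ^ i * q_pow (h * s) (mu z) \<tau> * (k z i j * qsum h (\<lambda>n. a z j n $ l) ?\<tau>))"
        by (rule sum.swap)
      also have "\<dots> = (\<Sum>j<?J z. log_q h ?\<tau> ^ j * q_pow h (mu z) ?\<tau> * qsum h (\<lambda>n. a z j n $ l) ?\<tau>)"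
      proof (rule sum.cong[OF refl])
        fix j assume "j \<in> {..<?J z}"
        then show "(\<Sum>i<?J z. log_q (h * s) \<tau> ^ i * q_pow (h * s) (mu z) \<tau> * (k z i j * qsum h (\<lambda>n. a z j n $ l) ?\<tau>))
            = log_q h ?\<tau> ^ j * q_pow h (mu z) ?\<tau> * qsum h (\<lambda>n. a z j n $ l) ?\<tau>"
          by (simp add: binom[of j "?J z"] q_pow_affine k_def sum_distrib_left sum_distrib_right mult_ac)
      qed
      finally show "(\<Sum>j<?J z. log_q h ?\<tau> ^ j * q_pow h (mu z) ?\<tau> * qsum h (\<lambda>n. a z j n $ l) ?\<tau>)
        = (\<Sum>i<?J z. log_q (h * s) \<tau> ^ i * q_pow (h * s) (mu z) \<tau> * qsum (h * s) (\<lambda>n. a' z i n $ l) \<tau>)" by simp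
    qed
    finally show "X ?\<tau> $ l = (\<Sum>z\<in>{z. eigenvalue T z}. \<Sum>i<?J z.
               log_q (h * s) \<tau> ^ i * q_pow (h * s) (mu z) \<tau> * qsum (h * s) (\<lambda>n. a' z i n $ l) \<tau>)" .
  qed
  then show ?thesis by blast
qed

lemma eigenvalue_similar_diag:
  fixes T :: "complex Matrix.mat"
  assumes "similar_mat_wit T (mat_diag m ev) P P'"
  shows "eigenvalue T z \<longleftrightarrow> (\<exists>s<m. ev s = z)"
proof -
  note T = similar_diag_wit(1)[OF assms]
  have "similar_mat T (mat_diag m ev)" using assms by (auto simp: similar_mat_def)
  then have "char_poly T = char_poly (mat_diag m ev)" by (rule char_poly_similar)
  also have "\<dots> = (\<Prod>a\<leftarrow>diag_mat (mat_diag m ev). [:- a, 1:])"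
    by (rule char_poly_upper_triangular[of _ m]) (auto simp: mat_diag_def)
  also have "diag_mat (mat_diag m ev) = map ev [0..<m]"
    by (auto simp: diag_mat_def mat_diag_def)
  finally show ?thesis unfolding eigenvalue_root_char_poly[OF T]
    by (auto simp: poly_prod_list prod_list_zero_iff)
qed

text \<open>The labelled identity is claimed for every representation, so admissible expansions need
  a logarithmic form too: only the power 0 occurs, and the coefficient for \<open>z\<close> is the
  component in its eigenspace.\<close>

lemma log_exp_of_adm_exp:
  assumes a: "adm_exp m h T X a"
  shows "\<exists>a'. log_exp m h T X a'"
proof -
  obtain P P' ev where w: "similar_mat_wit T (mat_diag m ev) P P'" using a unfolding adm_exp_def by blast
  note ww = similar_diag_wit[OF w]
  define c where "c n s = (P' *\<^sub>v a n) $ s" for n s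
  have c: "coord_exp m h ev P X c" unfolding c_def by (rule coord_exp_of_adm_exp[OF w a])
  have q: "qs h (\<lambda>n. c n s)" if "s < m" for s using c that by (simp add: coord_exp_def)
  define a' where "a' z j n = (if j = (0::nat) then Matrix.vec m (\<lambda>l. \<Sum>s | s < m \<and> ev s = z. P $$ (l, s) * c n s) else 0\<^sub>v m)" for z j n
  have spec: "{z. eigenvalue T z} = ev ` {..<m}" using eigenvalue_similar_diag[OF w] by auto
  have "log_exp m h T X a'" unfolding log_exp_def
  proof (intro conjI allI impI ballI)
    show "a' z j n \<in> carrier_vec m" for z j n by (simp add: a'_def)
    show "qs h (\<lambda>n. a' z j n $ l)" if "l < m" for z j l
      using that by (cases "j = 0") (auto simp: a'_def intro!: qs_sum qs_cmult q)
    show "a' z j n = 0\<^sub>v m" if "\<not> (eigenvalue T z \<and> j < jordan_size T z)" for z j n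
    proof (cases "eigenvalue T z")
      case True
      then have "j \<noteq> 0" using that jordan_size_pos[OF ww(1) True] by auto
      then show ?thesis by (simp add: a'_def)
    next
      case False
      then have e: "{s. s < m \<and> ev s = z} = {}" using eigenvalue_similar_diag[OF w] by blast
      show ?thesis unfolding a'_def e by (auto intro!: eq_vecI)
    qed
    fix \<tau> assume \<tau>: "\<tau> \<in> upper_half_plane"
    then have X: "X \<tau> = P *\<^sub>v Matrix.vec m (\<lambda>s. q_pow h (mu (ev s)) \<tau> * qsum h (\<lambda>n. c n s) \<tau>)"
      using c by (simp add: coord_exp_def)
    show "X \<tau> \<in> carrier_vec m" unfolding X by (rule mult_mat_vec_carrier[OF ww(2)]) simp
    fix l assume l: "l < m"
    have "X \<tau> $ l = (\<Sum>s<m. P $$ (l, s) * (q_pow h (mu (ev s)) \<tau> * qsum h (\<lambda>n. c n s) \<tau>))"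
      unfolding X by (subst mult_mat_vec_index[OF ww(2) _ l]) auto
    also have "\<dots> = (\<Sum>z\<in>{z. eigenvalue T z}. \<Sum>s\<in>{s \<in> {..<m}. ev s = z}. P $$ (l, s) * (q_pow h (mu (ev s)) \<tau> * qsum h (\<lambda>n. c n s) \<tau>))"
      unfolding spec by (rule sum.group[symmetric]) auto
    also have "\<dots> = (\<Sum>z\<in>{z. eigenvalue T z}. \<Sum>j<jordan_size T z.
               log_q h \<tau> ^ j * q_pow h (mu z) \<tau> * qsum h (\<lambda>n. a' z j n $ l) \<tau>)"
    proof (rule sum.cong[OF refl])
      fix z assume "z \<in> {z. eigenvalue T z}"
      then have J: "jordan_size T z > 0" using jordan_size_pos[OF ww(1)] by simp
      have "(\<Sum>j<jordan_size T z. log_q h \<tau> ^ j * q_pow h (mu z) \<tau> * qsum h (\<lambda>n. a' z j n $ l) \<tau>)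
          = (\<Sum>j\<in>{0}. log_q h \<tau> ^ j * q_pow h (mu z) \<tau> * qsum h (\<lambda>n. a' z j n $ l) \<tau>)"
        using J l by (intro sum.mono_neutral_right) (auto simp: a'_def)
      also have "\<dots> = q_pow h (mu z) \<tau> * qsum h (\<lambda>n. \<Sum>s | s < m \<and> ev s = z. P $$ (l, s) * c n s) \<tau>"
        using l by (simp add: a'_def)
      also have "qsum h (\<lambda>n. \<Sum>s | s < m \<and> ev s = z. P $$ (l, s) * c n s) \<tau>
          = (\<Sum>s | s < m \<and> ev s = z. P $$ (l, s) * qsum h (\<lambda>n. c n s) \<tau>)"
        using \<tau> by (subst qsum_sum) (auto intro: qs_cmult q simp: qsum_cmult)
      finally show "(\<Sum>s\<in>{s \<in> {..<m}. ev s = z}. P $$ (l, s) * (q_pow h (mu (ev s)) \<tau> * qsum h (\<lambda>n. c n s) \<tau>))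
          = (\<Sum>j<jordan_size T z. log_q h \<tau> ^ j * q_pow h (mu z) \<tau> * qsum h (\<lambda>n. a' z j n $ l) \<tau>)"
        by (auto simp: sum_distrib_left mult_ac intro!: sum.cong)
    qed
    finally show "X \<tau> $ l = (\<Sum>z\<in>{z. eigenvalue T z}. \<Sum>j<jordan_size T z.
               log_q h \<tau> ^ j * q_pow h (mu z) \<tau> * qsum h (\<lambda>n. a' z j n $ l) \<tau>)" .
  qed
  then show ?thesis by blast
qed

section \<open>Conjugation of automorphic forms\<close>

lemma cusp_generator_Infty:
  assumes "subgroup K SL2R" "- id2 \<in> K" "has_width K Infty h"
  shows "cusp_generator K Infty = mat2 1 h 0 1"
  by (simp add: cusp_generator_def cusp_width_eq[OF assms])

lemma conj_group_inv_cancel: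
  assumes "sl2 g"
  shows "conj_group (matrix_inv g) (conj_group g K) = K"
  using assms by (simp add: conj_group_conj_group sl2_inv) (simp add: conj_group_def)

lemma has_width_cusp_mat:
  assumes "subgroup K SL2R" "has_width K c h"
  shows "has_width (conj_group (matrix_inv (cusp_mat c)) K) Infty h"
proof -
  have "has_width (conj_group (matrix_inv (cusp_mat c)) K) (moebius_bd (matrix_inv (cusp_mat c)) c) (1\<^sup>2 * h)"
    by (rule has_width_conj_group[OF _ assms, of _ _ 0]) (simp_all add: sl2_inv id2_mat2[symmetric])
  then show ?thesis by simp
qed

lemma cusp_data:
  assumes "subgroup K SL2R" "- id2 \<in> K" "has_width K c h"
  defines "K' \<equiv> conj_group (matrix_inv (cusp_mat c)) K"
  shows "cusp_width K' Infty = h"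
    and "conj_rep (matrix_inv (cusp_mat c)) \<rho> (cusp_generator K' Infty) = \<rho> (cusp_translation c h)"
proof -
  have A: "sl2 (matrix_inv (cusp_mat c))" by (simp add: sl2_inv)
  have K': "subgroup K' SL2R" "- id2 \<in> K'" "has_width K' Infty h"
    unfolding K'_def using subgroup_conj_group[OF A assms(1)] uminus_id2_mem_conj_group[OF A assms(2)]
      has_width_cusp_mat[OF assms(1,3)] by blast+
  show "cusp_width K' Infty = h" by (rule cusp_width_eq[OF K'])
  show "conj_rep (matrix_inv (cusp_mat c)) \<rho> (cusp_generator K' Infty) = \<rho> (cusp_translation c h)"
    by (simp add: cusp_generator_Infty[OF K'] conj_rep_def sl2_inv cusp_translation_def)
qed

lemma admissible_conj:
  assumes "sl2 g"
  shows "admissible (conj_group g K) (conj_rep g \<rho>) \<longleftrightarrow> admissible K \<rho>"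
proof -
  have "parabolic (g ** x ** matrix_inv g) \<longleftrightarrow> parabolic x" for x
    using assms by (simp add: parabolic_def trace_conj)
  moreover have "conj_rep g \<rho> (g ** x ** matrix_inv g) = \<rho> x" for x
    using assms by (simp add: conj_rep_def matrix_mul_assoc sl2_inv sl2_inv_cancel)
  ultimately show ?thesis unfolding admissible_def conj_group_def by simp
qed

text \<open>The delicate point is the behaviour at the cusps. The cusp \<open>c\<close> of the
  conjugate group corresponds to \<open>c0\<close> of \<open>K\<close>; between the two local
  coordinates \<open>g\<close> is upper triangular, so the expansion at \<open>c\<close> arises from
  the one at \<open>c0\<close> by an affine substitution.\<close>

lemma vvaf_conj:
  assumes K: "subgroup K SL2R" "- id2 \<in> K" "discrete K" and g: "sl2 g"
    and X: "weakly_holomorphic_vvaf m K \<rho> X"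
  shows "weakly_holomorphic_vvaf m (conj_group g K) (conj_rep g \<rho>) (\<lambda>\<tau>. X (moebius (matrix_inv g) \<tau>))"
proof -
  have gi: "sl2 (matrix_inv g)" using g by (simp add: sl2_inv)
  note up = moebius_upper[OF gi]
  have Xc: "X \<tau> \<in> carrier_vec m" if "\<tau> \<in> upper_half_plane" for \<tau>
    using X that by (simp add: weakly_holomorphic_vvaf_def)
  show ?thesis unfolding weakly_holomorphic_vvaf_def
  proof (intro conjI ballI allI impI)
    show "X (moebius (matrix_inv g) \<tau>) \<in> carrier_vec m" if "\<tau> \<in> upper_half_plane" for \<tau>
      using Xc[OF up[OF that]] .
    show "(\<lambda>\<tau>. X (moebius (matrix_inv g) \<tau>) $ l) holomorphic_on upper_half_plane" if "l < m" for l
    proof -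
      have "(\<lambda>\<tau>. X \<tau> $ l) holomorphic_on upper_half_plane"
        using X that by (simp add: weakly_holomorphic_vvaf_def)
      from holomorphic_on_compose_gen[OF moebius_holomorphic[OF gi] this] up
      show ?thesis by (auto simp: o_def)
    qed
    show "X (moebius (matrix_inv g) (moebius \<gamma> \<tau>)) = conj_rep g \<rho> \<gamma> *\<^sub>v X (moebius (matrix_inv g) \<tau>)"
      if \<gamma>: "\<gamma> \<in> conj_group g K" and \<tau>: "\<tau> \<in> upper_half_plane" for \<gamma> \<tau>
    proof -
      have s\<gamma>: "sl2 \<gamma>" using subgroup_SL2R_D(1)[OF subgroup_conj_group[OF g K(1)] \<gamma>] .
      define x where "x = matrix_inv g ** \<gamma> ** g"
      have x: "x \<in> K" using \<gamma> by (simp add: x_def mem_conj_group[OF g])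
      have sx: "sl2 x" using subgroup_SL2R_D(1)[OF K(1) x] .
      have "x ** matrix_inv g = matrix_inv g ** \<gamma>"
        using g by (simp add: x_def sl2_inv_cancel)
      then have "moebius (matrix_inv g) (moebius \<gamma> \<tau>) = moebius x (moebius (matrix_inv g) \<tau>)"
        using moebius_mult[OF gi s\<gamma> \<tau>] moebius_mult[OF sx gi \<tau>] by simp
      then show ?thesis using X x up[OF \<tau>] by (simp add: weakly_holomorphic_vvaf_def conj_rep_def x_def)
    qed
    fix c assume c: "is_cusp (conj_group g K) c"
    define c0 where "c0 = moebius_bd (matrix_inv g) c"
    have gc0: "moebius_bd g c0 = c" using g by (simp add: c0_def moebius_bd_inv)
    have cusp: "is_cusp K c0"
      using is_cusp_conj_group[OF gi subgroup_conj_group[OF g K(1)] c]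
      by (simp add: conj_group_inv_cancel[OF g] c0_def)
    obtain h where h: "has_width K c0 h" using ex_has_width[OF K cusp] by blast
    obtain \<alpha> \<beta> where \<alpha>: "\<alpha> \<noteq> 0" and U: "matrix_inv (cusp_mat c) ** g ** cusp_mat c0 = mat2 \<alpha> \<beta> 0 (1 / \<alpha>)"
      using cusp_change[OF g, of c0] unfolding gc0 by metis
    have h': "has_width (conj_group g K) c (\<alpha>\<^sup>2 * h)"
      using has_width_conj_group[OF g K(1) h, unfolded gc0, OF U \<alpha>] .
    note data0 = cusp_data[OF K(1,2) h]
    note data1 = cusp_data[OF subgroup_conj_group[OF g K(1)] uminus_id2_mem_conj_group[OF g K(2)] h']
    \<comment> \<open>Conjugation carries the generator at \<open>c0\<close> to the one at
      \<open>c\<close>, so both expansions refer to the same matrix.\<close>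
    have "g ** cusp_translation c0 h ** matrix_inv g = cusp_translation c (\<alpha>\<^sup>2 * h)"
      using conj_cusp_translation[OF g, of c0, unfolded gc0, OF U \<alpha>] .
    then have "matrix_inv g ** cusp_translation c (\<alpha>\<^sup>2 * h) ** g = cusp_translation c0 h"
      using g by (simp add: matrix_mul_assoc[symmetric] sl2_inv_cancel sl2_inv flip: \<open>g ** cusp_translation c0 h ** matrix_inv g = cusp_translation c (\<alpha>\<^sup>2 * h)\<close>)
    then have T: "conj_rep g \<rho> (cusp_translation c (\<alpha>\<^sup>2 * h)) = \<rho> (cusp_translation c0 h)"
      by (simp add: conj_rep_def)
    let ?X0 = "\<lambda>\<tau>. X (moebius (cusp_mat c0) \<tau>)" and ?X1 = "\<lambda>\<tau>. X (moebius (matrix_inv g) (moebius (cusp_mat c) \<tau>))"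
    have X1: "?X0 (\<tau> / of_real (\<alpha>\<^sup>2) + of_real (- \<beta> / \<alpha>)) = ?X1 \<tau>" if \<tau>: "\<tau> \<in> upper_half_plane" for \<tau>
    proof -
      \<comment> \<open>The inverse of the upper triangular matrix in \<open>U\<close>; it acts by
        \<tau>/\<alpha>^2 - \<beta>/\<alpha>.\<close>
      let ?V = "mat2 (1 / \<alpha>) (- \<beta>) 0 \<alpha>"
      have V: "sl2 ?V" using \<alpha> by simp
      have "matrix_inv (mat2 \<alpha> \<beta> 0 (1 / \<alpha>)) = ?V" using \<alpha> by (simp add: matrix_inv_mat2)
      then have "matrix_inv (matrix_inv (cusp_mat c) ** g ** cusp_mat c0) = ?V" by (simp only: U)
      then have "matrix_inv (cusp_mat c0) ** matrix_inv g ** cusp_mat c = ?V"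
        using g by (simp add: sl2_inv_mult sl2_mult sl2_inv matrix_mul_assoc)
      then have "cusp_mat c0 ** ?V = cusp_mat c0 ** (matrix_inv (cusp_mat c0) ** (matrix_inv g ** cusp_mat c))"
        by (simp add: matrix_mul_assoc)
      then have e: "cusp_mat c0 ** ?V = matrix_inv g ** cusp_mat c" by (simp add: sl2_inv_cancel)
      have "moebius ?V \<tau> = \<tau> / of_real (\<alpha>\<^sup>2) + of_real (- \<beta> / \<alpha>)"
        using \<alpha> by (simp add: moebius_def power2_eq_square field_simps)
      then have "?X0 (\<tau> / of_real (\<alpha>\<^sup>2) + of_real (- \<beta> / \<alpha>)) = ?X0 (moebius ?V \<tau>)" by simp
      also have "\<dots> = X (moebius (matrix_inv g ** cusp_mat c) \<tau>)"
        using moebius_mult[OF sl2_cusp_mat[of c0] V \<tau>] by (simp add: e)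
      also have "\<dots> = ?X1 \<tau>" using moebius_mult[OF gi sl2_cusp_mat[of c] \<tau>] by simp
      finally show ?thesis .
    qed
    have \<alpha>2: "\<alpha>\<^sup>2 > 0" using \<alpha> by simp
    have at0: "if admissible K \<rho> then \<exists>a. adm_exp m h (\<rho> (cusp_translation c0 h)) ?X0 a
        else \<exists>a. log_exp m h (\<rho> (cusp_translation c0 h)) ?X0 a"
      using X cusp unfolding weakly_holomorphic_vvaf_def Let_def admissible_expansion_iff log_expansion_iff
      by (auto simp: data0)
    have "if admissible K \<rho> then \<exists>a. adm_exp m (h * \<alpha>\<^sup>2) (\<rho> (cusp_translation c0 h)) ?X1 a
        else \<exists>a. log_exp m (h * \<alpha>\<^sup>2) (\<rho> (cusp_translation c0 h)) ?X1 a"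
    proof (cases "admissible K \<rho>")
      case True
      then obtain a where "adm_exp m h (\<rho> (cusp_translation c0 h)) ?X0 a" using at0 by auto
      then obtain a' where "adm_exp m (h * \<alpha>\<^sup>2) (\<rho> (cusp_translation c0 h))
          (\<lambda>\<tau>. ?X0 (\<tau> / of_real (\<alpha>\<^sup>2) + of_real (- \<beta> / \<alpha>))) a'"
        using adm_exp_affine[OF _ \<alpha>2] by blast
      then have "adm_exp m (h * \<alpha>\<^sup>2) (\<rho> (cusp_translation c0 h)) ?X1 a'"
        by (rule adm_exp_cong) (rule X1)
      with True
      show ?thesis by auto
    next
      case False
      then obtain a where "log_exp m h (\<rho> (cusp_translation c0 h)) ?X0 a" using at0 by auto
      then obtain a' where "log_exp m (h * \<alpha>\<^sup>2) (\<rho> (cusp_translation c0 h))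
          (\<lambda>\<tau>. ?X0 (\<tau> / of_real (\<alpha>\<^sup>2) + of_real (- \<beta> / \<alpha>))) a'"
        using log_exp_affine[OF _ \<alpha>2] by blast
      then have "log_exp m (h * \<alpha>\<^sup>2) (\<rho> (cusp_translation c0 h)) ?X1 a'"
        by (rule log_exp_cong) (rule X1)
      with False
      show ?thesis by auto
    qed
    then show "let A = cusp_mat c; \<Gamma>' = conj_group (matrix_inv A) (conj_group g K);
         \<rho>' = conj_rep (matrix_inv A) (conj_rep g \<rho>); X' = \<lambda>\<tau>. X (moebius (matrix_inv g) (moebius A \<tau>))
     in if admissible (conj_group g K) (conj_rep g \<rho>) then \<exists>a. admissible_expansion m \<Gamma>' \<rho>' X' a
        else \<exists>a. log_expansion m \<Gamma>' \<rho>' X' a"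
      unfolding Let_def admissible_expansion_iff log_expansion_iff admissible_conj[OF g]
      by (simp only: data1 T) (simp only: mult.commute)
  qed
qed

section \<open>Coset representatives\<close>

text \<open>The nested enumeration is flattened to one list of index pairs, so that the cycle and
  the position of the a-th representative can be read from its a-th pair.\<close>

lemma coset_reps_pairs:
  assumes "cusp_generator G c = cusp_translation c w"
    and ks_def: "ks = concat (map (\<lambda>i. map (Pair i) [0..<cusp_index G H (cs ! i)]) [0..<length cs])"
  shows "coset_reps G H c cs As = map (\<lambda>(i, j). cusp_translation c (of_nat j * w) ** matrix_inv (As ! i)) ks"
    and "distinct ks" and "set ks = (SIGMA i:{..<length cs}. {..<cusp_index G H (cs ! i)})"
proof -
  show "coset_reps G H c cs As = map (\<lambda>(i, j). cusp_translation c (of_nat j * w) ** matrix_inv (As ! i)) ks"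
    unfolding coset_reps_def ks_def assms(1) cusp_translation_pow by (simp add: map_concat o_def)
  show "set ks = (SIGMA i:{..<length cs}. {..<cusp_index G H (cs ! i)})"
    by (auto simp: ks_def)
  have "distinct (concat (map (\<lambda>i. map (Pair i) [0..<f i]) [0..<n]))" for f :: "nat \<Rightarrow> nat" and n
    by (induction n) (auto simp: distinct_map inj_on_def)
  then show "distinct ks" by (simp add: ks_def)
qed

lemma conj_group_self:
  assumes "subgroup G SL2R" "A \<in> G"
  shows "conj_group A G = G"
proof -
  note G = subgroup_SL2R_D[OF assms(1)]
  have e: "matrix_inv A ** x ** A \<in> G \<longleftrightarrow> x \<in> G" for x
  proof
    assume "matrix_inv A ** x ** A \<in> G"
    then have "A ** (matrix_inv A ** x ** A) ** matrix_inv A \<in> G"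
      by (rule G(2)[OF G(2)[OF assms(2)] G(3)[OF assms(2)]])
    then show "x \<in> G"
      by (simp only: matrix_mul_assoc[symmetric] sl2_inv_cancel[OF G(1)[OF assms(2)]]
          sl2_inv(1)[OF G(1)[OF assms(2)]] matrix_mul_rid)
  qed (intro G(2,3) assms(2))
  show ?thesis by (rule Set.set_eqI) (simp only: mem_conj_group[OF G(1)[OF assms(2)]] e)
qed

lemma r_coset_eq:
  assumes H: "subgroup H SL2R" and h: "h \<in> H"
  shows "H #>\<^bsub>SL2R\<lparr>carrier := G\<rparr>\<^esub> (h ** y) = H #>\<^bsub>SL2R\<lparr>carrier := G\<rparr>\<^esub> y"
proof -
  note Hs = subgroup_SL2R_D[OF H]
  have sh: "sl2 h" using Hs(1)[OF h] .
  have e: "x ** (h ** y) = (x ** h) ** y" "x ** y = (x ** matrix_inv h) ** (h ** y)" for x :: "real^2^2"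
    using sh by (simp_all add: matrix_mul_assoc sl2_inv_cancel)
  have r: "H #>\<^bsub>SL2R\<lparr>carrier := G\<rparr>\<^esub> a = (\<lambda>x. x ** a) ` H" for a
    by (auto simp: r_coset_def)
  have "(\<lambda>x. x ** (h ** y)) ` H \<subseteq> (\<lambda>x. x ** y) ` H"
    by (rule image_subsetI, subst e(1)) (rule imageI[OF Hs(2)[OF _ h]])
  moreover have "(\<lambda>x. x ** y) ` H \<subseteq> (\<lambda>x. x ** (h ** y)) ` H"
    by (rule image_subsetI, subst e(2)) (rule imageI[OF Hs(2)[OF _ Hs(3)[OF h]]])
  ultimately show ?thesis unfolding r by (rule equalityI)
qed

text \<open>
  If the \<open>a\<close>-th representative is \<open>g\<^sub>i\<^sub>,\<^sub>j\<close>, then \<open>cl a = i\<close> and \<open>ps a = j\<close>; \<open>kk i\<close> is the relative width \<open>h\<^sub>i\<close>.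
\<close>

lemma coset_reps_structure:
  assumes G: "subgroup G SL2R" and H: "subgroup H SL2R" "- id2 \<in> H" "H \<subseteq> G"
    and w: "has_width G c w" and lift: "lift_data G H c cs As"
  defines "gs \<equiv> coset_reps G H c cs As"
  obtains cl ps kk :: "nat \<Rightarrow> nat" where
    "length gs = group_index (SL2R\<lparr>carrier := G\<rparr>) H"
    "\<And>a. a < length gs \<Longrightarrow> gs ! a \<in> G \<and> ps a < kk (cl a)"
    "\<And>a j. a < length gs \<Longrightarrow> j < kk (cl a) \<Longrightarrow> \<exists>b<length gs. cl b = cl a \<and> ps b = j"
    "\<And>a b. a < length gs \<Longrightarrow> b < length gs \<Longrightarrow> cl a = cl b \<Longrightarrow> ps a = ps b \<Longrightarrow> a = b"
    "\<And>a b. a < length gs \<Longrightarrow> b < length gs \<Longrightarrow> matrix_inv (gs ! a) ** cusp_translation c w ** gs ! b \<in> H \<longleftrightarrow>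
      cl a = cl b \<and> ps a = Suc (ps b) mod kk (cl b)"
    "\<And>a b. a < length gs \<Longrightarrow> b < length gs \<Longrightarrow> cl a = cl b \<Longrightarrow>
      gs ! a = cusp_translation c ((of_nat (ps a) - of_nat (ps b)) * w) ** gs ! b"
    "\<And>a. a < length gs \<Longrightarrow> has_width (conj_group (matrix_inv (cusp_mat c) ** gs ! a) H) Infty (of_nat (kk (cl a)) * w)
      \<and> is_cusp (conj_group (matrix_inv (cusp_mat c) ** gs ! a) H) Infty"
proof -
  note Gs = subgroup_SL2R_D[OF G] and Hs = subgroup_SL2R_D[OF H(1)]
  let ?n = "length cs" and ?k = "\<lambda>i. cusp_index G H (cs ! i)" and ?T = "cusp_translation c"
  have mG: "- id2 \<in> G" using H by blast
  have gen: "cusp_generator G c = ?T w"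
    by (simp add: cusp_generator_def cusp_width_eq[OF G mG w])
  have A: "As ! i \<in> G" "moebius_bd (As ! i) c = cs ! i" "is_cusp H (cs ! i)" if "i < ?n" for i
    using lift that by (auto simp: lift_data_def)
  have ineq: "moebius_bd \<gamma> (cs ! i) \<noteq> cs ! j" if "i < ?n" "j < ?n" "i \<noteq> j" "\<gamma> \<in> H" for i j \<gamma>
    using lift that by (auto simp: lift_data_def)
  have sA: "sl2 (As ! i)" if "i < ?n" for i using Gs(1)[OF A(1)[OF that]] .
  have w0: "w > 0" and stG: "bd_stabilizer G c = pm_translations c (int_multiples w)"
    using w by (auto simp: has_width_def)
  have TG: "?T (of_int n * w) \<in> G" for n
  proof -
    have "?T (of_int n * w) \<in> bd_stabilizer G c"
      unfolding stG by (auto simp: pm_translations_def int_multiples_def)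
    then show ?thesis by (simp add: bd_stabilizer_def)
  qed
  have "\<exists>\<alpha> \<beta>. \<alpha> \<noteq> 0 \<and> matrix_inv (cusp_mat (cs ! i)) ** As ! i ** cusp_mat c = mat2 \<alpha> \<beta> 0 (1 / \<alpha>)" if "i < ?n" for i
    using cusp_change[OF sA[OF that], of c] unfolding A(2)[OF that] by metis
  then obtain \<alpha> \<beta> where \<alpha>: "\<And>i. i < ?n \<Longrightarrow> \<alpha> i \<noteq> 0"
    and U: "\<And>i. i < ?n \<Longrightarrow> matrix_inv (cusp_mat (cs ! i)) ** As ! i ** cusp_mat c = mat2 (\<alpha> i) (\<beta> i) 0 (1 / \<alpha> i)"
    by metis
  \<comment> \<open>Conjugation by \<open>As ! i\<close>, an element of \<open>G\<close>, preserves
    \<open>G\<close> and carries the width at \<open>c\<close> to the one at \<open>cs ! i\<close>,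
    up to the factor \<alpha>^2.\<close>
  have wG: "has_width G (cs ! i) ((\<alpha> i)\<^sup>2 * w)" if i: "i < ?n" for i
    using has_width_conj_group[OF sA[OF i] G w, unfolded A(2)[OF i], OF U[OF i] \<alpha>[OF i]]
    by (simp add: conj_group_self[OF G A(1)[OF i]])
  have wH: "?k i > 0" "has_width H (cs ! i) (of_nat (?k i) * ((\<alpha> i)\<^sup>2 * w))" if i: "i < ?n" for i
    using ex_cusp_index[OF G H wG[OF i] A(3)[OF i]] by auto
  have conjT: "As ! i ** ?T x ** matrix_inv (As ! i) = cusp_translation (cs ! i) ((\<alpha> i)\<^sup>2 * x)" if i: "i < ?n" for i x
    using conj_cusp_translation[OF sA[OF i], of c, unfolded A(2)[OF i], OF U[OF i] \<alpha>[OF i]] .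
  \<comment> \<open>The conjugated n-th power of the generator is the translation at
    \<open>cs ! i\<close> by n times the width of \<open>G\<close> there, and the width of
    \<open>H\<close> is \<open>?k i\<close> times as large.\<close>
  have memH: "As ! i ** ?T (of_int n * w) ** matrix_inv (As ! i) \<in> H \<longleftrightarrow> int (?k i) dvd n" if i: "i < ?n" for i n
  proof -
    let ?x = "(\<alpha> i)\<^sup>2 * (of_int n * w)" and ?h = "of_nat (?k i) * ((\<alpha> i)\<^sup>2 * w)"
    have pos: "(\<alpha> i)\<^sup>2 * w \<noteq> 0" using \<alpha>[OF i] w0 by simp
    have "cusp_translation (cs ! i) ?x \<in> H \<longleftrightarrow> cusp_translation (cs ! i) ?x \<in> bd_stabilizer H (cs ! i)"
      by (simp add: bd_stabilizer_def)
    also have "\<dots> \<longleftrightarrow> ?x \<in> int_multiples ?h"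
      using wH(2)[OF i] by (auto simp: has_width_def pm_translations_def)
    also have "\<dots> \<longleftrightarrow> (\<exists>q. of_int n * ((\<alpha> i)\<^sup>2 * w) = of_int (q * int (?k i)) * ((\<alpha> i)\<^sup>2 * w))"
      by (auto simp: int_multiples_def mult_ac)
    also have "\<dots> \<longleftrightarrow> (\<exists>q. n = q * int (?k i))"
      using pos by (simp only: mult_cancel_right of_int_eq_iff simp_thms)
    finally show ?thesis by (auto simp: conjT[OF i] dvd_def mult.commute)
  qed
  \<comment> \<open>Such an element of \<open>H\<close> would map \<open>cs ! j\<close> to
    \<open>cs ! i\<close>, and these are inequivalent for i different from j.\<close>
  have cross: "i = j" if "i < ?n" "j < ?n" "As ! i ** ?T x ** matrix_inv (As ! j) \<in> H" for i j x
  proof (rule ccontr)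
    assume "i \<noteq> j"
    have "moebius_bd (As ! i ** ?T x ** matrix_inv (As ! j)) (cs ! j) = cs ! i"
      unfolding A(2)[OF that(2), symmetric] using sA that A(2)[OF that(1)]
      by (simp add: moebius_bd_mult sl2_mult sl2_inv moebius_bd_inv)
    then show False using ineq[OF that(2,1) _ that(3)] \<open>i \<noteq> j\<close> by auto
  qed
  define ks where "ks = concat (map (\<lambda>i. map (Pair i) [0..<?k i]) [0..<?n])"
  note pairs = coset_reps_pairs[OF gen ks_def]
  define rep where "rep = (\<lambda>(i, j). ?T (of_nat j * w) ** matrix_inv (As ! i))"
  have gs: "gs = map rep ks" unfolding gs_def pairs(1) rep_def ..
  have inks: "i < ?n \<and> j < ?k i" if "(i, j) \<in> set ks" for i j using that by (auto simp: pairs(3))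
  \<comment> \<open>One formula serves two purposes: e = 0 separates the cosets, e = 1 describes the
    action of the generator on them.\<close>
  have prod: "matrix_inv (rep (i, j)) ** ?T (of_int e * w) ** rep (i', j')
      = As ! i ** ?T (of_int (e + int j' - int j) * w) ** matrix_inv (As ! i')"
    if "i < ?n" "i' < ?n" for i j i' j' e
  proof -
    have "matrix_inv (rep (i, j)) = As ! i ** ?T (- (of_nat j * w))"
      using sA[OF that(1)] by (simp add: rep_def sl2_inv_mult sl2_inv matrix_inv_cusp_translation)
    then have "matrix_inv (rep (i, j)) ** ?T (of_int e * w) ** rep (i', j')
        = As ! i ** (?T (- (of_nat j * w)) ** ?T (of_int e * w) ** ?T (of_nat j' * w)) ** matrix_inv (As ! i')"
      by (simp add: rep_def matrix_mul_assoc)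
    also have "?T (- (of_nat j * w)) ** ?T (of_int e * w) ** ?T (of_nat j' * w) = ?T (of_int (e + int j' - int j) * w)"
      by (simp add: cusp_translation_add algebra_simps)
    finally show ?thesis .
  qed
  have rel: "matrix_inv (rep (i, j)) ** ?T (of_int e * w) ** rep (i', j') \<in> H \<longleftrightarrow>
      i = i' \<and> int (?k i) dvd e + int j' - int j"
    if "i < ?n" "i' < ?n" for i j i' j' e
  proof
    assume *: "matrix_inv (rep (i, j)) ** ?T (of_int e * w) ** rep (i', j') \<in> H"
    then have "i = i'" unfolding prod[OF that] using cross[OF that] by blast
    with * show "i = i' \<and> int (?k i) dvd e + int j' - int j"
      unfolding prod[OF that] using memH[OF that(1)] by blast
  next
    assume "i = i' \<and> int (?k i) dvd e + int j' - int j"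
    then show "matrix_inv (rep (i, j)) ** ?T (of_int e * w) ** rep (i', j') \<in> H"
      unfolding prod[OF that] using memH[OF that(1)] by blast
  qed
  have repG: "rep p \<in> G" if "p \<in> set ks" for p
  proof -
    obtain i j where p: "p = (i, j)" by force
    have "?T (of_int (int j) * w) \<in> G" by (rule TG)
    moreover have "i < ?n" using inks[of i j] that p by simp
    then have "matrix_inv (As ! i) \<in> G" by (intro Gs(3) A(1))
    ultimately show ?thesis unfolding p rep_def using Gs(2) by simp
  qed
  \<comment> \<open>\<open>group_index\<close> counts right cosets, while the representatives belong
    to left cosets; hence the inverses.\<close>
  let ?coset = "\<lambda>p. H #>\<^bsub>SL2R\<lparr>carrier := G\<rparr>\<^esub> matrix_inv (rep p)"
  have inj: "inj_on ?coset (set ks)"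
  proof (rule inj_onI)
    fix p q assume pq: "p \<in> set ks" "q \<in> set ks" "?coset p = ?coset q"
    obtain i j i' j' where p: "p = (i, j)" and q: "q = (i', j')" by force
    have ij: "i < ?n" "j < ?k i" "i' < ?n" "j' < ?k i'" using inks pq(1,2) by (auto simp: p q)
    have "id2 ** matrix_inv (rep p) \<in> ?coset p" using Hs(4) by (auto simp: r_coset_def intro!: bexI[of _ id2])
    then obtain h where h: "h \<in> H" "matrix_inv (rep p) = h ** matrix_inv (rep q)"
      unfolding pq(3) by (auto simp: r_coset_def)
    have "matrix_inv (rep p) ** ?T (of_int 0 * w) ** rep q = h"
      using Gs(1)[OF repG[OF pq(2)]] by (simp add: h(2) sl2_inv_cancel)
    then have "i = i' \<and> int (?k i) dvd 0 + int j' - int j"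
      using rel[OF ij(1,3), of j 0 j'] h(1) unfolding p q by metis
    then have ii: "i = i'" and dv: "int (?k i) dvd int j' - int j" by auto
    have "j = j'"
    proof (rule ccontr)
      assume "j \<noteq> j'"
      then have "int (?k i) \<le> \<bar>int j' - int j\<bar>" using dvd_imp_le_int[OF _ dv] by simp
      then show False using ij ii by auto
    qed
    then show "p = q" by (simp add: p q ii)
  qed
  have "rcosets\<^bsub>SL2R\<lparr>carrier := G\<rparr>\<^esub> H = ?coset ` set ks"
  proof
    show "?coset ` set ks \<subseteq> rcosets\<^bsub>SL2R\<lparr>carrier := G\<rparr>\<^esub> H"
      using repG Gs(3) by (auto simp: RCOSETS_def)
    show "rcosets\<^bsub>SL2R\<lparr>carrier := G\<rparr>\<^esub> H \<subseteq> ?coset ` set ks"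
    proof
      fix C assume "C \<in> rcosets\<^bsub>SL2R\<lparr>carrier := G\<rparr>\<^esub> H"
      then obtain x where x: "x \<in> G" and C: "C = H #>\<^bsub>SL2R\<lparr>carrier := G\<rparr>\<^esub> x" by (auto simp: RCOSETS_def)
      have "moebius_bd x c \<in> (\<lambda>\<gamma>. moebius_bd \<gamma> c) ` G" using x by blast
      also have "\<dots> = (\<Union>i<?n. (\<lambda>\<gamma>. moebius_bd \<gamma> (cs ! i)) ` H)" using lift by (simp add: lift_data_def)
      finally obtain i \<gamma> where i: "i < ?n" and \<gamma>: "\<gamma> \<in> H" "moebius_bd x c = moebius_bd \<gamma> (cs ! i)" by blast
      \<comment> \<open>As \<gamma> followed after \<open>As ! i\<close> sends \<open>c\<close> to
        the same point as \<open>x\<close>, the quotient \<open>y\<close> fixes \<open>c\<close> and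
        is, up to sign, a power of the generator.\<close>
      define y where "y = matrix_inv (As ! i) ** (matrix_inv \<gamma> ** x)"
      have s: "sl2 x" "sl2 \<gamma>" using Gs(1)[OF x] Hs(1)[OF \<gamma>(1)] .
      have "y \<in> G" unfolding y_def
        by (intro Gs(2) Gs(3)[OF A(1)[OF i]] subsetD[OF H(3) Hs(3)[OF \<gamma>(1)]] x)
      moreover have "moebius_bd y c = c"
        unfolding y_def using s sA[OF i] \<gamma>(2)
        by (simp add: moebius_bd_mult sl2_mult sl2_inv moebius_bd_inv flip: A(2)[OF i])
      ultimately have "y \<in> pm_translations c (int_multiples w)" unfolding stG[symmetric] by (simp add: bd_stabilizer_def)
      then obtain n :: int where n: "y = ?T (of_int n * w) \<or> y = - ?T (of_int n * w)"
        by (auto simp: pm_translations_def int_multiples_def)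
      have xy: "x = \<gamma> ** (As ! i ** y)" using s sA[OF i] by (simp add: y_def matrix_mul_assoc sl2_inv_cancel sl2_inv)
      \<comment> \<open>The exponent n is rounded up to a multiple of \<open>?k i\<close>; the
        amount added is the index j of the representative.\<close>
      define j where "j = nat ((- n) mod int (?k i))"
      have j: "j < ?k i" "int j = (- n) mod int (?k i)"
        using wH(1)[OF i] by (auto simp: j_def nat_less_iff)
      have dv: "int (?k i) dvd n + int j"
        unfolding j(2) by (metis add.commute dvd_minus_mod minus_diff_eq dvd_minus_iff diff_minus_eq_add minus_minus mod_eq_dvd_iff mod_mod_trivial)
      define h where "h = As ! i ** ?T (of_int (n + int j) * w) ** matrix_inv (As ! i)"
      have hH: "h \<in> H" unfolding h_def using memH[OF i] dv by blast
      have "?T (of_int n * w) = ?T (of_int (n + int j) * w) ** ?T (- (of_nat j * w))"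
        by (simp add: cusp_translation_add algebra_simps)
      then have "As ! i ** ?T (of_int n * w) = h ** (As ! i ** ?T (- (of_nat j * w)))"
        using sA[OF i] by (simp add: h_def matrix_mul_assoc sl2_inv_cancel)
      also have "As ! i ** ?T (- (of_nat j * w)) = matrix_inv (rep (i, j))"
        using sA[OF i] by (simp add: rep_def sl2_inv_mult sl2_inv matrix_inv_cusp_translation)
      finally have e: "As ! i ** ?T (of_int n * w) = h ** matrix_inv (rep (i, j))" .
      \<comment> \<open>-I in \<open>H\<close> absorbs a possible sign of \<open>y\<close>.\<close>
      have m: "- h \<in> H" using Hs(2)[OF H(2) hH] by (simp add: uminus_mult)
      have "\<exists>h'\<in>H. x = h' ** matrix_inv (rep (i, j))"
        using n
      proof
        assume "y = ?T (of_int n * w)"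
        then have "x = (\<gamma> ** h) ** matrix_inv (rep (i, j))" unfolding xy e[symmetric] matrix_mul_assoc[symmetric] by simp
        then show ?thesis using Hs(2)[OF \<gamma>(1) hH] by blast
      next
        assume "y = - ?T (of_int n * w)"
        then have "x = (\<gamma> ** (- h)) ** matrix_inv (rep (i, j))"
          unfolding xy matrix_mul_assoc[symmetric] by (simp add: uminus_mult e)
        then show ?thesis using Hs(2)[OF \<gamma>(1) m] by blast
      qed
      then have "C = ?coset (i, j)" using r_coset_eq[OF H(1)] C by blast
      moreover have "(i, j) \<in> set ks" using i j(1) by (simp add: pairs(3))
      ultimately show "C \<in> ?coset ` set ks" by blast
    qed
  qed
  then have "group_index (SL2R\<lparr>carrier := G\<rparr>) H = card (set ks)"
    by (simp only: group_index_def card_image[OF inj])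
  also have "\<dots> = length gs" using distinct_card[OF pairs(2)] by (simp add: gs)
  finally have len: "length gs = group_index (SL2R\<lparr>carrier := G\<rparr>) H" by simp
  define cl where "cl a = fst (ks ! a)" for a
  define ps where "ps a = snd (ks ! a)" for a
  have lk: "length gs = length ks" by (simp add: gs)
  have ka: "ks ! a = (cl a, ps a)" "cl a < ?n" "ps a < ?k (cl a)" "gs ! a = rep (cl a, ps a)" "gs ! a \<in> G"
    if "a < length gs" for a
  proof -
    have mem: "ks ! a \<in> set ks" using that lk by simp
    show e: "ks ! a = (cl a, ps a)" by (simp add: cl_def ps_def)
    show "cl a < ?n" "ps a < ?k (cl a)" using inks mem e by metis+
    show "gs ! a = rep (cl a, ps a)" using that lk e by (simp add: gs)
    then show "gs ! a \<in> G" using repG mem e by simp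
  qed
  show thesis
  proof (rule that[of ps ?k cl])
    show "length gs = group_index (SL2R\<lparr>carrier := G\<rparr>) H" by (rule len)
    show "gs ! a \<in> G \<and> ps a < ?k (cl a)" if "a < length gs" for a using ka[OF that] by simp
    show "\<exists>b<length gs. cl b = cl a \<and> ps b = j" if "a < length gs" "j < ?k (cl a)" for a j
    proof -
      have "(cl a, j) \<in> set ks" using ka(2)[OF that(1)] that(2) by (simp add: pairs(3))
      then obtain b where "b < length ks" "ks ! b = (cl a, j)" by (auto simp: in_set_conv_nth)
      then show ?thesis by (auto simp: lk cl_def ps_def)
    qed
    show "a = b" if "a < length gs" "b < length gs" "cl a = cl b" "ps a = ps b" for a b
      using pairs(2) that ka(1) lk by (metis nth_eq_iff_index_eq)
    show "matrix_inv (gs ! a) ** ?T w ** gs ! b \<in> H \<longleftrightarrow> cl a = cl b \<and> ps a = Suc (ps b) mod ?k (cl b)"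
      if "a < length gs" "b < length gs" for a b
    proof -
      have "matrix_inv (gs ! a) ** ?T w ** gs ! b \<in> H \<longleftrightarrow>
          cl a = cl b \<and> int (?k (cl a)) dvd 1 + int (ps b) - int (ps a)"
        using rel[OF ka(2)[OF that(1)] ka(2)[OF that(2)], of "ps a" 1 "ps b"]
        by (simp add: ka(4)[OF that(1)] ka(4)[OF that(2)])
      also have "\<dots> \<longleftrightarrow> cl a = cl b \<and> int (Suc (ps b)) mod int (?k (cl a)) = int (ps a) mod int (?k (cl a))"
        by (simp add: mod_eq_dvd_iff)
      also have "\<dots> \<longleftrightarrow> cl a = cl b \<and> ps a = Suc (ps b) mod ?k (cl b)"
      proof -
        have "int (Suc (ps b)) mod int (?k (cl a)) = int (ps a) mod int (?k (cl a)) \<longleftrightarrow>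
            Suc (ps b) mod ?k (cl a) = ps a mod ?k (cl a)"
          by (simp only: of_nat_mod[symmetric] of_nat_eq_iff)
        then show ?thesis using ka(3)[OF that(1)] by auto
      qed
      finally show ?thesis .
    qed
    show "gs ! a = ?T ((of_nat (ps a) - of_nat (ps b)) * w) ** gs ! b"
      if "a < length gs" "b < length gs" "cl a = cl b" for a b
      by (simp add: ka(4)[OF that(1)] ka(4)[OF that(2)] rep_def matrix_mul_assoc cusp_translation_add that(3) algebra_simps)
    fix a assume a: "a < length gs"
    let ?i = "cl a" and ?g = "matrix_inv (cusp_mat c) ** gs ! a"
    note i = ka(2)[OF a]
    have sg: "sl2 ?g" using Gs(1)[OF ka(5)[OF a]] by (simp add: sl2_mult sl2_inv)
    have inf: "moebius_bd ?g (cs ! ?i) = Infty"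
      using sA[OF i] by (simp add: ka(4)[OF a] rep_def moebius_bd_mult sl2_mult sl2_inv moebius_bd_inv flip: A(2)[OF i])
    \<comment> \<open>The inverse of \<open>U\<close>. It shows that \<open>?g\<close> takes the
      local coordinate at the cusp of \<open>H\<close> to the one at infinity by an upper triangular
      matrix with first entry 1/\<alpha>, which cancels the factor \<alpha>^2 in the width.\<close>
    have Vinv: "matrix_inv (As ! ?i) ** cusp_mat (cs ! ?i) = cusp_mat c ** mat2 (1 / \<alpha> ?i) (- \<beta> ?i) 0 (\<alpha> ?i)"
    proof -
      have "matrix_inv (mat2 (\<alpha> ?i) (\<beta> ?i) 0 (1 / \<alpha> ?i)) = mat2 (1 / \<alpha> ?i) (- \<beta> ?i) 0 (\<alpha> ?i)"
        using \<alpha>[OF i] by (simp add: matrix_inv_mat2)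
      then have "matrix_inv (matrix_inv (cusp_mat (cs ! ?i)) ** As ! ?i ** cusp_mat c) = mat2 (1 / \<alpha> ?i) (- \<beta> ?i) 0 (\<alpha> ?i)"
        by (simp only: U[OF i])
      then have "matrix_inv (cusp_mat c) ** (matrix_inv (As ! ?i) ** cusp_mat (cs ! ?i)) = mat2 (1 / \<alpha> ?i) (- \<beta> ?i) 0 (\<alpha> ?i)"
        using sA[OF i] by (simp add: sl2_inv_mult sl2_mult sl2_inv matrix_mul_assoc)
      then show ?thesis by (metis sl2_inv_cancel(1) sl2_cusp_mat)
    qed
    have "?g ** cusp_mat (cs ! ?i) = (matrix_inv (cusp_mat c) ** ?T (of_nat (ps a) * w) ** cusp_mat c) ** mat2 (1 / \<alpha> ?i) (- \<beta> ?i) 0 (\<alpha> ?i)"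
      by (simp add: ka(4)[OF a] rep_def matrix_mul_assoc[symmetric] Vinv)
    also have "matrix_inv (cusp_mat c) ** ?T (of_nat (ps a) * w) ** cusp_mat c = mat2 1 (of_nat (ps a) * w) 0 1"
      by (simp add: cusp_translation_def matrix_mul_assoc sl2_inv_cancel sl2_inv)
    finally have "matrix_inv (cusp_mat (moebius_bd ?g (cs ! ?i))) ** ?g ** cusp_mat (cs ! ?i)
        = mat2 (1 / \<alpha> ?i) (- \<beta> ?i + of_nat (ps a) * w * \<alpha> ?i) 0 (1 / (1 / \<alpha> ?i))"
      by (simp add: inf)
    from has_width_conj_group[OF sg H(1) wH(2)[OF i] this] \<alpha>[OF i]
    have "has_width (conj_group ?g H) Infty (of_nat (?k ?i) * w)"
      by (simp add: inf power_divide)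
    moreover have "is_cusp (conj_group ?g H) Infty"
      using is_cusp_conj_group[OF sg H(1) A(3)[OF i]] by (simp add: inf)
    ultimately show "has_width (conj_group ?g H) Infty (of_nat (?k ?i) * w) \<and> is_cusp (conj_group ?g H) Infty" ..
  qed
qed

section \<open>Roots of unitary eigenvalues\<close>

lemma mu_bounds: "0 \<le> mu z" "mu z < 1"
  using Arg2pi_ge_0[of z] Arg2pi_lt_2pi[of z] by (simp_all add: mu_def)

lemma cis_mu:
  assumes "cmod z = 1"
  shows "cis (2 * pi * mu z) = z"
  using assms complex_norm_eq_1_exp[of z] by (simp add: mu_def cis_conv_exp)

lemma mu_cis:
  assumes "0 \<le> x" "x < 1"
  shows "mu (cis (2 * pi * x)) = x"
proof -
  have "Arg2pi (cis (2 * pi * x)) = 2 * pi * x"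
    by (rule Arg2pi_unique[of 1]) (use assms in \<open>simp_all add: cis_conv_exp\<close>)
  then show ?thesis by (simp add: mu_def)
qed

lemma cis_int_multiple: "cis (2 * pi * of_int n) = 1"
  by (simp add: cis.ctr complex_eq_iff cos_int_2pin sin_int_2pin)

text \<open>The k-th roots are numbered by argument so that \<open>mu\<close> of the r-th one is (mu
  z + r)/k; the fractional power of q for this root then belongs to the residue r.\<close>

definition root_of :: "complex \<Rightarrow> nat \<Rightarrow> nat \<Rightarrow> complex" where
  "root_of z k r = cis (2 * pi * ((mu z + of_nat r) / of_nat k))"

lemma root_of_pow:
  assumes "cmod z = 1" "k > 0"
  shows "root_of z k r ^ k = z"
proof -
  have "root_of z k r ^ k = cis (of_nat k * (2 * pi * ((mu z + of_nat r) / of_nat k)))"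
    by (simp only: root_of_def Complex.DeMoivre)
  also have "of_nat k * (2 * pi * ((mu z + of_nat r) / of_nat k)) = 2 * pi * mu z + 2 * pi * of_int (int r)"
    using assms(2) by (simp add: field_simps)
  also have "cis \<dots> = cis (2 * pi * mu z) * cis (2 * pi * of_int (int r))" by (rule cis_mult[symmetric])
  finally show ?thesis unfolding cis_int_multiple cis_mu[OF assms(1)] by simp
qed

lemma mu_root_of:
  assumes "r < k"
  shows "mu (root_of z k r) = (mu z + of_nat r) / of_nat k"
  unfolding root_of_def
proof (rule mu_cis)
  have "mu z + of_nat r < of_nat k"
    using mu_bounds(2)[of z] assms by (simp add: less_eq_Suc_le[of r k, unfolded of_nat_le_iff[symmetric, where 'a = real]])
  then show "(mu z + of_nat r) / of_nat k < 1" using assms by simp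
qed (simp add: mu_bounds(1))

text \<open>The number r is recovered from the root itself, so index shifts can be written as
  functions of an eigenvalue label, without a numbering of the roots.\<close>

lemma floor_mu_root_of:
  assumes "r < k"
  shows "\<lfloor>of_nat k * mu (root_of z k r)\<rfloor> = int r"
proof -
  have "of_nat k * mu (root_of z k r) = mu z + of_nat r" using assms by (simp add: mu_root_of)
  then show ?thesis using mu_bounds[of z] by (simp add: floor_unique)
qed

lemma bij_betw_root_of:
  assumes z: "cmod z = 1" and k: "k > 0"
  shows "bij_betw (root_of z k) {..<k} {w. w ^ k = z}"
proof (rule bij_betw_imageI)
  show "inj_on (root_of z k) {..<k}"
    by (rule inj_onI) (metis floor_mu_root_of lessThan_iff of_nat_eq_iff)
  show "root_of z k ` {..<k} = {w. w ^ k = z}"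
  proof
    show "{w. w ^ k = z} \<subseteq> root_of z k ` {..<k}"
    proof
      fix w assume "w \<in> {w. w ^ k = z}"
      then have w: "w ^ k = z" by simp
      then have "cmod w ^ k = 1" using z by (simp flip: norm_power)
      then have nw: "cmod w = 1" using power_eq_imp_eq_base[of "cmod w" k 1] k by simp
      \<comment> \<open>The integer part of \<open>x\<close> is the number of the root, and its
        fractional part is \<open>mu z\<close>.\<close>
      define x where "x = of_nat k * mu w"
      define r where "r = nat \<lfloor>x\<rfloor>"
      have x: "0 \<le> x" "x < of_nat k" using mu_bounds[of w] k by (simp_all add: x_def)
      then have r: "r < k" "of_int (int r) \<le> x" "x < of_int (int r) + 1" by (simp_all add: r_def nat_less_iff floor_less_iff)
      have "z = cis (2 * pi * x)" unfolding w[symmetric] x_def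
        by (subst cis_mu[OF nw, symmetric]) (simp add: Complex.DeMoivre mult_ac)
      also have "\<dots> = cis (2 * pi * (x - of_int (int r)) + 2 * pi * of_int (int r))" by (simp add: algebra_simps)
      also have "\<dots> = cis (2 * pi * (x - of_int (int r)))"
        unfolding cis_mult[symmetric] cis_int_multiple by simp
      finally have "mu z = x - of_int (int r)" using mu_cis[of "x - of_int (int r)"] r by simp
      then have "root_of z k r = cis (2 * pi * mu w)" using k by (simp add: root_of_def x_def)
      then show "w \<in> root_of z k ` {..<k}" using r(1) cis_mu[OF nw] by auto
    qed
  qed (use root_of_pow[OF z k] in auto)
qed

text \<open>Residues modulo k correspond to the k-th roots of \<open>z\<close>, so the decomposition
  into sections becomes a sum over roots, each with its own fractional power of q.\<close>

lemma q_pow_qsum_roots: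
  assumes z: "cmod z = 1" and k: "k > 0" and f: "qs (h * of_nat k) f" and \<tau>: "\<tau> \<in> upper_half_plane"
  shows "q_pow (h * of_nat k) (mu z) \<tau> * qsum (h * of_nat k) f \<tau> =
    (\<Sum>w | w ^ k = z. q_pow h (mu w) \<tau> * qsum h (\<lambda>n. f (int k * n + \<lfloor>of_nat k * mu w\<rfloor>)) \<tau>)"
proof -
  have "(\<Sum>w | w ^ k = z. q_pow h (mu w) \<tau> * qsum h (\<lambda>n. f (int k * n + \<lfloor>of_nat k * mu w\<rfloor>)) \<tau>)
      = (\<Sum>r<k. q_pow h (mu (root_of z k r)) \<tau> *
          qsum h (\<lambda>n. f (int k * n + \<lfloor>of_nat k * mu (root_of z k r)\<rfloor>)) \<tau>)"
    by (rule sum.reindex_bij_betw[OF bij_betw_root_of[OF z k], symmetric])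
  also have "\<dots> = (\<Sum>r<k. q_pow (h * of_nat k) (mu z) \<tau> *
      (q_pow h (of_nat r / of_nat k) \<tau> * qsum h (\<lambda>n. f (int k * n + int r)) \<tau>))"
  proof (rule sum.cong[OF refl])
    fix r assume "r \<in> {..<k}"
    then show "q_pow h (mu (root_of z k r)) \<tau> * qsum h (\<lambda>n. f (int k * n + \<lfloor>of_nat k * mu (root_of z k r)\<rfloor>)) \<tau>
        = q_pow (h * of_nat k) (mu z) \<tau> * (q_pow h (of_nat r / of_nat k) \<tau> * qsum h (\<lambda>n. f (int k * n + int r)) \<tau>)"
      using k by (simp add: floor_mu_root_of) (simp add: mu_root_of add_divide_distrib q_pow_add q_pow_width_mult mult.assoc)
  qed
  finally show ?thesis using qsum_sections[OF f k \<tau>] by (simp add: sum_distrib_left)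
qed

section \<open>Block vectors\<close>

lemma block_index:
  assumes "p < d * (m :: nat)"
  shows "p div m < d" "p mod m < m"
  using assms by (auto simp: less_mult_imp_div_less intro!: mod_less_divisor intro: gr0I)

lemma block_index_less: "a < d \<Longrightarrow> l < m \<Longrightarrow> a * m + l < d * (m :: nat)"
proof -
  assume "a < d" "l < m"
  then have "a * m + l < Suc a * m" "Suc a * m \<le> d * m" by (simp, intro mult_right_mono) auto
  then show ?thesis by linarith
qed

lemma block_vec_carrier [simp]: "block_vec d m v \<in> carrier_vec (d * m)"
  by (simp add: block_vec_def)

lemma block_vec_index: "p < d * m \<Longrightarrow> block_vec d m v $ p = v (p div m) $ (p mod m)"
  by (simp add: block_vec_def)

lemma block_vec_cong: "(\<And>a. a < d \<Longrightarrow> v a = w a) \<Longrightarrow> block_vec d m v = block_vec d m w"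
  unfolding block_vec_def by (rule eq_vecI) (simp_all add: block_index)

lemma block_vec_zero: "block_vec d m (\<lambda>a. 0\<^sub>v m) = 0\<^sub>v (d * m)"
  by (rule eq_vecI) (auto simp: block_vec_def block_index)

lemma block_vec_smult:
  assumes "\<And>a. a < d \<Longrightarrow> v a \<in> carrier_vec m"
  shows "r \<cdot>\<^sub>v block_vec d m v = block_vec d m (\<lambda>a. r \<cdot>\<^sub>v v a)"
proof (rule eq_vecI)
  fix p assume "p < dim_vec (block_vec d m (\<lambda>a. r \<cdot>\<^sub>v v a))"
  then have p: "p < d * m" by (simp add: block_vec_def)
  with block_index[OF p] carrier_vecD[OF assms[OF block_index(1)[OF p]]] show "(r \<cdot>\<^sub>v block_vec d m v) $ p = block_vec d m (\<lambda>a. r \<cdot>\<^sub>v v a) $ p"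
    by (simp add: block_vec_def carrier_vecD)
qed (simp add: block_vec_def)

lemma block_vec_add:
  assumes "\<And>a. a < d \<Longrightarrow> v a \<in> carrier_vec m" "\<And>a. a < d \<Longrightarrow> w a \<in> carrier_vec m"
  shows "block_vec d m v + block_vec d m w = block_vec d m (\<lambda>a. v a + w a)"
proof (rule eq_vecI)
  fix p assume "p < dim_vec (block_vec d m (\<lambda>a. v a + w a))"
  then have p: "p < d * m" by (simp add: block_vec_def)
  with block_index[OF p] carrier_vecD[OF assms(1)[OF block_index(1)[OF p]]]
    carrier_vecD[OF assms(2)[OF block_index(1)[OF p]]] show "(block_vec d m v + block_vec d m w) $ p = block_vec d m (\<lambda>a. v a + w a) $ p"
    by (simp add: block_vec_def carrier_vecD)
qed (simp add: block_vec_def)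

lemma sum_blocks:
  fixes d m :: nat and g :: "nat \<Rightarrow> nat \<Rightarrow> complex"
  shows "(\<Sum>p<d * m. g (p div m) (p mod m)) = (\<Sum>a<d. \<Sum>l<m. g a l)"
proof (cases "m = 0")
  case False
  have "(\<Sum>p<d * m. g (p div m) (p mod m)) = (\<Sum>a<d. \<Sum>p = a * m..<a * m + m. g (p div m) (p mod m))"
    by (rule sum.nat_group[symmetric])
  also have "\<dots> = (\<Sum>a<d. \<Sum>l<m. g a l)"
  proof (rule sum.cong[OF refl])
    fix a
    have "(\<Sum>p = a * m..<a * m + m. g (p div m) (p mod m)) = (\<Sum>l = 0..<m. g ((l + a * m) div m) ((l + a * m) mod m))"
      using sum.shift_bounds_nat_ivl[of "\<lambda>p. g (p div m) (p mod m)" 0 "a * m" m] by (simp add: add.commute)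
    also have "\<dots> = (\<Sum>l<m. g a l)" using False by (intro sum.cong) auto
    finally show "(\<Sum>p = a * m..<a * m + m. g (p div m) (p mod m)) = (\<Sum>l<m. g a l)" .
  qed
  finally show ?thesis .
qed simp

section \<open>The logarithmic expansion of a lift\<close>

lemma finite_eigenvalues:
  assumes "T \<in> carrier_mat n n"
  shows "finite {z. eigenvalue (T :: complex Matrix.mat) z}"
proof -
  have "char_poly T \<noteq> 0" using degree_monic_char_poly[OF assms] by auto
  then show ?thesis unfolding eigenvalue_root_char_poly[OF assms] by (rule poly_roots_finite)
qed

text \<open>Every eigenvalue of \<open>S i\<close> is replaced by its roots, which turns the
  expansion of a block into a sum over labels of \<open>T\<close>. The assumption \<open>js\<close>
  guarantees that these labels are allowed in an expansion for \<open>T\<close>; a label that does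
  not occur for a block gets the factor 0 from \<open>rs\<close>.\<close>

lemma log_exp_lift:
  fixes S :: "nat \<Rightarrow> complex Matrix.mat" and kk :: "nat \<Rightarrow> nat"
    and rs :: "nat \<Rightarrow> complex \<Rightarrow> nat \<Rightarrow> rat"
  assumes kk: "\<And>i. i < d \<Longrightarrow> kk i > 0"
    and b: "\<And>i. i < d \<Longrightarrow> log_exp m (h * of_nat (kk i)) (S i) (F i) (b i)"
    and S: "\<And>i. i < d \<Longrightarrow> S i \<in> carrier_mat m m"
    and unit: "\<And>i z. i < d \<Longrightarrow> eigenvalue (S i) z \<Longrightarrow> cmod z = 1"
    and T: "T \<in> carrier_mat (d * m) (d * m)"
    and js: "\<And>i z. i < d \<Longrightarrow> eigenvalue (S i) (z ^ kk i) \<Longrightarrow>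
      eigenvalue T z \<and> jordan_size (S i) (z ^ kk i) \<le> jordan_size T z"
    and X: "\<And>\<tau>. \<tau> \<in> upper_half_plane \<Longrightarrow> X \<tau> = block_vec d m (\<lambda>i. F i \<tau>)"
    and ev: "\<And>i z j. eigenvalue (S i) (z ^ kk i) \<Longrightarrow> ev i z j = z ^ kk i"
    and rs: "\<And>i z j. rs i z j = (if eigenvalue (S i) (z ^ kk i) then (1 / of_nat (kk i)) ^ j else 0)"
  defines "a \<equiv> \<lambda>z j n. if eigenvalue T z \<and> j < jordan_size T z
      then block_vec d m (\<lambda>i. of_rat (rs i z j) \<cdot>\<^sub>v b i (ev i z j) j (int (kk i) * n + \<lfloor>of_nat (kk i) * mu z\<rfloor>))
      else 0\<^sub>v (d * m)"
  shows "log_exp (d * m) h T X a"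
proof -
  have bc: "b i z j n \<in> carrier_vec m" and bq: "l < m \<Longrightarrow> qs (h * of_nat (kk i)) (\<lambda>n. b i z j n $ l)"
    and b0: "\<not> (eigenvalue (S i) z \<and> j < jordan_size (S i) z) \<Longrightarrow> b i z j n = 0\<^sub>v m"
    and bX: "\<tau> \<in> upper_half_plane \<Longrightarrow> l < m \<Longrightarrow> F i \<tau> $ l = (\<Sum>z\<in>{z. eigenvalue (S i) z}. \<Sum>j<jordan_size (S i) z.
       log_q (h * of_nat (kk i)) \<tau> ^ j * q_pow (h * of_nat (kk i)) (mu z) \<tau> * qsum (h * of_nat (kk i)) (\<lambda>n. b i z j n $ l) \<tau>)"
    if "i < d" for i z j n l \<tau>
    using b[OF that] by (simp_all add: log_exp_def)
  have a_index: "a z j n $ p = of_rat (rs (p div m) z j) *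
      b (p div m) (ev (p div m) z j) j (int (kk (p div m)) * n + \<lfloor>of_nat (kk (p div m)) * mu z\<rfloor>) $ (p mod m)"
    if "p < d * m" "eigenvalue T z" "j < jordan_size T z" for z j n p
    using that block_index[OF that(1)]
    by (simp add: a_def block_vec_index carrier_vecD[OF bc[OF block_index(1)[OF that(1)]]])
  show ?thesis unfolding log_exp_def
  proof (intro conjI allI impI ballI)
    show "a z j n \<in> carrier_vec (d * m)" for z j n by (simp add: a_def)
    show "a z j n = 0\<^sub>v (d * m)" if "\<not> (eigenvalue T z \<and> j < jordan_size T z)" for z j n
      using that by (auto simp: a_def)
    show "qs h (\<lambda>n. a z j n $ p)" if p: "p < d * m" for z j p
    proof (cases "eigenvalue T z \<and> j < jordan_size T z")
      case True
      then show ?thesis using p block_index[OF p]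
        by (simp add: a_index) (intro qs_cmult qs_section[OF bq kk])
    next
      case False
      have "(\<lambda>n. a z j n $ p) = (\<lambda>n. 0)" using False p by (auto simp: a_def)
      then show ?thesis by simp
    qed
    fix \<tau> assume \<tau>: "\<tau> \<in> upper_half_plane"
    show "X \<tau> \<in> carrier_vec (d * m)" by (simp add: X[OF \<tau>])
    fix p assume p: "p < d * m"
    define i where "i = p div m"
    define l where "l = p mod m"
    have i: "i < d" and l: "l < m" using block_index[OF p] by (simp_all add: i_def l_def)
    let ?k = "kk i"
    \<comment> \<open>The contribution of the label (z, j) to block i; the width h k divides the
      logarithm by k, whence the factor k^(-j).\<close>
    define G where "G z j = (log_q h \<tau> / of_nat ?k) ^ j * (q_pow h (mu z) \<tau> *
        qsum h (\<lambda>n. b i (z ^ ?k) j (int ?k * n + \<lfloor>of_nat ?k * mu z\<rfloor>) $ l) \<tau>)" for z j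
    define Z where "Z = {z. eigenvalue (S i) (z ^ ?k)}"
    have ZT: "Z \<subseteq> {z. eigenvalue T z}" using js[OF i] by (auto simp: Z_def)
    have finZ: "finite Z" using finite_subset[OF ZT finite_eigenvalues[OF T]] .
    have "X \<tau> $ p = F i \<tau> $ l" using p by (simp add: X[OF \<tau>] block_vec_index i_def l_def)
    \<comment> \<open>The roots are grouped by their k-th power y, so that \<open>sum.group\<close>
      afterwards merges both sums into one over \<open>Z\<close>.\<close>
    also have "\<dots> = (\<Sum>y\<in>{y. eigenvalue (S i) y}. \<Sum>z\<in>{z\<in>Z. z ^ ?k = y}. \<Sum>j<jordan_size (S i) (z ^ ?k). G z j)"
      unfolding bX[OF i \<tau> l]
    proof (rule sum.cong[OF refl])
      fix y assume "y \<in> {y. eigenvalue (S i) y}"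
      then have y: "eigenvalue (S i) y" by simp
      have Zy: "{z\<in>Z. z ^ ?k = y} = {z. z ^ ?k = y}" using y by (auto simp: Z_def)
      have "(\<Sum>j<jordan_size (S i) y. log_q (h * of_nat ?k) \<tau> ^ j * q_pow (h * of_nat ?k) (mu y) \<tau> * qsum (h * of_nat ?k) (\<lambda>n. b i y j n $ l) \<tau>)
          = (\<Sum>j<jordan_size (S i) y. \<Sum>z | z ^ ?k = y. G z j)"
      proof (rule sum.cong[OF refl])
        fix j
        have "log_q (h * of_nat ?k) \<tau> = log_q h \<tau> / of_nat ?k" by (simp add: log_q_def)
        then have "log_q (h * of_nat ?k) \<tau> ^ j * q_pow (h * of_nat ?k) (mu y) \<tau> * qsum (h * of_nat ?k) (\<lambda>n. b i y j n $ l) \<tau>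
            = (log_q h \<tau> / of_nat ?k) ^ j * (\<Sum>z | z ^ ?k = y. q_pow h (mu z) \<tau> * qsum h (\<lambda>n. b i y j (int ?k * n + \<lfloor>of_nat ?k * mu z\<rfloor>) $ l) \<tau>)"
          using q_pow_qsum_roots[OF unit[OF i y] kk[OF i] bq[OF i l] \<tau>] by (simp add: mult.assoc)
        also have "\<dots> = (\<Sum>z | z ^ ?k = y. G z j)"
          unfolding sum_distrib_left by (rule sum.cong) (auto simp: G_def)
        finally show "log_q (h * of_nat ?k) \<tau> ^ j * q_pow (h * of_nat ?k) (mu y) \<tau> * qsum (h * of_nat ?k) (\<lambda>n. b i y j n $ l) \<tau>
            = (\<Sum>z | z ^ ?k = y. G z j)" .
      qed
      also have "\<dots> = (\<Sum>z | z ^ ?k = y. \<Sum>j<jordan_size (S i) y. G z j)" by (rule sum.swap)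
      also have "\<dots> = (\<Sum>z\<in>{z\<in>Z. z ^ ?k = y}. \<Sum>j<jordan_size (S i) (z ^ ?k). G z j)"
        unfolding Zy by (rule sum.cong) auto
      finally show "(\<Sum>j<jordan_size (S i) y. log_q (h * of_nat ?k) \<tau> ^ j * q_pow (h * of_nat ?k) (mu y) \<tau> * qsum (h * of_nat ?k) (\<lambda>n. b i y j n $ l) \<tau>)
          = (\<Sum>z\<in>{z\<in>Z. z ^ ?k = y}. \<Sum>j<jordan_size (S i) (z ^ ?k). G z j)" .
    qed
    also have "\<dots> = (\<Sum>z\<in>Z. \<Sum>j<jordan_size (S i) (z ^ ?k). G z j)"
      by (rule sum.group[OF finZ finite_eigenvalues[OF S[OF i]]]) (auto simp: Z_def)
    \<comment> \<open>Powers of the logarithm beyond the Jordan size of \<open>S i\<close> have zero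
      coefficients, so the range can be enlarged to that of \<open>T\<close>.\<close>
    also have "\<dots> = (\<Sum>z\<in>Z. \<Sum>j<jordan_size T z. G z j)"
    proof (rule sum.cong[OF refl])
      fix z assume "z \<in> Z"
      then have z: "jordan_size (S i) (z ^ ?k) \<le> jordan_size T z" using js[OF i] by (simp add: Z_def)
      have "G z j = 0" if "\<not> j < jordan_size (S i) (z ^ ?k)" for j
        using b0[OF i, of "z ^ ?k" j] that l by (simp add: G_def)
      then show "(\<Sum>j<jordan_size (S i) (z ^ ?k). G z j) = (\<Sum>j<jordan_size T z. G z j)"
        using z by (intro sum.mono_neutral_left) auto
    qed
    \<comment> \<open>The eigenvalues of \<open>T\<close> outside \<open>Z\<close> are added; the
      factor \<open>rs\<close> vanishes there.\<close>
    also have "\<dots> = (\<Sum>z\<in>{z. eigenvalue T z}. \<Sum>j<jordan_size T z. log_q h \<tau> ^ j * q_pow h (mu z) \<tau> * qsum h (\<lambda>n. a z j n $ p) \<tau>)"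
    proof (rule sum.mono_neutral_cong_left[OF finite_eigenvalues[OF T] ZT])
      show "\<forall>z\<in>{z. eigenvalue T z} - Z. (\<Sum>j<jordan_size T z. log_q h \<tau> ^ j * q_pow h (mu z) \<tau> * qsum h (\<lambda>n. a z j n $ p) \<tau>) = 0"
      proof
        fix z assume "z \<in> {z. eigenvalue T z} - Z"
        then show "(\<Sum>j<jordan_size T z. log_q h \<tau> ^ j * q_pow h (mu z) \<tau> * qsum h (\<lambda>n. a z j n $ p) \<tau>) = 0"
          using p by (intro sum.neutral) (auto simp: a_index rs Z_def i_def[symmetric])
      qed
      fix z assume z: "z \<in> Z"
      then have zT: "eigenvalue T z" and zS: "eigenvalue (S i) (z ^ ?k)" using ZT by (auto simp: Z_def)
      show "(\<Sum>j<jordan_size T z. G z j) = (\<Sum>j<jordan_size T z. log_q h \<tau> ^ j * q_pow h (mu z) \<tau> * qsum h (\<lambda>n. a z j n $ p) \<tau>)"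
      proof (rule sum.cong[OF refl])
        fix j assume "j \<in> {..<jordan_size T z}"
        then have "(\<lambda>n. a z j n $ p) = (\<lambda>n. of_rat ((1 / of_nat ?k) ^ j) * b i (z ^ ?k) j (int ?k * n + \<lfloor>of_nat ?k * mu z\<rfloor>) $ l)"
          using p zT zS by (auto simp: a_index rs ev i_def[symmetric] l_def[symmetric])
        moreover have "of_rat ((1 / of_nat ?k) ^ j) = (1 / of_nat ?k :: complex) ^ j"
          by (simp add: of_rat_power of_rat_divide)
        ultimately have e: "(\<lambda>n. a z j n $ p) = (\<lambda>n. (1 / of_nat ?k) ^ j *
            b i (z ^ ?k) j (int ?k * n + \<lfloor>of_nat ?k * mu z\<rfloor>) $ l)" by (simp only:)
        show "G z j = log_q h \<tau> ^ j * q_pow h (mu z) \<tau> * qsum h (\<lambda>n. a z j n $ p) \<tau>"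
          unfolding e qsum_cmult G_def by (simp add: power_divide)
      qed
    qed
    finally show "X \<tau> $ p = (\<Sum>z\<in>{z. eigenvalue T z}. \<Sum>j<jordan_size T z. log_q h \<tau> ^ j * q_pow h (mu z) \<tau> * qsum h (\<lambda>n. a z j n $ p) \<tau>)" .
  qed
qed

section \<open>Cyclic block matrices\<close>

lemma block_mat_mult_vec:
  assumes A: "A \<in> carrier_mat (d * m) (d * m)" and v: "\<And>b. b < d \<Longrightarrow> v b \<in> carrier_vec m"
    and a: "a < d" and l: "l < m"
  shows "(A *\<^sub>v block_vec d m v) $ (a * m + l) = (\<Sum>b<d. \<Sum>s<m. A $$ (a * m + l, b * m + s) * v b $ s)"
proof -
  have "(A *\<^sub>v block_vec d m v) $ (a * m + l) = (\<Sum>p<d * m. A $$ (a * m + l, p) * block_vec d m v $ p)"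
    by (rule mult_mat_vec_index[OF A block_vec_carrier block_index_less[OF a l]])
  also have "\<dots> = (\<Sum>p<d * m. A $$ (a * m + l, p div m * m + p mod m) * v (p div m) $ (p mod m))"
    by (rule sum.cong) (simp_all add: block_vec_index)
  also have "\<dots> = (\<Sum>b<d. \<Sum>s<m. A $$ (a * m + l, b * m + s) * v b $ s)"
    by (rule sum_blocks)
  finally show ?thesis .
qed

lemma block_mat_mult_index:
  assumes A: "A \<in> carrier_mat (d * m) (d * m)" and B: "B \<in> carrier_mat (d * m) (d * m)"
    and "a < d" "l < m" "c < d" "t < m"
  shows "(A * B) $$ (a * m + l, c * m + t) =
    (\<Sum>b<d. \<Sum>s<m. A $$ (a * m + l, b * m + s) * (B $$ (b * m + s, c * m + t) :: complex))"
proof -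
  have "(A * B) $$ (a * m + l, c * m + t) = (\<Sum>p<d * m. A $$ (a * m + l, p) * B $$ (p, c * m + t))"
    by (rule mult_mat_index[OF A B]) (use assms in \<open>simp_all add: block_index_less\<close>)
  also have "\<dots> = (\<Sum>p<d * m. A $$ (a * m + l, p div m * m + p mod m) * B $$ (p div m * m + p mod m, c * m + t))"
    by simp
  also have "\<dots> = (\<Sum>b<d. \<Sum>s<m. A $$ (a * m + l, b * m + s) * B $$ (b * m + s, c * m + t))"
    by (rule sum_blocks)
  finally show ?thesis .
qed

lemma block_vec_eqI:
  assumes "v \<in> carrier_vec (d * m)"
    and "\<And>a l. a < d \<Longrightarrow> l < m \<Longrightarrow> v $ (a * m + l) = w a $ l"
  shows "v = block_vec d m w"
proof (rule eq_vecI)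
  fix p assume "p < dim_vec (block_vec d m w)"
  then have p: "p < d * m" by (simp add: block_vec_def)
  show "v $ p = block_vec d m w $ p"
    using assms(2)[OF block_index[OF p]] p by (simp add: block_vec_index)
qed (use assms(1) in \<open>simp add: block_vec_def\<close>)

lemma block_vec_nth: "a < d \<Longrightarrow> l < m \<Longrightarrow> block_vec d m w $ (a * m + l) = w a $ l"
  by (simp add: block_vec_index block_index_less)

lemma block_mat_eqI:
  assumes "A \<in> carrier_mat (d * m) (d * m)" "B \<in> carrier_mat (d * m) (d * m)"
    and "\<And>a l c t. a < d \<Longrightarrow> l < m \<Longrightarrow> c < d \<Longrightarrow> t < m \<Longrightarrow>
      A $$ (a * m + l, c * m + t) = B $$ (a * m + l, c * m + t)"
  shows "A = B"
proof (rule eq_matI)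
  fix p q assume "p < dim_row B" "q < dim_col B"
  then have p: "p < d * m" and q: "q < d * m" using assms(2) by auto
  show "A $$ (p, q) = B $$ (p, q)" using assms(3)[OF block_index[OF p] block_index[OF q]] by simp
qed (use assms in auto)

lemma smult_zero_vector [simp]: "c \<cdot>\<^sub>v 0\<^sub>v m = (0\<^sub>v m :: complex Matrix.vec)"
  by (rule eq_vecI) auto

text \<open>
  The blocks are arranged in cycles: block \<open>a\<close> lies in the cycle \<open>cl a\<close> of length \<open>kk (cl a)\<close>,
  at position \<open>ps a\<close>. The matrix \<open>T\<close> moves every block to the next position of its cycle and
  applies \<open>S (cl a)\<close> when it passes from the last to the first one.
\<close>

locale block_cycles =
  fixes d m :: nat and cl ps kk :: "nat \<Rightarrow> nat"
    and S :: "nat \<Rightarrow> complex Matrix.mat" and T :: "complex Matrix.mat"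
  assumes ps: "\<And>a. a < d \<Longrightarrow> ps a < kk (cl a)"
    and ex: "\<And>a j. a < d \<Longrightarrow> j < kk (cl a) \<Longrightarrow> \<exists>b<d. cl b = cl a \<and> ps b = j"
    and inj: "\<And>a b. a < d \<Longrightarrow> b < d \<Longrightarrow> cl a = cl b \<Longrightarrow> ps a = ps b \<Longrightarrow> a = b"
    and S: "\<And>a. a < d \<Longrightarrow> S (cl a) \<in> carrier_mat m m"
    and T: "T \<in> carrier_mat (d * m) (d * m)"
    and T_index: "\<And>a b l s. a < d \<Longrightarrow> b < d \<Longrightarrow> l < m \<Longrightarrow> s < m \<Longrightarrow> T $$ (a * m + l, b * m + s) =
      (if cl a = cl b \<and> ps a = Suc (ps b) mod kk (cl b)
       then (if ps a = 0 then S (cl a) else 1\<^sub>m m) $$ (l, s) else 0)"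
    and unit: "\<And>a z. a < d \<Longrightarrow> eigenvalue (S (cl a)) z \<Longrightarrow> cmod z = 1"
begin

definition pos :: "nat \<Rightarrow> nat \<Rightarrow> nat" where
  "pos a j = (SOME b. b < d \<and> cl b = cl a \<and> ps b = j)"

text \<open>The predecessor in the cycle, whose column block is the only one that row block a of
  \<open>T\<close> meets.\<close>

definition prv :: "nat \<Rightarrow> nat" where
  "prv a = pos a (if ps a = 0 then kk (cl a) - 1 else ps a - 1)"

abbreviation M :: "nat \<Rightarrow> complex Matrix.mat" where
  "M a \<equiv> if ps a = 0 then S (cl a) else 1\<^sub>m m"

lemma pos: "a < d \<Longrightarrow> j < kk (cl a) \<Longrightarrow> pos a j < d \<and> cl (pos a j) = cl a \<and> ps (pos a j) = j"
  unfolding pos_def by (rule someI_ex) (use ex in blast)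

lemma prv:
  assumes "a < d"
  shows "prv a < d" "cl (prv a) = cl a" "ps (prv a) = (if ps a = 0 then kk (cl a) - 1 else ps a - 1)"
  using pos[OF assms, of "if ps a = 0 then kk (cl a) - 1 else ps a - 1"] ps[OF assms]
  by (auto simp: prv_def)

lemma next_iff:
  assumes a: "a < d" and b: "b < d"
  shows "cl a = cl b \<and> ps a = Suc (ps b) mod kk (cl b) \<longleftrightarrow> b = prv a"
proof
  assume *: "cl a = cl b \<and> ps a = Suc (ps b) mod kk (cl b)"
  have "ps b = (if ps a = 0 then kk (cl a) - 1 else ps a - 1)"
  proof (cases "Suc (ps b) = kk (cl b)")
    case True
    then show ?thesis using * by simp
  next
    case False
    then have "Suc (ps b) < kk (cl b)" using ps[OF b] by simp
    then show ?thesis using * by simp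
  qed
  then show "b = prv a" using prv[OF a] * by (intro inj[OF b prv(1)[OF a]]) auto
next
  assume b': "b = prv a"
  show "cl a = cl b \<and> ps a = Suc (ps b) mod kk (cl b)"
    using prv[OF a] ps[OF a] by (auto simp: b')
qed

lemma M: "a < d \<Longrightarrow> M a \<in> carrier_mat m m"
  using S by auto

lemma T_row:
  assumes a: "a < d" and l: "l < m"
  shows "(\<Sum>b<d. \<Sum>s<m. T $$ (a * m + l, b * m + s) * f b s) = (\<Sum>s<m. M a $$ (l, s) * f (prv a) s)"
proof -
  have "(\<Sum>b<d. \<Sum>s<m. T $$ (a * m + l, b * m + s) * f b s)
      = (\<Sum>b<d. if b = prv a then \<Sum>s<m. M a $$ (l, s) * f (prv a) s else 0)"
    by (rule sum.cong[OF refl]) (auto simp: T_index[OF a _ l] next_iff[OF a] intro!: sum.cong)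
  also have "\<dots> = (\<Sum>s<m. M a $$ (l, s) * f (prv a) s)" using prv(1)[OF a] by (simp add: sum.delta)
  finally show ?thesis .
qed

lemma T_action:
  assumes v: "\<And>b. b < d \<Longrightarrow> v b \<in> carrier_vec m"
  shows "T *\<^sub>v block_vec d m v = block_vec d m (\<lambda>a. M a *\<^sub>v v (prv a))"
proof (rule block_vec_eqI)
  show "T *\<^sub>v block_vec d m v \<in> carrier_vec (d * m)" by (rule mult_mat_vec_carrier[OF T]) simp
  fix a l assume a: "a < d" and l: "l < m"
  have "(T *\<^sub>v block_vec d m v) $ (a * m + l) = (\<Sum>b<d. \<Sum>s<m. T $$ (a * m + l, b * m + s) * v b $ s)"
    by (rule block_mat_mult_vec[OF T v a l])
  also have "\<dots> = (\<Sum>s<m. M a $$ (l, s) * v (prv a) $ s)" by (rule T_row[OF a l])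
  also have "\<dots> = (M a *\<^sub>v v (prv a)) $ l"
    by (rule mult_mat_vec_index[OF M[OF a] v[OF prv(1)[OF a]] l, symmetric])
  finally show "(T *\<^sub>v block_vec d m v) $ (a * m + l) = (M a *\<^sub>v v (prv a)) $ l" .
qed

text \<open>A vector supported on a single block. \<open>T\<close> moves such vectors around their
  cycle, which reduces powers of \<open>T\<close> to counting positions.\<close>

definition blk :: "nat \<Rightarrow> complex Matrix.vec \<Rightarrow> complex Matrix.vec" where
  "blk b x = block_vec d m (\<lambda>a. if a = b then x else 0\<^sub>v m)"

lemma T_blk:
  assumes a: "a < d" and x: "x \<in> carrier_vec m"
  shows "T *\<^sub>v blk (prv a) x = blk a (M a *\<^sub>v x)"
  unfolding blk_def
proof (subst T_action)
  show "block_vec d m (\<lambda>c. M c *\<^sub>v (if prv c = prv a then x else 0\<^sub>v m))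
      = block_vec d m (\<lambda>c. if c = a then M a *\<^sub>v x else 0\<^sub>v m)"
  proof (rule block_vec_cong)
    fix c assume c: "c < d"
    have "prv c = prv a \<longleftrightarrow> c = a"
    proof
      assume "prv c = prv a"
      then have "cl c = cl (prv a) \<and> ps c = Suc (ps (prv a)) mod kk (cl (prv a))"
        using next_iff[OF c prv(1)[OF a]] by simp
      moreover have "cl a = cl (prv a) \<and> ps a = Suc (ps (prv a)) mod kk (cl (prv a))"
        using next_iff[OF a prv(1)[OF a]] by simp
      ultimately show "c = a" by (intro inj[OF c a]) auto
    qed simp
    moreover have "M c *\<^sub>v 0\<^sub>v m = 0\<^sub>v m" using M[OF c] by (intro eq_vecI) (auto simp: scalar_prod_def)
    ultimately show "M c *\<^sub>v (if prv c = prv a then x else 0\<^sub>v m) = (if c = a then M a *\<^sub>v x else 0\<^sub>v m)" by simp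
  qed
qed (use x in auto)

lemma blk_carrier: "blk b x \<in> carrier_vec (d * m)"
  by (simp add: blk_def)

lemma T_pow_blk:
  assumes a: "a < d" and x: "x \<in> carrier_vec m" and j: "j < kk (cl a)"
  shows "T ^\<^sub>m j *\<^sub>v blk (pos a 0) x = blk (pos a j) x"
  using j
proof (induction j)
  case 0
  then show ?case using T blk_carrier[of "pos a 0" x] by simp
next
  case (Suc j)
  have "j < kk (cl a)" using Suc.prems by simp
  note p = pos[OF a this] pos[OF a Suc.prems]
  then have pd: "pos a (Suc j) < d" by blast
  have e: "prv (pos a (Suc j)) = pos a j"
    by (rule inj[OF prv(1)[OF pd]]) (simp_all add: prv[OF pd] p)
  have "T ^\<^sub>m Suc j *\<^sub>v blk (pos a 0) x = T *\<^sub>v (T ^\<^sub>m j *\<^sub>v blk (pos a 0) x)"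
    unfolding pow_mat_Suc_left[OF T] by (rule assoc_mult_mat_vec[OF T pow_carrier_mat[OF T] blk_carrier])
  also have "\<dots> = T *\<^sub>v blk (prv (pos a (Suc j))) x" using Suc by (simp add: e)
  also have "\<dots> = blk (pos a (Suc j)) (M (pos a (Suc j)) *\<^sub>v x)"
    by (rule T_blk[OF pd x])
  finally show ?case using p x by simp
qed

text \<open>A full turn passes the end of the cycle exactly once, so \<open>S\<close> is applied
  exactly once. This is the intertwining relation required by
  \<open>jordan_size_root\<close>.\<close>

lemma T_pow_cycle:
  assumes a: "a < d" and x: "x \<in> carrier_vec m"
  shows "T ^\<^sub>m kk (cl a) *\<^sub>v blk (pos a 0) x = blk (pos a 0) (S (cl a) *\<^sub>v x)"
proof -
  obtain k where k: "kk (cl a) = Suc k" using ps[OF a] by (cases "kk (cl a)") auto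
  have p: "pos a 0 < d" "cl (pos a 0) = cl a" "ps (pos a 0) = 0" using pos[OF a, of 0] k by auto
  have q: "pos a k < d" "cl (pos a k) = cl a" "ps (pos a k) = k" using pos[OF a, of k] k by auto
  have e: "prv (pos a 0) = pos a k" by (rule inj[OF prv(1)[OF p(1)]]) (simp_all add: prv[OF p(1)] p q k)
  have "T ^\<^sub>m Suc k *\<^sub>v blk (pos a 0) x = T *\<^sub>v (T ^\<^sub>m k *\<^sub>v blk (pos a 0) x)"
    unfolding pow_mat_Suc_left[OF T] by (rule assoc_mult_mat_vec[OF T pow_carrier_mat[OF T] blk_carrier])
  also have "\<dots> = T *\<^sub>v blk (prv (pos a 0)) x" using T_pow_blk[OF a x, of k] k by (simp add: e)
  also have "\<dots> = blk (pos a 0) (M (pos a 0) *\<^sub>v x)" by (rule T_blk[OF p(1) x])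
  finally show ?thesis using p k by simp
qed

text \<open>The summand with the i-th power of \<open>T\<close> lands in position i, so the summands
  occupy distinct blocks and cannot cancel. For the whole cycle this gives the nonvanishing required
  by \<open>jordan_size_root\<close>.\<close>

lemma geometric_blk:
  assumes a: "a < d" and x: "x \<in> carrier_vec m" and j: "j \<le> kk (cl a)"
  shows "geometric_mat T z j *\<^sub>v blk (pos a 0) x =
    block_vec d m (\<lambda>b. if cl b = cl a \<and> ps b < j then z ^ (j - 1 - ps b) \<cdot>\<^sub>v x else 0\<^sub>v m)"
  using j
proof (induction j)
  case 0
  have "0\<^sub>m (d * m) (d * m) *\<^sub>v blk (pos a 0) x = 0\<^sub>v (d * m)"
    using blk_carrier[of "pos a 0" x] by (intro eq_vecI) (auto simp: scalar_prod_def)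
  then show ?case using T by (simp add: block_vec_zero)
next
  case (Suc j)
  let ?w = "\<lambda>j b. if cl b = cl a \<and> ps b < j then z ^ (j - 1 - ps b) \<cdot>\<^sub>v x else 0\<^sub>v m"
  let ?e = "blk (pos a 0) x"
  have p: "pos a 0 < d" "cl (pos a 0) = cl a" "ps (pos a 0) = 0" using pos[OF a, of 0] Suc.prems by auto
  have w: "?w j b \<in> carrier_vec m" for j b using x by auto
  have G: "geometric_mat T z j \<in> carrier_mat (d * m) (d * m)" by (rule geometric_mat_carrier[OF T])
  have "geometric_mat T z (Suc j) *\<^sub>v ?e = (T * geometric_mat T z j + z ^ j \<cdot>\<^sub>m 1\<^sub>m (d * m)) *\<^sub>v ?e"
    using T by simp
  also have "\<dots> = T * geometric_mat T z j *\<^sub>v ?e + (z ^ j \<cdot>\<^sub>m 1\<^sub>m (d * m)) *\<^sub>v ?e"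
    by (rule add_mult_distrib_mat_vec[OF mult_carrier_mat[OF T G] _ blk_carrier]) simp
  also have "T * geometric_mat T z j *\<^sub>v ?e = T *\<^sub>v block_vec d m (?w j)"
    using assoc_mult_mat_vec[OF T G blk_carrier] Suc by simp
  also have "\<dots> = block_vec d m (\<lambda>b. M b *\<^sub>v ?w j (prv b))" by (rule T_action[OF w])
  also have "(z ^ j \<cdot>\<^sub>m 1\<^sub>m (d * m)) *\<^sub>v ?e = z ^ j \<cdot>\<^sub>v ?e"
    using blk_carrier[of "pos a 0" x] by (intro eq_vecI) auto
  also have "\<dots> = block_vec d m (\<lambda>b. z ^ j \<cdot>\<^sub>v (if b = pos a 0 then x else 0\<^sub>v m))"
    unfolding blk_def by (rule block_vec_smult) (use x in auto)
  also have "block_vec d m (\<lambda>b. M b *\<^sub>v ?w j (prv b)) + \<dots>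
      = block_vec d m (\<lambda>b. M b *\<^sub>v ?w j (prv b) + z ^ j \<cdot>\<^sub>v (if b = pos a 0 then x else 0\<^sub>v m))"
    by (rule block_vec_add) (use x mult_mat_vec_carrier[OF M w] in auto)
  also have "\<dots> = block_vec d m (?w (Suc j))"
  proof (rule block_vec_cong)
    fix b assume b: "b < d"
    note pb = prv[OF b]
    have z0: "M b *\<^sub>v 0\<^sub>v m = 0\<^sub>v m" using M[OF b] by (intro eq_vecI) (auto simp: scalar_prod_def)
    show "M b *\<^sub>v ?w j (prv b) + z ^ j \<cdot>\<^sub>v (if b = pos a 0 then x else 0\<^sub>v m) = ?w (Suc j) b"
    proof (cases "cl b = cl a")
      case False
      then have "b \<noteq> pos a 0" using p by auto
      then show ?thesis using False pb z0 by simp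
    next
      case cl: True
      show ?thesis
      proof (cases "ps b = 0")
        case True
        then have "b = pos a 0" using cl p b by - (rule inj, auto)
        \<comment> \<open>Since j is still below the length of the cycle, its last position is empty
          and nothing passes through \<open>S\<close>.\<close>
        moreover have "?w j (prv b) = 0\<^sub>v m" using True pb cl Suc.prems by auto
        ultimately show ?thesis using True cl z0 x p by simp
      next
        case False
        then have "b \<noteq> pos a 0" using p by auto
        moreover have "ps b - 1 < j \<longleftrightarrow> ps b < Suc j" "j - 1 - (ps b - 1) = Suc j - 1 - ps b" using False by auto
        ultimately show ?thesis using False cl pb x by auto
      qed
    qed
  qed
  finally show ?case .
qed

lemma cycle_jordan:
  assumes a: "a < d" and ev: "eigenvalue (S (cl a)) (z ^ kk (cl a))"
  shows "jordan_size (S (cl a)) (z ^ kk (cl a)) \<le> jordan_size T z" "eigenvalue T z"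
proof -
  let ?k = "kk (cl a)" and ?e = "blk (pos a 0)"
  have k: "?k > 0" using ps[OF a] by simp
  have p: "pos a 0 < d" "cl (pos a 0) = cl a" "ps (pos a 0) = 0" using pos[OF a k] by auto
  \<comment> \<open>Roots of unitary eigenvalues are nonzero, so the power of \<open>z\<close> in
    \<open>geometric_blk\<close> does not vanish.\<close>
  have z: "z \<noteq> 0" using unit[OF a ev] k by (auto simp: power_0_left)
  have e0: "?e (0\<^sub>v m) = 0\<^sub>v (d * m)"
    unfolding blk_def block_vec_zero[symmetric] by (rule block_vec_cong) simp
  have lin: "?e (x + c \<cdot>\<^sub>v y) = ?e x + c \<cdot>\<^sub>v ?e y" if "x \<in> carrier_vec m" "y \<in> carrier_vec m" for x y c
    unfolding blk_def using that
    by (subst block_vec_smult, force, subst block_vec_add, force, force) (auto intro!: block_vec_cong)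
  have nz: "geometric_mat T z ?k *\<^sub>v ?e x \<noteq> 0\<^sub>v (d * m)" if x: "x \<in> carrier_vec m" "x \<noteq> 0\<^sub>v m" for x
  proof
    assume *: "geometric_mat T z ?k *\<^sub>v ?e x = 0\<^sub>v (d * m)"
    have "x $ l = 0" if l: "l < m" for l
    proof -
      have "(geometric_mat T z ?k *\<^sub>v ?e x) $ (pos a 0 * m + l) = z ^ (?k - 1) * x $ l"
        using k p x(1) l by (simp add: geometric_blk[OF a x(1)] block_vec_nth)
      moreover have "(geometric_mat T z ?k *\<^sub>v ?e x) $ (pos a 0 * m + l) = 0"
        unfolding * using block_index_less[OF p(1) l] by simp
      ultimately show ?thesis using z by simp
    qed
    then have "x = 0\<^sub>v m" using x(1) by (intro eq_vecI) auto
    then show False using x(2) by simp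
  qed
  note root = jordan_size_root[OF T S[OF a], of ?e ?k z, OF blk_carrier e0 lin T_pow_cycle[OF a] nz ev]
  show "jordan_size (S (cl a)) (z ^ ?k) \<le> jordan_size T z" by (rule root(1))
  show "eigenvalue T z" by (rule root(2))
qed

lemma sum_cycle:
  assumes a: "a < d"
  shows "(\<Sum>b<d. if cl b = cl a then f b else 0) = (\<Sum>r<kk (cl a). f (pos a r) :: complex)"
proof -
  have "(\<Sum>r<kk (cl a). f (pos a r)) = (\<Sum>b | b < d \<and> cl b = cl a. f b)"
  proof (rule sum.reindex_bij_witness[of _ ps "pos a"])
    fix b assume "b \<in> {b. b < d \<and> cl b = cl a}"
    then have b: "b < d" "cl b = cl a" by auto
    then show "pos a (ps b) = b" using pos[OF a, of "ps b"] ps[OF b(1)] by - (rule inj, auto)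
    show "ps b \<in> {..<kk (cl a)}" using ps[OF b(1)] b by simp
  qed (use pos[OF a] in auto)
  also have "\<dots> = (\<Sum>b<d. if cl b = cl a then f b else 0)"
    by (rule sum.mono_neutral_cong_left) auto
  finally show ?thesis by simp
qed

end

section \<open>The eigenbasis of a cyclic block matrix\<close>

lemma sum_roots_of_unity:
  assumes x: "\<bar>x\<bar> < int k"
  shows "(\<Sum>r<k. cis (2 * pi * of_nat r / of_nat k * of_int x)) = (if x = 0 then of_nat k else 0)"
proof (cases "x = 0")
  case False
  have k: "k > 0" using x by auto
  \<comment> \<open>The sum is geometric in this k-th root of unity, which is 1 only if k divides x;
    the bound on x then leaves only x = 0.\<close>
  define u where "u = cis (2 * pi * of_int x / of_nat k)"
  have "u ^ k = cis (2 * pi * of_int x)" using k by (simp add: u_def Complex.DeMoivre)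
  then have uk: "u ^ k = 1" by (simp only: cis_int_multiple)
  have "u \<noteq> 1"
  proof
    assume "u = 1"
    then obtain n :: int where n: "2 * pi * of_int x / of_nat k = of_int (2 * n) * pi"
      unfolding u_def cis_conv_exp exp_eq_1 by auto
    then have "of_int x = (of_int (n * int k) :: real)" using k by (simp add: field_simps)
    then have xn: "x = n * int k" by (simp only: of_int_eq_iff)
    then have "n \<noteq> 0" using False by auto
    then have "1 * int k \<le> \<bar>n\<bar> * int k" by (intro mult_right_mono) auto
    then show False using x by (simp add: xn abs_mult)
  qed
  have "(\<Sum>r<k. cis (2 * pi * of_nat r / of_nat k * of_int x)) = (\<Sum>r<k. u ^ r)"
    by (rule sum.cong) (simp_all add: u_def Complex.DeMoivre mult_ac)
  also have "\<dots> = 0" using geometric_sum[OF \<open>u \<noteq> 1\<close>, of k] uk by simp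
  finally show ?thesis using False by simp
qed simp

context block_cycles
begin

context
  fixes ev :: "nat \<Rightarrow> nat \<Rightarrow> complex" and P P' :: "nat \<Rightarrow> complex Matrix.mat"
  assumes wit: "\<And>a. a < d \<Longrightarrow> similar_mat_wit (S (cl a)) (mat_diag m (ev (cl a))) (P (cl a)) (P' (cl a))"
begin

definition twist :: "nat \<Rightarrow> nat \<Rightarrow> int \<Rightarrow> complex" where
  "twist b s x = cis (2 * pi * ((mu (ev (cl b) s) + of_nat (ps b)) / of_nat (kk (cl b))) * of_int x)"

definition lift_ev :: "nat \<Rightarrow> complex" where
  "lift_ev q = root_of (ev (cl (q div m)) (q mod m)) (kk (cl (q div m))) (ps (q div m))"

text \<open>
  \<open>twist b s x\<close> is the \<open>x\<close>-th power of the eigenvalue \<open>z\<close> of \<open>T\<close> with index \<open>b * m + s\<close>. An eigenvector for \<open>z\<close>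
  has the blocks \<open>z\<^sup>-\<^sup>j v\<close> at the positions \<open>j\<close> of one cycle, where \<open>v\<close> is an eigenvector of \<open>S\<close>; it is
  scaled such that the block \<open>b\<close> is \<open>v\<close> itself.
\<close>

definition lift_basis :: "complex Matrix.mat" where
  "lift_basis = Matrix.mat (d * m) (d * m) (\<lambda>(p, q).
     if cl (p div m) = cl (q div m)
     then P (cl (q div m)) $$ (p mod m, q mod m) * twist (q div m) (q mod m) (int (ps (q div m)) - int (ps (p div m)))
     else 0)"

text \<open>The inverse discrete Fourier transform along each cycle, combined with
  \<open>P'\<close>: opposite phases and the factor 1/k.\<close>

definition lift_basis_inv :: "complex Matrix.mat" where
  "lift_basis_inv = Matrix.mat (d * m) (d * m) (\<lambda>(q, p).
     if cl (p div m) = cl (q div m)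
     then P' (cl (q div m)) $$ (q mod m, p mod m) * twist (q div m) (q mod m) (int (ps (p div m)) - int (ps (q div m)))
       / of_nat (kk (cl (q div m)))
     else 0)"

lemma lift_basis_carrier: "lift_basis \<in> carrier_mat (d * m) (d * m)" "lift_basis_inv \<in> carrier_mat (d * m) (d * m)"
  by (simp_all add: lift_basis_def lift_basis_inv_def)

lemma lift_basis_index:
  assumes "a < d" "l < m" "b < d" "s < m"
  shows "lift_basis $$ (a * m + l, b * m + s) = (if cl a = cl b then P (cl b) $$ (l, s) * twist b s (int (ps b) - int (ps a)) else 0)"
    and "lift_basis_inv $$ (b * m + s, a * m + l) = (if cl a = cl b then P' (cl b) $$ (s, l) * twist b s (int (ps a) - int (ps b)) / of_nat (kk (cl b)) else 0)"
  using assms by (simp_all add: lift_basis_def lift_basis_inv_def block_index_less)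

lemma twist_add: "twist b s (x + y) = twist b s x * twist b s y"
  by (simp add: twist_def cis_mult distrib_left)

lemma twist_1: "twist b s 1 = root_of (ev (cl b) s) (kk (cl b)) (ps b)"
  by (simp add: twist_def root_of_def)

lemma ev_unit: "a < d \<Longrightarrow> s < m \<Longrightarrow> cmod (ev (cl a) s) = 1"
  using unit eigenvalue_similar_diag[OF wit] by blast

lemma twist_cycle:
  assumes "b < d" "s < m"
  shows "twist b s (int (kk (cl b))) = ev (cl b) s"
proof -
  have k: "kk (cl b) > 0" using ps[OF assms(1)] by simp
  have "twist b s (int (kk (cl b))) = cis (2 * pi * mu (ev (cl b) s) + 2 * pi * of_int (int (ps b)))"
  proof -
    have "2 * pi * ((mu (ev (cl b) s) + of_nat (ps b)) / of_nat (kk (cl b))) * of_int (int (kk (cl b)))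
        = 2 * pi * mu (ev (cl b) s) + 2 * pi * of_int (int (ps b))"
      using k by (simp add: field_simps)
    then show ?thesis by (simp only: twist_def)
  qed
  also have "\<dots> = cis (2 * pi * mu (ev (cl b) s)) * cis (2 * pi * of_int (int (ps b)))" by (rule cis_mult[symmetric])
  finally show ?thesis unfolding cis_int_multiple cis_mu[OF ev_unit[OF assms]] by simp
qed

text \<open>Orthogonality of characters: summing over the positions of the middle block leaves only
  equal positions of the outer blocks, and there the product of \<open>P\<close> and
  \<open>P'\<close> remains.\<close>

lemma lift_basis_inverse: "lift_basis * lift_basis_inv = 1\<^sub>m (d * m)"
proof (rule block_mat_eqI[OF mult_carrier_mat[OF lift_basis_carrier] one_carrier_mat])
  fix a l c t assume a: "a < d" and l: "l < m" and c: "c < d" and t: "t < m"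
  have one: "1\<^sub>m (d * m) $$ (a * m + l, c * m + t) = (if a = c \<and> l = t then 1 else 0 :: complex)"
  proof -
    have "a * m + l = c * m + t \<longleftrightarrow> a = c \<and> l = t"
    proof
      assume e: "a * m + l = c * m + t"
      have "(a * m + l) div m = (c * m + t) div m" "(a * m + l) mod m = (c * m + t) mod m" by (simp_all only: e)
      then show "a = c \<and> l = t" using l t by simp
    qed simp
    then show ?thesis using a l c t by (simp add: block_index_less)
  qed
  have prod: "(lift_basis * lift_basis_inv) $$ (a * m + l, c * m + t) =
      (\<Sum>b<d. \<Sum>s<m. lift_basis $$ (a * m + l, b * m + s) * lift_basis_inv $$ (b * m + s, c * m + t))"
    by (rule block_mat_mult_index[OF lift_basis_carrier a l c t])
  show "(lift_basis * lift_basis_inv) $$ (a * m + l, c * m + t) = 1\<^sub>m (d * m) $$ (a * m + l, c * m + t)"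
  proof (cases "cl a = cl c")
    case False
    then have "(\<Sum>b<d. \<Sum>s<m. lift_basis $$ (a * m + l, b * m + s) * lift_basis_inv $$ (b * m + s, c * m + t)) = 0"
      by (intro sum.neutral ballI) (auto simp: lift_basis_index a l c t)
    then show ?thesis using False by (auto simp: prod one)
  next
    case True
    let ?k = "kk (cl a)" and ?x = "int (ps c) - int (ps a)"
    let ?A = "\<lambda>s. P (cl a) $$ (l, s) * P' (cl a) $$ (s, t)"
    let ?w = "\<lambda>s. cis (2 * pi * (mu (ev (cl a) s) / of_nat ?k) * of_int ?x)"
    have k: "?k > 0" using ps[OF a] by simp
    have x: "\<bar>?x\<bar> < int ?k" using ps[OF a] ps[OF c] True by auto
    have "(\<Sum>b<d. \<Sum>s<m. lift_basis $$ (a * m + l, b * m + s) * lift_basis_inv $$ (b * m + s, c * m + t))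
        = (\<Sum>b<d. if cl b = cl a then \<Sum>s<m. ?A s * twist b s ?x / of_nat ?k else 0)"
    proof (rule sum.cong[OF refl])
      fix b assume "b \<in> {..<d}"
      then have b: "b < d" by simp
      have tw: "twist b s (int (ps b) - int (ps a)) * twist b s (int (ps c) - int (ps b)) = twist b s ?x" for s
        by (simp flip: twist_add)
      show "(\<Sum>s<m. lift_basis $$ (a * m + l, b * m + s) * lift_basis_inv $$ (b * m + s, c * m + t))
          = (if cl b = cl a then \<Sum>s<m. ?A s * twist b s ?x / of_nat ?k else 0)"
        using True by (auto simp: lift_basis_index a l b c t tw[symmetric] mult_ac intro!: sum.cong)
    qed
    also have "\<dots> = (\<Sum>r<?k. \<Sum>s<m. ?A s * twist (pos a r) s ?x / of_nat ?k)" by (rule sum_cycle[OF a])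
    \<comment> \<open>The phase splits into a factor depending on s and a root of unity depending on
      r, so the sum over r can be carried out first.\<close>
    also have "\<dots> = (\<Sum>r<?k. \<Sum>s<m. ?A s * ?w s / of_nat ?k * cis (2 * pi * of_nat r / of_nat ?k * of_int ?x))"
    proof (intro sum.cong refl)
      fix r s assume "r \<in> {..<?k}" "s \<in> {..<m}"
      then have "twist (pos a r) s ?x = cis (2 * pi * ((mu (ev (cl a) s) + of_nat r) / of_nat ?k) * of_int ?x)"
        using pos[OF a, of r] by (simp add: twist_def)
      also have "2 * pi * ((mu (ev (cl a) s) + of_nat r) / of_nat ?k) * of_int ?x
          = 2 * pi * (mu (ev (cl a) s) / of_nat ?k) * of_int ?x + 2 * pi * of_nat r / of_nat ?k * of_int ?x"
        using k by (simp add: field_simps)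
      finally show "?A s * twist (pos a r) s ?x / of_nat ?k = ?A s * ?w s / of_nat ?k * cis (2 * pi * of_nat r / of_nat ?k * of_int ?x)"
        by (simp add: cis_mult[symmetric])
    qed
    also have "\<dots> = (\<Sum>s<m. ?A s * ?w s / of_nat ?k * (\<Sum>r<?k. cis (2 * pi * of_nat r / of_nat ?k * of_int ?x)))"
      by (subst sum.swap) (simp only: sum_distrib_left)
    also have "\<dots> = (if ?x = 0 then \<Sum>s<m. ?A s else 0)"
      unfolding sum_roots_of_unity[OF x] using k by simp
    also have "(\<Sum>s<m. ?A s) = (P (cl a) * P' (cl a)) $$ (l, t)"
      using similar_diag_wit[OF wit[OF a]] l t by (intro mult_mat_index[symmetric]) auto
    also have "P (cl a) * P' (cl a) = 1\<^sub>m m" using similar_diag_wit[OF wit[OF a]] by blast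
    also have "(if ?x = 0 then 1\<^sub>m m $$ (l, t) else 0) = (if a = c \<and> l = t then 1 else 0 :: complex)"
      using inj[OF a c True] l t by auto
    finally show ?thesis by (simp only: prod one)
  qed
qed

text \<open>Each step along the cycle multiplies a column by its root. When the cycle closes, the
  exponent drops by its full length, and the eigenvalue of \<open>S\<close>, the k-th power of the
  root by \<open>twist_cycle\<close>, makes up for it.\<close>

lemma T_lift_basis: "T * lift_basis = lift_basis * mat_diag (d * m) lift_ev"
proof (rule block_mat_eqI[OF mult_carrier_mat[OF T lift_basis_carrier(1)] mult_carrier_mat[OF lift_basis_carrier(1) mat_diag_dim]])
  fix a l c t assume a: "a < d" and l: "l < m" and c: "c < d" and t: "t < m"
  note pa = prv[OF a]
  have ct: "(c * m + t) div m = c" "(c * m + t) mod m = t" using t by simp_all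
  have "(lift_basis * mat_diag (d * m) lift_ev) $$ (a * m + l, c * m + t)
      = lift_basis $$ (a * m + l, c * m + t) * lift_ev (c * m + t)"
    using a l c t by (simp add: mat_diag_mult_right[OF lift_basis_carrier(1)] block_index_less)
  also have "lift_ev (c * m + t) = twist c t 1" by (simp only: lift_ev_def ct twist_1)
  finally have R: "(lift_basis * mat_diag (d * m) lift_ev) $$ (a * m + l, c * m + t)
      = (if cl a = cl c then P (cl c) $$ (l, t) * (twist c t (int (ps c) - int (ps a)) * twist c t 1) else 0)"
    by (simp add: lift_basis_index a l c t)
  have "(T * lift_basis) $$ (a * m + l, c * m + t)
      = (\<Sum>s<m. M a $$ (l, s) * lift_basis $$ (prv a * m + s, c * m + t))"
    unfolding block_mat_mult_index[OF T lift_basis_carrier(1) a l c t] by (rule T_row[OF a l])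
  also have "\<dots> = (\<Sum>s<m. M a $$ (l, s) * (if cl a = cl c then P (cl c) $$ (s, t) * twist c t (int (ps c) - int (ps (prv a))) else 0))"
    by (rule sum.cong) (simp_all add: lift_basis_index pa c t)
  also have "\<dots> = (if cl a = cl c then (\<Sum>s<m. M a $$ (l, s) * P (cl a) $$ (s, t)) * twist c t (int (ps c) - int (ps (prv a))) else 0)"
    by (simp add: sum_distrib_right mult.assoc)
  also have "(\<Sum>s<m. M a $$ (l, s) * P (cl a) $$ (s, t)) = (M a * P (cl a)) $$ (l, t)"
    by (rule mult_mat_index[OF M[OF a] similar_diag_wit(2)[OF wit[OF a]] l t, symmetric])
  also have "\<dots> = P (cl a) $$ (l, t) * (if ps a = 0 then ev (cl a) t else 1)"
  proof (cases "ps a = 0")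
    case True
    note w = similar_diag_wit[OF wit[OF a]]
    have "S (cl a) * P (cl a) = P (cl a) * mat_diag m (ev (cl a)) * (P' (cl a) * P (cl a))"
      by (subst w(6)) (rule assoc_mult_mat[OF mult_carrier_mat[OF w(2) mat_diag_dim] w(3,2)])
    also have "\<dots> = P (cl a) * mat_diag m (ev (cl a))"
      unfolding w(5) by (rule right_mult_one_mat[OF mult_carrier_mat[OF w(2) mat_diag_dim]])
    finally show ?thesis using True l t by (simp add: mat_diag_mult_right[OF w(2)])
  next
    case False
    then show ?thesis using left_mult_one_mat[OF similar_diag_wit(2)[OF wit[OF a]]] by simp
  qed
  finally have L: "(T * lift_basis) $$ (a * m + l, c * m + t) = (if cl a = cl c
      then P (cl a) $$ (l, t) * (if ps a = 0 then ev (cl a) t else 1) * twist c t (int (ps c) - int (ps (prv a))) else 0)" .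
  have "(if ps a = 0 then ev (cl a) t else 1) * twist c t (int (ps c) - int (ps (prv a)))
      = twist c t (int (ps c) - int (ps a)) * twist c t 1" if "cl a = cl c"
  proof (cases "ps a = 0")
    case True
    have "int (ps (prv a)) = int (kk (cl c)) - 1" using pa True ps[OF a] that by auto
    then have "ev (cl a) t * twist c t (int (ps c) - int (ps (prv a)))
        = twist c t (int (kk (cl c)) + (int (ps c) - (int (kk (cl c)) - 1)))"
      unfolding twist_add[of c t "int (kk (cl c))"] twist_cycle[OF c t] that by simp
    then show ?thesis using True by (simp add: twist_add[symmetric])
  next
    case False
    then have e: "int (ps c) - int (ps (prv a)) = (int (ps c) - int (ps a)) + 1" using pa by auto
    show ?thesis using False by (simp only: e twist_add if_False mult_1_left)
  qed
  then show "(T * lift_basis) $$ (a * m + l, c * m + t) = (lift_basis * mat_diag (d * m) lift_ev) $$ (a * m + l, c * m + t)"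
    unfolding L R by (simp add: mult.assoc)
qed

lemma lift_wit: "similar_mat_wit T (mat_diag (d * m) lift_ev) lift_basis lift_basis_inv"
proof (rule similar_mat_witI)
  note B = lift_basis_carrier
  show "lift_basis * lift_basis_inv = 1\<^sub>m (d * m)" by (rule lift_basis_inverse)
  show "lift_basis_inv * lift_basis = 1\<^sub>m (d * m)"
    by (rule mat_mult_left_right_inverse[OF B lift_basis_inverse])
  have "T = T * (lift_basis * lift_basis_inv)" unfolding lift_basis_inverse by (rule right_mult_one_mat[OF T, symmetric])
  also have "\<dots> = T * lift_basis * lift_basis_inv" by (rule assoc_mult_mat[OF T B, symmetric])
  finally show "T = lift_basis * mat_diag (d * m) lift_ev * lift_basis_inv" unfolding T_lift_basis .
qed (use T lift_basis_carrier in auto)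

text \<open>
  In the coordinates of \<open>lift_basis\<close>, the sections of the expansion of one block over the residue
  classes modulo the length of the cycle are the coordinates of the lift.
\<close>

lemma coord_exp_lift:
  assumes h: "h > 0"
    and c: "\<And>a. a < d \<Longrightarrow> coord_exp m (h * of_nat (kk (cl a))) (ev (cl a)) (P (cl a)) (F a) (c a)"
    and rel: "\<And>a b n s. a < d \<Longrightarrow> b < d \<Longrightarrow> cl a = cl b \<Longrightarrow> s < m \<Longrightarrow>
      c a n s = c b n s * q_pow (h * of_nat (kk (cl a))) (mu (ev (cl a) s) + of_int n) (of_real (of_int (int (ps b) - int (ps a)) * h))"
    and X: "\<And>\<tau>. \<tau> \<in> upper_half_plane \<Longrightarrow> X \<tau> = block_vec d m (\<lambda>a. F a \<tau>)"
  shows "coord_exp (d * m) h lift_ev lift_basis X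
    (\<lambda>n q. c (q div m) (int (kk (cl (q div m))) * n + int (ps (q div m))) (q mod m))" (is "coord_exp _ _ _ _ _ ?c")
  unfolding coord_exp_def
proof (intro conjI allI impI ballI)
  have cq: "qs (h * of_nat (kk (cl a))) (\<lambda>n. c a n s)" if "a < d" "s < m" for a s
    using c[OF that(1)] that(2) by (simp add: coord_exp_def)
  have kp: "kk (cl a) > 0" if "a < d" for a using ps[OF that] by simp
  show q: "qs h (\<lambda>n. ?c n q)" if "q < d * m" for q
    using block_index[OF that] by (intro qs_section cq kp)
  fix \<tau> assume \<tau>: "\<tau> \<in> upper_half_plane"
  let ?v = "Matrix.vec (d * m) (\<lambda>q. q_pow h (mu (lift_ev q)) \<tau> * qsum h (\<lambda>n. ?c n q) \<tau>)"
  let ?w = "\<lambda>b. Matrix.vec m (\<lambda>s. q_pow h (mu (lift_ev (b * m + s))) \<tau> * qsum h (\<lambda>n. ?c n (b * m + s)) \<tau>)"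
  have v: "?v = block_vec d m ?w"
    by (rule block_vec_eqI) (simp_all add: block_index_less)
  have "lift_basis *\<^sub>v ?v = block_vec d m (\<lambda>a. F a \<tau>)"
  proof (rule block_vec_eqI)
    show "lift_basis *\<^sub>v ?v \<in> carrier_vec (d * m)" by (rule mult_mat_vec_carrier[OF lift_basis_carrier(1)]) simp
    fix a l assume a: "a < d" and l: "l < m"
    let ?k = "kk (cl a)"
    let ?f = "\<lambda>b. \<Sum>s<m. P (cl a) $$ (l, s) * (q_pow (h * of_nat ?k) (mu (ev (cl a) s)) \<tau> *
        (q_pow h (of_nat (ps b) / of_nat ?k) \<tau> * qsum h (\<lambda>n. c a (int ?k * n + int (ps b)) s) \<tau>))"
    have "(lift_basis *\<^sub>v ?v) $ (a * m + l) = (\<Sum>b<d. \<Sum>s<m. lift_basis $$ (a * m + l, b * m + s) * ?w b $ s)"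
      unfolding v by (rule block_mat_mult_vec[OF lift_basis_carrier(1) _ a l]) simp
    also have "\<dots> = (\<Sum>b<d. if cl b = cl a then ?f b else 0)"
    proof (rule sum.cong[OF refl])
      fix b assume "b \<in> {..<d}"
      then have b: "b < d" by simp
      show "(\<Sum>s<m. lift_basis $$ (a * m + l, b * m + s) * ?w b $ s) = (if cl b = cl a then ?f b else 0)"
      proof (cases "cl b = cl a")
        case False
        then show ?thesis by (auto simp: lift_basis_index a l b intro!: sum.neutral)
      next
        case True
        have "lift_basis $$ (a * m + l, b * m + s) * ?w b $ s
            = P (cl a) $$ (l, s) * (q_pow (h * of_nat ?k) (mu (ev (cl a) s)) \<tau> *
              (q_pow h (of_nat (ps b) / of_nat ?k) \<tau> * qsum h (\<lambda>n. c a (int ?k * n + int (ps b)) s) \<tau>))"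
          if s: "s < m" for s
        proof -
          let ?x = "int (ps b) - int (ps a)"
          \<comment> \<open>The index is congruent to \<open>ps b\<close> modulo the length of the
            cycle, so the translation factor in \<open>rel\<close> is the phase of the basis times
            the exponential of an integral multiple of 2 pi i. The scaling of
            \<open>lift_basis\<close> is made for this cancellation.\<close>
          have tw: "c a (int ?k * n + int (ps b)) s = twist b s ?x * c b (int ?k * n + int (ps b)) s" for n
          proof -
            have "q_pow (h * of_nat ?k) (mu (ev (cl a) s) + of_int (int ?k * n + int (ps b))) (of_real (of_int ?x * h))
                = cis (2 * pi * ((mu (ev (cl a) s) + of_nat (ps b)) / of_nat ?k) * of_int ?x + 2 * pi * of_int (n * ?x))"
              unfolding q_pow_def cis_conv_exp using h kp[OF a] by (intro arg_cong[of _ _ exp]) (simp add: field_simps)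
            also have "\<dots> = twist b s ?x * cis (2 * pi * of_int (n * ?x))"
              unfolding cis_mult[symmetric] by (simp add: twist_def True)
            finally show ?thesis unfolding rel[OF a b True[symmetric] s] cis_int_multiple by simp
          qed
          have bs: "(b * m + s) div m = b" "(b * m + s) mod m = s" using s by simp_all
          have "?w b $ s = q_pow h (mu (lift_ev (b * m + s))) \<tau> * qsum h (\<lambda>n. c b (int ?k * n + int (ps b)) s) \<tau>"
            using s by (simp only: index_vec bs True)
          also have "mu (lift_ev (b * m + s)) = mu (ev (cl a) s) / of_nat ?k + of_nat (ps b) / of_nat ?k"
            using ps[OF b] by (simp only: lift_ev_def bs mu_root_of True add_divide_distrib)
          finally have "?w b $ s = q_pow (h * of_nat ?k) (mu (ev (cl a) s)) \<tau> *
              (q_pow h (of_nat (ps b) / of_nat ?k) \<tau> * qsum h (\<lambda>n. c b (int ?k * n + int (ps b)) s) \<tau>)"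
            using kp[OF a] by (simp only: q_pow_add q_pow_width_mult of_nat_eq_0_iff neq0_conv mult.assoc not_False_eq_True)
          moreover have "qsum h (\<lambda>n. c a (int ?k * n + int (ps b)) s) \<tau> = twist b s ?x * qsum h (\<lambda>n. c b (int ?k * n + int (ps b)) s) \<tau>"
            unfolding tw qsum_cmult ..
          ultimately show ?thesis using True by (simp add: lift_basis_index a l b s)
        qed
        then show ?thesis using True by simp
      qed
    qed
    also have "\<dots> = (\<Sum>r<?k. ?f (pos a r))" by (rule sum_cycle[OF a])
    also have "\<dots> = (\<Sum>r<?k. \<Sum>s<m. P (cl a) $$ (l, s) * (q_pow (h * of_nat ?k) (mu (ev (cl a) s)) \<tau> *
        (q_pow h (of_nat r / of_nat ?k) \<tau> * qsum h (\<lambda>n. c a (int ?k * n + int r) s) \<tau>)))"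
      by (rule sum.cong) (use pos[OF a] in auto)
    also have "\<dots> = (\<Sum>s<m. P (cl a) $$ (l, s) * (q_pow (h * of_nat ?k) (mu (ev (cl a) s)) \<tau> *
        (\<Sum>r<?k. q_pow h (of_nat r / of_nat ?k) \<tau> * qsum h (\<lambda>n. c a (int ?k * n + int r) s) \<tau>)))"
      by (subst sum.swap) (simp only: sum_distrib_left)
    also have "\<dots> = (\<Sum>s<m. P (cl a) $$ (l, s) * (q_pow (h * of_nat ?k) (mu (ev (cl a) s)) \<tau> * qsum (h * of_nat ?k) (\<lambda>n. c a n s) \<tau>))"
      by (rule sum.cong) (simp_all add: qsum_sections[OF cq[OF a] kp[OF a] \<tau>])
    also have "\<dots> = F a \<tau> $ l"
      using c[OF a] \<tau> mult_mat_vec_index[OF similar_diag_wit(2)[OF wit[OF a]] _ l] by (simp add: coord_exp_def)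
    finally show "(lift_basis *\<^sub>v ?v) $ (a * m + l) = F a \<tau> $ l" .
  qed
  then show "X \<tau> = lift_basis *\<^sub>v ?v" by (simp add: X[OF \<tau>])
qed

end

end

section \<open>Application to the induced representation and the lift\<close>

lemma eigenvalue_exists:
  fixes A :: "complex Matrix.mat"
  assumes A: "A \<in> carrier_mat n n" and n: "n > 0"
  shows "\<exists>z. eigenvalue A z"
proof -
  obtain as where as: "char_poly A = (\<Prod>a\<leftarrow>as. [:- a, 1:])" "length as = n"
    using char_poly_factorized[OF A] by blast
  then obtain z where "z \<in> set as" using n by (cases as) auto
  then have "poly (char_poly A) z = 0" unfolding as(1) by (force simp: poly_prod_list prod_list_zero_iff)
  then show ?thesis using eigenvalue_root_char_poly[OF A] by blast
qed

lemma conj_id2 [simp]: "conj_group id2 K = K" "conj_rep id2 \<rho> = \<rho>"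
  by (simp_all add: conj_group_def conj_rep_def)

lemma vvaf_expansion_Infty:
  assumes "weakly_holomorphic_vvaf m \<Gamma> \<rho> X" "is_cusp \<Gamma> Infty"
  shows "if admissible \<Gamma> \<rho> then \<exists>a. admissible_expansion m \<Gamma> \<rho> X a else \<exists>a. log_expansion m \<Gamma> \<rho> X a"
proof -
  have "let A = cusp_mat Infty; \<Gamma>' = conj_group (matrix_inv A) \<Gamma>; \<rho>' = conj_rep (matrix_inv A) \<rho>;
             X' = (\<lambda>\<tau>. X (moebius A \<tau>))
         in if admissible \<Gamma> \<rho> then \<exists>a. admissible_expansion m \<Gamma>' \<rho>' X' a
            else \<exists>a. log_expansion m \<Gamma>' \<rho>' X' a"
    using assms unfolding weakly_holomorphic_vvaf_def by blast
  then show ?thesis by (cases "admissible \<Gamma> \<rho>") (simp_all add: Let_def)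
qed

text \<open>An invertible idempotent is the identity, which gives the value at \<open>id2\<close>
  directly from multiplicativity.\<close>

lemma hom_GL:
  assumes H: "subgroup H SL2R" and \<rho>: "\<rho> \<in> hom (SL2R\<lparr>carrier := H\<rparr>) (GL m)"
  shows "x \<in> H \<Longrightarrow> \<rho> x \<in> carrier_mat m m" and "\<rho> id2 = 1\<^sub>m m"
proof -
  have c: "\<rho> x \<in> carrier_mat m m" "invertible_mat (\<rho> x)" if "x \<in> H" for x
    using \<rho> that by (auto simp: hom_def GL_def)
  then show "x \<in> H \<Longrightarrow> \<rho> x \<in> carrier_mat m m" by blast
  have i: "id2 \<in> H" by (rule subgroup_SL2R_D(4)[OF H])
  then have "\<rho> (id2 \<otimes>\<^bsub>SL2R\<lparr>carrier := H\<rparr>\<^esub> id2) = \<rho> id2 \<otimes>\<^bsub>GL m\<^esub> \<rho> id2"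
    using \<rho> by (auto simp: hom_def)
  then have idem: "\<rho> id2 * \<rho> id2 = \<rho> id2" by (simp add: GL_def)
  note E = c(1)[OF i]
  obtain B where B: "\<rho> id2 * B = 1\<^sub>m (dim_row (\<rho> id2))" "B * \<rho> id2 = 1\<^sub>m (dim_row B)"
    using c(2)[OF i] unfolding invertible_mat_def inverts_mat_def by blast
  have "dim_row B = m" using arg_cong[OF B(2), of dim_col] carrier_matD[OF E] by simp
  moreover have "dim_col B = m" using arg_cong[OF B(1), of dim_col] carrier_matD[OF E] by simp
  ultimately have Bc: "B \<in> carrier_mat m m" by (rule carrier_matI)
  have "\<rho> id2 = \<rho> id2 * (\<rho> id2 * B)" using B(1) E by simp
  also have "\<dots> = \<rho> id2 * \<rho> id2 * B" by (rule assoc_mult_mat[OF E E Bc, symmetric])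
  also have "\<dots> = 1\<^sub>m m" using B(1) E by (simp add: idem)
  finally show "\<rho> id2 = 1\<^sub>m m" .
qed

lemma diagonalizable_wit:
  assumes "diagonalizable T" "T \<in> carrier_mat m m"
  shows "\<exists>ev P P'. similar_mat_wit T (mat_diag m ev) P P'"
proof -
  obtain D P P' where D: "diagonal_mat D" "similar_mat_wit T D P P'"
    using assms(1) by (auto simp: diagonalizable_def similar_mat_def)
  have "D \<in> carrier_mat m m" using similar_mat_witD2(5)[OF assms(2) D(2)] .
  then have "D = mat_diag m (\<lambda>i. D $$ (i, i))"
    using D(1) by (intro eq_matI) (auto simp: mat_diag_def diagonal_mat_def)
  then show ?thesis using D(2) by metis
qed

text \<open>The numbers, the eigenbases and the correspondence of eigenvalues are quantified before
  the form \<open>X\<close>, which expresses their independence of it. Requiring infinity to be a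
  cusp of every conjugate makes the coefficients there meaningful.\<close>

theorem theorem1p3:
  fixes G H :: "(real^2^2) set" and d m :: nat
    and \<rho> :: "real^2^2 \<Rightarrow> complex Matrix.mat"
    and c :: boundary_point and cs :: "boundary_point list" and As :: "(real^2^2) list"
  assumes "subgroup G SL2R" and "subgroup H SL2R" and "H \<subseteq> G"
    and "finite (rcosets\<^bsub>SL2R\<lparr>carrier := G\<rparr>\<^esub> H)"
    and "d = group_index (SL2R\<lparr>carrier := G\<rparr>) H"
    and "- id2 \<in> H"
    and "fuchsian_first_kind G" and "fuchsian_first_kind H"
    and "\<rho> \<in> hom (SL2R\<lparr>carrier := H\<rparr>) (GL m)"
    and "unitary_at_parabolics H \<rho>"
    and "is_cusp G c" and "is_cusp G Infty \<Longrightarrow> c = Infty"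
    and "lift_data G H c cs As"
  shows "\<exists>ms ns rs P Q lms lns lrs ev. \<forall>X. weakly_holomorphic_vvaf m H \<rho> X \<longrightarrow>
    (\<exists>g F.
       (\<forall>i<d. g i \<in> carrier SL2R \<and> is_cusp (conj_group (g i) H) Infty \<and>
          weakly_holomorphic_vvaf m (conj_group (g i) H) (conj_rep (g i) \<rho>) (F i)) \<and>
       (admissible H \<rho> \<longrightarrow>
          coefficient_identity d m
            (lift_group G c) (lift_rep m G H c cs As \<rho>) (lift_form m G H c cs As X)
            (\<lambda>i. conj_group (g i) H) (\<lambda>i. conj_rep (g i) \<rho>) F P Q ms ns rs) \<and>
       labelled_coefficient_identity d m
         (lift_group G c) (lift_rep m G H c cs As \<rho>) (lift_form m G H c cs As X)
         (\<lambda>i. conj_group (g i) H) (\<lambda>i. conj_rep (g i) \<rho>) F ev lms lns lrs)"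
proof -
  note G = assms(1) and H = assms(2) and HG = assms(3) and mH = assms(6)
  note Gs = subgroup_SL2R_D[OF G] and Hs = subgroup_SL2R_D[OF H]
  have mG: "- id2 \<in> G" using mH HG by blast
  have dG: "discrete G" and dH: "discrete H"
    using assms(7,8) by (auto simp: fuchsian_first_kind_def intro: discrete_subset)
  obtain w where w: "has_width G c w" using ex_has_width[OF G mG dG assms(11)] by blast
  have w0: "w > 0" using w by (simp add: has_width_def)
  define gs where "gs = coset_reps G H c cs As"
  show ?thesis
  proof (rule coset_reps_structure[OF G H mH HG w assms(13), folded gs_def])
    fix ps kk cl :: "nat \<Rightarrow> nat"
    assume index: "length gs = group_index (SL2R\<lparr>carrier := G\<rparr>) H"
      and gs0: "\<And>a. a < length gs \<Longrightarrow> gs ! a \<in> G \<and> ps a < kk (cl a)"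
      and ex0: "\<And>a j. a < length gs \<Longrightarrow> j < kk (cl a) \<Longrightarrow> \<exists>b<length gs. cl b = cl a \<and> ps b = j"
      and inj0: "\<And>a b. a < length gs \<Longrightarrow> b < length gs \<Longrightarrow> cl a = cl b \<Longrightarrow> ps a = ps b \<Longrightarrow> a = b"
      and memH0: "\<And>a b. a < length gs \<Longrightarrow> b < length gs \<Longrightarrow> matrix_inv (gs ! a) ** cusp_translation c w ** gs ! b \<in> H \<longleftrightarrow>
        cl a = cl b \<and> ps a = Suc (ps b) mod kk (cl b)"
      and rel0: "\<And>a b. a < length gs \<Longrightarrow> b < length gs \<Longrightarrow> cl a = cl b \<Longrightarrow>
        gs ! a = cusp_translation c ((of_nat (ps a) - of_nat (ps b)) * w) ** gs ! b"
      and wid0: "\<And>a. a < length gs \<Longrightarrow> has_width (conj_group (matrix_inv (cusp_mat c) ** gs ! a) H) Infty (of_nat (kk (cl a)) * w)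
        \<and> is_cusp (conj_group (matrix_inv (cusp_mat c) ** gs ! a) H) Infty"
    have len: "length gs = d" using index assms(5) by simp
    note ex = ex0[unfolded len] and inj = inj0[unfolded len] and memH = memH0[unfolded len] and rel = rel0[unfolded len]
      and wid = wid0[unfolded len, THEN conjunct1] and cusp = wid0[unfolded len, THEN conjunct2]
      and gsG = gs0[unfolded len, THEN conjunct1] and ps = gs0[unfolded len, THEN conjunct2]
    have sgs: "sl2 (gs ! a)" if "a < d" for a using Gs(1)[OF gsG[OF that]] .
    define g where "g a = matrix_inv (cusp_mat c) ** gs ! a" for a
    have sg: "sl2 (g a)" if "a < d" for a using sgs[OF that] by (simp add: g_def sl2_mult sl2_inv)
    have gi: "matrix_inv (g a) = matrix_inv (gs ! a) ** cusp_mat c" if "a < d" for a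
      using sgs[OF that] by (simp add: g_def sl2_inv_mult sl2_inv)
    \<comment> \<open>The generator of the stabilizer of infinity in the a-th conjugate, pulled back
      to \<open>H\<close>.\<close>
    define y where "y a = matrix_inv (gs ! a) ** cusp_translation c (of_nat (kk (cl a)) * w) ** gs ! a" for a
    have y_conj: "matrix_inv (g a) ** mat2 1 (of_nat (kk (cl a)) * w) 0 1 ** g a = y a" if "a < d" for a
      unfolding gi[OF that] by (simp add: g_def y_def cusp_translation_def matrix_mul_assoc)
    have yH: "y a \<in> H" if "a < d" for a
    proof -
      let ?h = "of_nat (kk (cl a)) * w"
      have "mat2 1 ?h 0 1 \<in> pm_translations Infty (int_multiples ?h)"
        by (auto simp: pm_translations_def int_multiples_def intro!: image_eqI[of _ _ ?h] range_eqI[of _ _ 1])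
      then have "mat2 1 ?h 0 1 \<in> conj_group (g a) H"
        using wid[OF that] by (auto simp: has_width_def bd_stabilizer_def g_def)
      then show ?thesis unfolding mem_conj_group[OF sg[OF that]] y_conj[OF that] .
    qed
    \<comment> \<open>Representatives of one cycle differ by powers of the generator, which commute
      with the translation in \<open>y\<close>; hence \<open>S\<close> can be indexed by
      cycles.\<close>
    have y_class: "y a = y b" if "a < d" "b < d" "cl a = cl b" for a b
    proof -
      let ?x = "(of_nat (ps a) - of_nat (ps b)) * w" and ?h = "of_nat (kk (cl b)) * w"
      have "y a = matrix_inv (gs ! b) ** (cusp_translation c (- ?x) ** cusp_translation c ?h ** cusp_translation c ?x) ** gs ! b"
        unfolding y_def rel[OF that] that(3) using sgs[OF that(2)]
        by (simp add: sl2_inv_mult matrix_inv_cusp_translation matrix_mul_assoc)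
      also have "cusp_translation c (- ?x) ** cusp_translation c ?h ** cusp_translation c ?x = cusp_translation c ?h"
        by (simp add: cusp_translation_add)
      finally show ?thesis by (simp add: y_def)
    qed
    have y_par: "parabolic (y a)" if "a < d" for a
      using trace_conj[of "matrix_inv (gs ! a)" "cusp_translation c (of_nat (kk (cl a)) * w)"] sgs[OF that]
      by (simp add: parabolic_def y_def sl2_inv)
    define S where "S i = \<rho> (y (SOME a. a < d \<and> cl a = i))" for i
    have S: "S (cl a) = \<rho> (y a)" if "a < d" for a
    proof -
      have "(SOME b. b < d \<and> cl b = cl a) < d \<and> cl (SOME b. b < d \<and> cl b = cl a) = cl a"
        by (rule someI_ex) (use that in blast)
      then show ?thesis unfolding S_def using y_class[OF _ that] by metis
    qed
    note \<rho>c = hom_GL[OF H assms(9)]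
    have Sc: "S (cl a) \<in> carrier_mat m m" if "a < d" for a
      unfolding S[OF that] by (rule \<rho>c(1)[OF yH[OF that]])
    define T where "T = induced_rep m H \<rho> gs (cusp_translation c w)"
    have Tc: "T \<in> carrier_mat (d * m) (d * m)" by (simp add: T_def induced_rep_def len)
    interpret B: block_cycles d m cl ps kk S T
    proof
      fix a b l s assume a: "a < d" and b: "b < d" and l: "l < m" and s: "s < m"
      let ?x = "matrix_inv (gs ! a) ** cusp_translation c w ** gs ! b"
      have e: "T $$ (a * m + l, b * m + s) = (if ?x \<in> H then \<rho> ?x $$ (l, s) else 0)"
        using l s block_index_less[OF a l] block_index_less[OF b s]
        by (simp add: T_def induced_rep_def len Let_def)
      \<comment> \<open>Between neighbours inside a cycle the quotient is the identity; closing the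
        cycle leaves the full translation \<open>y a\<close>.\<close>
      have "\<rho> ?x = (if ps a = 0 then S (cl a) else 1\<^sub>m m)"
        if *: "cl a = cl b" "ps a = Suc (ps b) mod kk (cl b)"
      proof (cases "Suc (ps b) = kk (cl b)")
        case True
        then have 0: "ps a = 0" using * by simp
        have "(of_nat (ps b) - of_nat (ps a) :: real) = of_nat (kk (cl a)) - 1"
          unfolding *(1) True[symmetric] 0 by simp
        then have "gs ! b = cusp_translation c ((of_nat (kk (cl a)) - 1) * w) ** gs ! a"
          using rel[OF b a *(1)[symmetric]] by simp
        then have "?x = matrix_inv (gs ! a) ** (cusp_translation c w ** cusp_translation c ((of_nat (kk (cl a)) - 1) * w)) ** gs ! a"
          by (simp add: matrix_mul_assoc)
        also have "\<dots> = y a" by (simp add: cusp_translation_add y_def algebra_simps)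
        finally show ?thesis using 0 S[OF a] by simp
      next
        case False
        then have "Suc (ps b) < kk (cl b)" using ps[OF b] by simp
        then have 1: "ps a = Suc (ps b)" using * by simp
        then have "gs ! a = cusp_translation c w ** gs ! b" using rel[OF a b *(1)] by simp
        then have "?x = matrix_inv (gs ! a) ** gs ! a" by (simp add: matrix_mul_assoc)
        then show ?thesis using 1 sl2_inv(2)[OF sgs[OF a]] \<rho>c(2) by simp
      qed
      then show "T $$ (a * m + l, b * m + s) = (if cl a = cl b \<and> ps a = Suc (ps b) mod kk (cl b)
         then (if ps a = 0 then S (cl a) else 1\<^sub>m m) $$ (l, s) else 0)"
        unfolding e memH[OF a b] by auto
    next
      fix a z assume a: "a < d" and z: "eigenvalue (S (cl a)) z"
      then show "cmod z = 1"
        using assms(10) yH[OF a] y_par[OF a] S[OF a] unfolding unitary_at_parabolics_def by metis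
    qed (use ps ex inj Sc Tc in blast)+
    have data: "cusp_width (lift_group G c) Infty = w"
      "lift_rep m G H c cs As \<rho> (cusp_generator (lift_group G c) Infty) = T"
      unfolding lift_group_def lift_rep_def T_def gs_def by (rule cusp_data[OF G mG w])+
    have data': "cusp_width (conj_group (g a) H) Infty = w * of_nat (kk (cl a))"
      "conj_rep (g a) \<rho> (cusp_generator (conj_group (g a) H) Infty) = S (cl a)" if "a < d" for a
    proof -
      note K = subgroup_conj_group[OF sg[OF that] H] uminus_id2_mem_conj_group[OF sg[OF that] mH]
        wid[OF that, folded g_def]
      show "cusp_width (conj_group (g a) H) Infty = w * of_nat (kk (cl a))"
        by (simp add: cusp_width_eq[OF K] mult.commute)
      show "conj_rep (g a) \<rho> (cusp_generator (conj_group (g a) H) Infty) = S (cl a)"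
        unfolding cusp_generator_Infty[OF K] conj_rep_def y_conj[OF that] S[OF that] ..
    qed
    have kp: "kk (cl a) > 0" if "a < d" for a using ps[OF that] by simp
    \<comment> \<open>The diagonalizations are chosen once per cycle and before any form is given;
      the blocks of one cycle have to share them.\<close>
    have "\<forall>i. \<exists>ev P P'. admissible H \<rho> \<and> (\<exists>a<d. cl a = i) \<longrightarrow> similar_mat_wit (S i) (mat_diag m ev) P P'"
    proof
      fix i
      show "\<exists>ev P P'. admissible H \<rho> \<and> (\<exists>a<d. cl a = i) \<longrightarrow> similar_mat_wit (S i) (mat_diag m ev) P P'"
      proof (cases "admissible H \<rho> \<and> (\<exists>a<d. cl a = i)")
        case True
        then obtain a where a: "a < d" "cl a = i" by blast
        have "diagonalizable (S (cl a))"
          using True yH[OF a(1)] y_par[OF a(1)] unfolding S[OF a(1)] admissible_def by blast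
        then show ?thesis using diagonalizable_wit[OF _ Sc[OF a(1)]] a(2) by blast
      qed blast
    qed
    then obtain ev P P' where wit: "\<And>a. admissible H \<rho> \<Longrightarrow> a < d \<Longrightarrow>
        similar_mat_wit (S (cl a)) (mat_diag m (ev (cl a))) (P (cl a)) (P' (cl a))"
      by metis
    \<comment> \<open>A block whose \<open>S\<close> has no eigenvalue \<open>z\<^sup>k\<close> does not contribute to the label \<open>z\<close>: its factor is \<open>0\<close>.\<close>
    define lev where "lev i z j = (if eigenvalue (S (cl i)) (z ^ kk (cl i)) then z ^ kk (cl i)
      else (SOME z. eigenvalue (S (cl i)) z))" for i z and j :: nat
    define lrs :: "nat \<Rightarrow> complex \<Rightarrow> nat \<Rightarrow> rat" where
      "lrs i z j = (if eigenvalue (S (cl i)) (z ^ kk (cl i)) then (1 / of_nat (kk (cl i))) ^ j else 0)" for i z j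
    \<comment> \<open>For unitary z this is the number of z among the roots of its power with
      exponent \<open>kk (cl i)\<close>, by \<open>floor_mu_root_of\<close>.\<close>
    define off where "off i z = \<lfloor>of_nat (kk (cl i)) * mu z\<rfloor>" for i z
    show ?thesis
    proof (rule exI[of _ "\<lambda>i. of_nat (kk (cl i))"], rule exI[of _ "\<lambda>i. of_nat (ps i)"], rule exI[of _ "\<lambda>i. 1"],
        rule exI[of _ "(B.lift_basis ev P, B.lift_basis_inv ev P')"], rule exI[of _ "\<lambda>i. (P (cl i), P' (cl i))"],
        rule exI[of _ "\<lambda>i z j. of_nat (kk (cl i))"], rule exI[of _ "\<lambda>i z j. of_int (off i z)"],
        rule exI[of _ lrs], rule exI[of _ lev], intro allI impI)
      fix X assume X: "weakly_holomorphic_vvaf m H \<rho> X"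
      define F where "F a \<tau> = X (moebius (matrix_inv (g a)) \<tau>)" for a \<tau>
      have F: "weakly_holomorphic_vvaf m (conj_group (g a) H) (conj_rep (g a) \<rho>) (F a)" if "a < d" for a
        unfolding F_def by (rule vvaf_conj[OF H mH dH sg[OF that] X])
      let ?Xt = "lift_form m G H c cs As X"
      have Xt: "?Xt \<tau> = block_vec d m (\<lambda>a. F a \<tau>)" if \<tau>: "\<tau> \<in> upper_half_plane" for \<tau>
        unfolding lift_form_def induced_form_def gs_def[symmetric] len
      proof (rule block_vec_cong)
        fix a assume a: "a < d"
        have "sl2 (matrix_inv (gs ! a))" using sgs[OF a] by (simp add: sl2_inv)
        then show "X (moebius (matrix_inv (gs ! a)) (moebius (cusp_mat c) \<tau>)) = F a \<tau>"
          unfolding F_def gi[OF a] by (simp add: moebius_mult \<tau>)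
      qed
      have expF: "if admissible H \<rho> then \<exists>a. adm_exp m (w * of_nat (kk (cl i))) (S (cl i)) (F i) a
          else \<exists>a. log_exp m (w * of_nat (kk (cl i))) (S (cl i)) (F i) a" if i: "i < d" for i
        using vvaf_expansion_Infty[OF F[OF i] cusp[OF i, folded g_def]]
        unfolding admissible_conj[OF sg[OF i]] admissible_expansion_iff log_expansion_iff data'[OF i] .
      \<comment> \<open>Both cases of \<open>expF\<close> yield a logarithmic expansion, the
        admissible one through \<open>log_exp_of_adm_exp\<close>.\<close>
      have "\<forall>i<d. \<exists>a. log_exp m (w * of_nat (kk (cl i))) (S (cl i)) (F i) a"
        using expF log_exp_of_adm_exp by metis
      then obtain bl where bl: "\<And>i. i < d \<Longrightarrow> log_exp m (w * of_nat (kk (cl i))) (S (cl i)) (F i) (bl i)"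
        by metis
      have labelled: "labelled_coefficient_identity d m
           (lift_group G c) (lift_rep m G H c cs As \<rho>) ?Xt
           (\<lambda>i. conj_group (g i) H) (\<lambda>i. conj_rep (g i) \<rho>) F lev (\<lambda>i z j. of_nat (kk (cl i))) (\<lambda>i z j. of_int (off i z)) lrs"
      proof -
        define al where "al z j n = (if eigenvalue T z \<and> j < jordan_size T z
          then block_vec d m (\<lambda>i. of_rat (lrs i z j) \<cdot>\<^sub>v bl i (lev i z j) j (int (kk (cl i)) * n + off i z))
          else 0\<^sub>v (d * m))" for z j n
        have "log_exp (d * m) w T ?Xt al"
          unfolding al_def off_def
          by (rule log_exp_lift[where kk = "\<lambda>i. kk (cl i)" and S = "\<lambda>i. S (cl i)" and F = F])
            (use kp bl Sc B.unit Tc B.cycle_jordan Xt in \<open>auto simp: lev_def lrs_def\<close>)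
        \<comment> \<open>An eigenvalue of \<open>T\<close> forces m > 0, so the default value in
          \<open>lev\<close> is a genuine eigenvalue as well.\<close>
        moreover have "eigenvalue (S (cl i)) (lev i z j)" if "eigenvalue T z" "i < d" for i z j
        proof -
          have "d * m > 0" using that(1) eigenvalue_imp_nonzero_dim[OF Tc] by blast
          then have "m > 0" by simp
          from eigenvalue_exists[OF Sc[OF that(2)] this] show ?thesis
            unfolding lev_def by (auto intro: someI_ex)
        qed
        ultimately show ?thesis
          unfolding labelled_coefficient_identity_def Let_def log_expansion_iff data
          using bl data' by (intro exI[of _ al] exI[of _ bl])
            (auto simp: al_def intro!: exI[of _ "\<lambda>i. int (kk (cl i)) * n + off i z" for n z])
      qed
      have adm: "coefficient_identity d m
              (lift_group G c) (lift_rep m G H c cs As \<rho>) ?Xt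
              (\<lambda>i. conj_group (g i) H) (\<lambda>i. conj_rep (g i) \<rho>) F
              (B.lift_basis ev P, B.lift_basis_inv ev P') (\<lambda>i. (P (cl i), P' (cl i)))
              (\<lambda>i. of_nat (kk (cl i))) (\<lambda>i. of_nat (ps i)) (\<lambda>i. 1)"
        if ad: "admissible H \<rho>"
      proof -
        note wit' = wit[OF ad]
        have "\<forall>i<d. \<exists>a. adm_exp m (w * of_nat (kk (cl i))) (S (cl i)) (F i) a" using expF ad by simp
        then obtain b0 where b0: "\<And>i. i < d \<Longrightarrow> adm_exp m (w * of_nat (kk (cl i))) (S (cl i)) (F i) (b0 i)"
          by metis
        define c0 where "c0 i n s = (P' (cl i) *\<^sub>v b0 i n) $ s" for i n s
        \<comment> \<open>The coordinates chosen in \<open>b0\<close> for different blocks are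
          unrelated choices. Therefore only those of the block in position 0 of a cycle are kept,
          and the other blocks get their translates by \<open>ps a\<close> times
          \<open>w\<close>.\<close>
        define cc where "cc a n s = q_pow (w * of_nat (kk (cl a))) (mu (ev (cl a) s) + of_int n) (of_real (- (of_nat (ps a) * w)))
            * c0 (B.pos a 0) n s" for a n s
        have p: "B.pos a 0 < d" "cl (B.pos a 0) = cl a" "ps (B.pos a 0) = 0" if "a < d" for a
          using B.pos[OF that kp[OF that]] by auto
        have Fa: "F a \<tau> = F (B.pos a 0) (\<tau> / of_real 1 + of_real (- (of_nat (ps a) * w)))"
          if a: "a < d" and \<tau>: "\<tau> \<in> upper_half_plane" for a \<tau>
        proof -
          let ?b = "B.pos a 0" and ?x = "of_nat (ps a) * w"
          let ?u = "mat2 1 (- ?x) 0 1"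
          have u: "sl2 ?u" by simp
          have "gs ! a = cusp_translation c ?x ** gs ! ?b" using rel[OF a p(1)[OF a]] p[OF a] by simp
          then have "matrix_inv (gs ! a) = matrix_inv (gs ! ?b) ** cusp_translation c (- ?x)"
            using sgs[OF p(1)[OF a]] by (simp add: sl2_inv_mult matrix_inv_cusp_translation)
          then have "matrix_inv (g a) = matrix_inv (gs ! ?b) ** (cusp_translation c (- ?x) ** cusp_mat c)"
            using gi[OF a] by (simp add: matrix_mul_assoc)
          also have "cusp_translation c (- ?x) ** cusp_mat c = cusp_mat c ** ?u"
            by (simp add: cusp_translation_def sl2_inv_cancel)
          finally have "matrix_inv (g a) = matrix_inv (g ?b) ** ?u"
            using gi[OF p(1)[OF a]] by (simp add: matrix_mul_assoc)
          moreover have "sl2 (matrix_inv (g ?b))" using sg[OF p(1)[OF a]] by (simp add: sl2_inv)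
          ultimately have "F a \<tau> = F ?b (moebius ?u \<tau>)"
            unfolding F_def by (simp only: moebius_mult[OF _ u \<tau>])
          also have "moebius ?u \<tau> = \<tau> / of_real 1 + of_real (- ?x)" by (simp add: moebius_def)
          finally show ?thesis .
        qed
        have cc: "coord_exp m (w * of_nat (kk (cl a))) (ev (cl a)) (P (cl a)) (F a) (cc a)" if a: "a < d" for a
        proof -
          note pa = p[OF a]
          have "coord_exp m (w * of_nat (kk (cl a))) (ev (cl a)) (P (cl a)) (F (B.pos a 0)) (c0 (B.pos a 0))"
            using coord_exp_of_adm_exp[OF wit'[OF pa(1)] b0[OF pa(1)]] unfolding c0_def[abs_def] pa(2) .
          from coord_exp_affine[OF this, of 1 "- (of_nat (ps a) * w)"]
          show ?thesis unfolding coord_exp_def cc_def by (simp add: Fa[OF a])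
        qed
        \<comment> \<open>Both blocks are translates of the one in position 0, so their coordinates
          differ by the factor for the difference of the two translations.\<close>
        have relc: "cc a n s = cc b n s * q_pow (w * of_nat (kk (cl a))) (mu (ev (cl a) s) + of_int n)
            (of_real (of_int (int (ps b) - int (ps a)) * w))"
          if a: "a < d" and b: "b < d" and ab: "cl a = cl b" and "s < m" for a b n s
        proof -
          have "B.pos a 0 = B.pos b 0" using p[OF a] p[OF b] ab by - (rule inj, auto)
          moreover have "complex_of_real (- (of_nat (ps a) * w))
              = of_real (- (of_nat (ps b) * w)) + of_real (of_int (int (ps b) - int (ps a)) * w)"
            unfolding of_real_add[symmetric] by (simp add: algebra_simps)
          ultimately show ?thesis unfolding cc_def ab by (simp only: q_pow_translate mult_ac)
        qed
        note lw = B.lift_wit[OF wit']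
        have C: "coord_exp (d * m) w (B.lift_ev ev) (B.lift_basis ev P) ?Xt
            (\<lambda>n q. cc (q div m) (int (kk (cl (q div m))) * n + int (ps (q div m))) (q mod m))"
          (is "coord_exp _ _ _ _ _ ?C")
          by (rule B.coord_exp_lift[OF wit' w0 cc relc Xt])
        define a where "a n = B.lift_basis ev P *\<^sub>v Matrix.vec (d * m) (?C n)" for n
        define b where "b i n = P (cl i) *\<^sub>v Matrix.vec m (cc i n)" for i n
        have A1: "adm_exp (d * m) w T ?Xt a"
          unfolding a_def[abs_def] by (rule adm_exp_of_coord_exp(1)[OF lw C])
        have A2: "B.lift_basis_inv ev P' *\<^sub>v a n = Matrix.vec (d * m) (?C n)" for n
          using adm_exp_of_coord_exp(2)[OF lw C, of n] unfolding a_def .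
        have Bi: "adm_exp m (w * of_nat (kk (cl i))) (S (cl i)) (F i) (b i)" "P' (cl i) *\<^sub>v b i n = Matrix.vec m (cc i n)"
          if "i < d" for i n
          using adm_exp_of_coord_exp[OF wit'[OF that] cc[OF that]] by (simp_all add: b_def[abs_def])
        have id: "B.lift_basis_inv ev P' *\<^sub>v a n = block_vec d m (\<lambda>i. of_rat 1 \<cdot>\<^sub>v (P' (cl i) *\<^sub>v b i (int (kk (cl i)) * n + int (ps i))))" for n
          unfolding A2 by (rule block_vec_eqI) (simp_all add: Bi(2) block_index_less)
        have eb: "eigenbasis T (B.lift_basis ev P) (B.lift_basis_inv ev P')"
          unfolding eigenbasis_def using lw by (intro exI[of _ "mat_diag (d * m) (B.lift_ev ev)"]) (auto simp: mat_diag_def diagonal_mat_def)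
        have ebi: "eigenbasis (S (cl i)) (P (cl i)) (P' (cl i))" if "i < d" for i
          unfolding eigenbasis_def using wit'[OF that] by (intro exI[of _ "mat_diag m (ev (cl i))"]) (auto simp: mat_diag_def diagonal_mat_def)
        show ?thesis
          unfolding coefficient_identity_def admissible_expansion_iff data fst_conv snd_conv
        proof (intro conjI allI impI exI)
          fix i assume "i < d"
          then show "eigenbasis (conj_rep (g i) \<rho> (cusp_generator (conj_group (g i) H) Infty)) (P (cl i)) (P' (cl i))"
            "adm_exp m (cusp_width (conj_group (g i) H) Infty)
              (conj_rep (g i) \<rho> (cusp_generator (conj_group (g i) H) Infty)) (F i) (b i)"
            using ebi Bi(1) by (simp_all add: data')
        next
          fix n i
          show "of_int (int (kk (cl i)) * n + int (ps i)) = (of_nat (kk (cl i)) * of_int n + of_nat (ps i) :: rat)" by simp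
        qed (rule eb A1 id)+
      qed
      show "\<exists>g F.
         (\<forall>i<d. g i \<in> carrier SL2R \<and> is_cusp (conj_group (g i) H) Infty \<and>
            weakly_holomorphic_vvaf m (conj_group (g i) H) (conj_rep (g i) \<rho>) (F i)) \<and>
         (admissible H \<rho> \<longrightarrow>
            coefficient_identity d m
              (lift_group G c) (lift_rep m G H c cs As \<rho>) ?Xt
              (\<lambda>i. conj_group (g i) H) (\<lambda>i. conj_rep (g i) \<rho>) F
              (B.lift_basis ev P, B.lift_basis_inv ev P') (\<lambda>i. (P (cl i), P' (cl i)))
              (\<lambda>i. of_nat (kk (cl i))) (\<lambda>i. of_nat (ps i)) (\<lambda>i. 1)) \<and>
         labelled_coefficient_identity d m
           (lift_group G c) (lift_rep m G H c cs As \<rho>) ?Xt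
           (\<lambda>i. conj_group (g i) H) (\<lambda>i. conj_rep (g i) \<rho>) F lev
           (\<lambda>i z j. of_nat (kk (cl i))) (\<lambda>i z j. of_int (off i z)) lrs"
      proof (intro exI[of _ g] exI[of _ F] conjI allI impI)
        fix i assume i: "i < d"
        show "g i \<in> carrier SL2R" using sg[OF i] by simp
        show "is_cusp (conj_group (g i) H) Infty" using cusp[OF i] by (simp add: g_def)
        show "weakly_holomorphic_vvaf m (conj_group (g i) H) (conj_rep (g i) \<rho>) (F i)" by (rule F[OF i])
      qed (rule adm labelled, assumption?)+
    qed
  qed
qed

end
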